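(* Consider the second-order equation $$\phi''-2\phi^3+c\phi=b$$ for a real-valued function $\phi$ of one real variable $x$, with real constants $b,c$; its solutions satisfy the first-order invariant $(\phi')^2=\phi^4-c\phi^2+2b\phi+2d$ for a real constant $d$. Bounded periodic (nonconstant) solutions of the second-order equation exist if and only if $(b,c)\in\Omega$, where $$\Omega=\{(b,c):\ b\in(-b_c,b_c),\ c>0\},\qquad b_c:=\frac{\sqrt{2c^3}}{\sqrt{27}}.$$ These solutions for $b\in(0,b_c)$ and $c>0$ can be uniquely parameterized by real parameters $(\zeta_1,\zeta_2,\zeta_3)$ satisfying $0<\zeta_3<\zeta_2<\zeta_1$ with $$b=4\zeta_1\zeta_2\zeta_3,\quad c=2(\zeta_1^2+\zeta_2^2+\zeta_3^2),\quad d=\tfrac12(\zeta_1^4+\zeta_2^4+\zeta_3^4)-\zeta_1^2\zeta_2^2-\zeta_1^2\zeta_3^2-\zeta_2^2\zeta_3^2.$$ If $\zeta_1\neq\zeta_2+\zeta_3$, the periodic profile $\phi$ is given explicitly by $$\phi(x)=(\zeta_1-\zeta_2-\zeta_3)\frac{H(\nu x-\beta)H(\nu x+\beta)}{\Theta(\nu x-\alpha)\Theta(\nu x+\alpha)}\frac{\Theta^2(\alpha)}{H^2(\beta)},$$ where $\nu>0$, $k\in(0,1)$, $\alpha\in(0,K)$ and $\beta\in(0,K)\cup i(0,K')$ are uniquely expressed by $$\nu=\sqrt{\zeta_1^2-\zeta_3^2},\qquad k=\sqrt{\frac{\zeta_1^2-\zeta_2^2}{\zeta_1^2-\zeta_3^2}},$$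 $$\mathrm{sn}(\alpha)=\sqrt{\frac{\zeta_1-\zeta_3}{\zeta_1+\zeta_2}},\qquad \mathrm{sn}(\beta)=\sqrt{\frac{(\zeta_1+\zeta_3)(\zeta_1-\zeta_2-\zeta_3)}{(\zeta_1-\zeta_2)(\zeta_1+\zeta_2+\zeta_3)}},$$ such that $\beta$ is real for $\zeta_1>\zeta_2+\zeta_3$ and purely imaginary for $\zeta_1<\zeta_2+\zeta_3$. If $\zeta_1=\zeta_2+\zeta_3$, the periodic profile is given by $$\phi(x)=\frac{2(\zeta_2+\zeta_3)\zeta_3\,\mathrm{sn}^2(\nu x)\,\Theta^2(\nu x)\,\Theta^2(\alpha)}{(\zeta_2+2\zeta_3)\,\Theta(\nu x-\alpha)\Theta(\nu x+\alpha)\,\Theta^2(0)},$$ with the same $\nu>0$, $k\in(0,1)$ and $\alpha\in(0,K)$.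
   Context: For an elliptic modulus $k\in(0,1)$, $K=K(k)$ is the complete elliptic integral of the first kind, $k'=\sqrt{1-k^2}$, $K'=K(k')$, and $q=e^{-\pi K'/K}$. Jacobi's theta functions are $\theta_1(y)=2\sum_{n\ge1}(-1)^{n-1}q^{(n-1/2)^2}\sin((2n-1)y)$ and $\theta_4(y)=1+2\sum_{n\ge1}(-1)^nq^{n^2}\cos(2ny)$, and $H(x)=\theta_1\!\left(\frac{\pi x}{2K}\right)$, $\Theta(x)=\theta_4\!\left(\frac{\pi x}{2K}\right)$. $\mathrm{sn},\mathrm{cn},\mathrm{dn}$ denote Jacobi elliptic functions with modulus $k$ (the modulus $k$ defined in the statement). *)

theory Defs
  imports "HOL-Analysis.Analysis"
begin

definition ellF :: "real \<Rightarrow> real \<Rightarrow> real" where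
  "ellF k phi =
     (if 0 \<le> phi then integral {0..phi} (\<lambda>t. 1 / sqrt (1 - k\<^sup>2 * (sin t)\<^sup>2))
      else - integral {phi..0} (\<lambda>t. 1 / sqrt (1 - k\<^sup>2 * (sin t)\<^sup>2)))"

definition ellK :: "real \<Rightarrow> real" where
  "ellK k = ellF k (pi / 2)"

definition ellK' :: "real \<Rightarrow> real" where
  "ellK' k = ellK (sqrt (1 - k\<^sup>2))"

definition jam :: "real \<Rightarrow> real \<Rightarrow> real" where
  "jam k u = (THE phi. ellF k phi = u)"

definition jsn :: "real \<Rightarrow> real \<Rightarrow> real" where
  "jsn k u = sin (jam k u)"

definition nome :: "real \<Rightarrow> real" where
  "nome k = exp (- pi * ellK' k / ellK k)"

text \<open>theta_1(y) = 2 sum_{n>=1} (-1)^(n-1) q^((n-1/2)^2) sin((2n-1) y), index shifted n -> n+1.\<close>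
definition jtheta1 :: "real \<Rightarrow> complex \<Rightarrow> complex" where
  "jtheta1 q y = 2 * (\<Sum>n. (-1) ^ n * complex_of_real (q powr ((real n + 1/2)\<^sup>2))
                              * sin ((2 * of_nat n + 1) * y))"

text \<open>theta_4(y) = 1 + 2 sum_{n>=1} (-1)^n q^(n^2) cos(2 n y), index shifted n -> n+1.\<close>
definition jtheta4 :: "real \<Rightarrow> complex \<Rightarrow> complex" where
  "jtheta4 q y = 1 + 2 * (\<Sum>n. (-1) ^ (n + 1) * complex_of_real (q ^ ((n + 1)\<^sup>2))
                              * cos (2 * of_nat (n + 1) * y))"

definition jH :: "real \<Rightarrow> complex \<Rightarrow> complex" where
  "jH k x = jtheta1 (nome k) (of_real pi * x / (2 * of_real (ellK k)))"

definition jTheta :: "real \<Rightarrow> complex \<Rightarrow> complex" where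
  "jTheta k x = jtheta4 (nome k) (of_real pi * x / (2 * of_real (ellK k)))"

text \<open>sn at a complex argument, via Jacobi's classical representation
  sn(u) = H(u) / (sqrt k * Theta(u)); it agrees with jsn on the reals.\<close>
definition jsnC :: "real \<Rightarrow> complex \<Rightarrow> complex" where
  "jsnC k u = jH k u / (complex_of_real (sqrt k) * jTheta k u)"

definition is_sol :: "real \<Rightarrow> real \<Rightarrow> (real \<Rightarrow> real) \<Rightarrow> bool" where
  "is_sol b c phi \<longleftrightarrow>
     (\<exists>phi'. \<forall>x. (phi has_real_derivative phi' x) (at x) \<and>
                 (phi' has_real_derivative (b + 2 * (phi x) ^ 3 - c * phi x)) (at x))"

definition bpnc :: "(real \<Rightarrow> real) \<Rightarrow> bool" where
  "bpnc phi \<longleftrightarrow> (\<exists>T>0. \<forall>x. phi (x + T) = phi x) \<and> bounded (range phi) \<and>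
                 (\<exists>x y. phi x \<noteq> phi y)"

definition invariant :: "real \<Rightarrow> real \<Rightarrow> real \<Rightarrow> (real \<Rightarrow> real) \<Rightarrow> bool" where
  "invariant b c d phi \<longleftrightarrow>
     (\<forall>x. (deriv phi x)\<^sup>2 = (phi x) ^ 4 - c * (phi x)\<^sup>2 + 2 * b * phi x + 2 * d)"

definition bcrit :: "real \<Rightarrow> real" where
  "bcrit c = sqrt (2 * c ^ 3) / sqrt 27"

definition zb :: "real \<Rightarrow> real \<Rightarrow> real \<Rightarrow> real" where
  "zb z1 z2 z3 = 4 * z1 * z2 * z3"

definition zc :: "real \<Rightarrow> real \<Rightarrow> real \<Rightarrow> real" where
  "zc z1 z2 z3 = 2 * (z1\<^sup>2 + z2\<^sup>2 + z3\<^sup>2)"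

definition zd :: "real \<Rightarrow> real \<Rightarrow> real \<Rightarrow> real" where
  "zd z1 z2 z3 = (z1 ^ 4 + z2 ^ 4 + z3 ^ 4) / 2 - z1\<^sup>2 * z2\<^sup>2 - z1\<^sup>2 * z3\<^sup>2 - z2\<^sup>2 * z3\<^sup>2"

definition znu :: "real \<Rightarrow> real \<Rightarrow> real \<Rightarrow> real" where
  "znu z1 z2 z3 = sqrt (z1\<^sup>2 - z3\<^sup>2)"

definition zk :: "real \<Rightarrow> real \<Rightarrow> real \<Rightarrow> real" where
  "zk z1 z2 z3 = sqrt ((z1\<^sup>2 - z2\<^sup>2) / (z1\<^sup>2 - z3\<^sup>2))"

text \<open>Profile in the case zeta1 /= zeta2 + zeta3 (complex-valued expression; beta may be imaginary).\<close>
definition profA :: "real \<Rightarrow> real \<Rightarrow> real \<Rightarrow> real \<Rightarrow> complex \<Rightarrow> real \<Rightarrow> complex" where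
  "profA z1 z2 z3 alpha beta x =
     (let nu = znu z1 z2 z3; k = zk z1 z2 z3; y = complex_of_real (nu * x) in
       complex_of_real (z1 - z2 - z3)
       * (jH k (y - beta) * jH k (y + beta))
       / (jTheta k (y - of_real alpha) * jTheta k (y + of_real alpha))
       * ((jTheta k (of_real alpha))\<^sup>2 / (jH k beta)\<^sup>2))"

definition profB :: "real \<Rightarrow> real \<Rightarrow> real \<Rightarrow> real \<Rightarrow> real \<Rightarrow> complex" where
  "profB z1 z2 z3 alpha x =
     (let nu = znu z1 z2 z3; k = zk z1 z2 z3; y = complex_of_real (nu * x) in
       (complex_of_real (2 * (z2 + z3) * z3 * (jsn k (nu * x))\<^sup>2)
         * (jTheta k y)\<^sup>2 * (jTheta k (of_real alpha))\<^sup>2)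
       / (complex_of_real (z2 + 2 * z3) * jTheta k (y - of_real alpha) * jTheta k (y + of_real alpha)
          * (jTheta k 0)\<^sup>2))"

definition alpha_ok :: "real \<Rightarrow> real \<Rightarrow> real \<Rightarrow> real \<Rightarrow> bool" where
  "alpha_ok z1 z2 z3 alpha \<longleftrightarrow>
     (let k = zk z1 z2 z3 in
       0 < alpha \<and> alpha < ellK k \<and> jsn k alpha = sqrt ((z1 - z3) / (z1 + z2)))"

definition beta_set :: "real \<Rightarrow> complex set" where
  "beta_set k = complex_of_real ` {0<..<ellK k} \<union> (\<lambda>v. \<i> * complex_of_real v) ` {0<..<ellK' k}"

definition beta_ok :: "real \<Rightarrow> real \<Rightarrow> real \<Rightarrow> complex \<Rightarrow> bool" where
  "beta_ok z1 z2 z3 beta \<longleftrightarrow>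
     (let k = zk z1 z2 z3 in
       beta \<in> beta_set k \<and>
       jsnC k beta = csqrt (complex_of_real
          ((z1 + z3) * (z1 - z2 - z3) / ((z1 - z2) * (z1 + z2 + z3)))))"

end

theory Submission
  imports Defs "HOL-Complex_Analysis.Complex_Analysis"
begin

text \<open>
  A bounded periodic solution attains its minimum \<open>m\<close> and maximum \<open>M\<close> at roots of the quartic
  \<open>\<phi>\<^sup>4 - c \<phi>\<^sup>2 + 2 b \<phi> + 2 d\<close>; uniqueness for the second-order equation makes these roots simple, and
  since the quartic has no cubic term the two remaining roots are real and enclose \<open>[m, M]\<close>. The
  \<open>\<zeta>\<^sub>i\<close> are half sums of the roots, and up to translation the solution is a Moebius function of
  \<open>sn\<^sup>2\<close>.

  To express it by theta functions, all theta identities are reduced to one bilinear formula between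
  the series with nomes \<open>q\<close> and \<open>q\<^sup>2\<close>. It gives the addition formulas, and through the
  duplication \<open>q \<mapsto> q\<^sup>2\<close> it also locates the zeros, which are obvious for small \<open>q\<close>.
  The addition formulas turn into a differential equation for \<open>\<theta>\<^sub>1 / \<theta>\<^sub>4\<close>; read along the real
  axis it identifies the quotient with \<open>sn\<close> and its half period with \<open>K\<close>, read along the imaginary
  axis up to the first pole it produces \<open>K'\<close>. Hence \<open>q\<close> is the nome of the modulus
  \<open>\<theta>\<^sub>2(0)\<^sup>2 / \<theta>\<^sub>3(0)\<^sup>2\<close>, and the nome is an injective function of the modulus.
\<close>

section \<open>Theta series\<close>

text \<open>The statement starts from \<open>k\<close> and takes its nome from elliptic integrals,
  whereas theta identities are statements about \<open>q\<close>. The work therefore runs backwards: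
  an arbitrary \<open>q\<close> yields a modulus \<open>kap\<close>, then
  \<open>nome kap = q\<close> is shown, and monotonicity of \<open>nome\<close> returns to a given
  \<open>k\<close>. The obstacle is \<open>K'\<close>. Instead of Poisson summation or contour
  integrals, the differential equation of the quotient is integrated from 0 to its first pole on the
  imaginary axis. This requires knowing exactly where \<open>jtheta4\<close> first vanishes, hence a
  zero-free strip of optimal width and not merely nonvanishing on the reals. On the side of the
  solutions, \<open>b\<close> and \<open>c\<close> leave a one-parameter family of orbits, and
  \<open>d\<close> selects one of them. So uniqueness of the parameters passes through the
  first-order invariant, while existence for given \<open>b, c\<close> involves a choice.\<close>

lemma has_sum_int_split:
  fixes f :: "int \<Rightarrow> 'a :: {topological_comm_monoid_add, t2_space}"
  assumes "((\<lambda>n. f (int n)) has_sum a) UNIV" "((\<lambda>n. f (- int n - 1)) has_sum b) UNIV"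
  shows "(f has_sum (a + b)) UNIV"
proof -
  have 1: "(f has_sum a) (range int)"
    using assms(1) by (subst has_sum_reindex) (auto simp: o_def inj_on_def)
  have 2: "(f has_sum b) (range (\<lambda>n. - int n - 1))"
    using assms(2) by (subst has_sum_reindex) (auto simp: o_def inj_on_def)
  have 3: "range int \<union> range (\<lambda>n. - int n - 1) = UNIV"
  proof -
    have "x \<in> range int \<union> range (\<lambda>n. - int n - 1)" for x :: int
    proof (cases "x \<ge> 0")
      case True
      then have "x = int (nat x)" by simp
      then show ?thesis by blast
    next
      case False
      then have "x = - int (nat (- x - 1)) - 1" by simp
      then show ?thesis by blast
    qed
    then show ?thesis by blast
  qed
  have 4: "range int \<inter> range (\<lambda>n. - int n - 1) = {}"
    by auto
  show ?thesis using has_sum_Un_disjoint[OF 1 2 4] 3 by simp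
qed

lemma summable_on_exp_neg_abs_int: "(\<lambda>n::int. exp (- \<bar>real_of_int n\<bar>)) summable_on UNIV"
proof -
  have g: "(\<lambda>n. exp (-1::real) ^ n) summable_on UNIV"
    by (intro norm_summable_imp_summable_on) (auto simp: norm_power intro!: summable_geometric)
  have 1: "(\<lambda>n. exp (- \<bar>real_of_int (int n)\<bar>)) summable_on UNIV"
    using g by (simp add: exp_of_nat_mult[symmetric])
  have "(\<lambda>n. exp (-1) * exp (-1::real) ^ n) summable_on UNIV"
    using g by (rule summable_on_cmult_right)
  also have "(\<lambda>n. exp (-1) * exp (-1::real) ^ n) = (\<lambda>n. exp (- \<bar>real_of_int (- int n - 1)\<bar>))"
    by (rule ext) (simp add: exp_of_nat_mult[symmetric] exp_add[symmetric])
  finally have 2: "(\<lambda>n. exp (- \<bar>real_of_int (- int n - 1)\<bar>)) summable_on UNIV" .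
  show ?thesis
    using has_sum_int_split[OF has_sum_infsum[OF 1] has_sum_infsum[OF 2]] by (rule has_sum_imp_summable)
qed

definition theta_term :: "real \<Rightarrow> real \<Rightarrow> complex \<Rightarrow> int \<Rightarrow> complex" where
  "theta_term q a z n = of_real (q powr ((of_int n + a)\<^sup>2)) * exp (2 * \<i> * of_real (of_int n + a) * z)"

text \<open>\<open>a = 0\<close> gives \<open>\<theta>\<^sub>3\<close> and \<open>a = 1/2\<close> gives \<open>\<theta>\<^sub>2\<close>; \<open>\<theta>\<^sub>4\<close> and \<open>\<theta>\<^sub>1\<close>
  are the same series at \<open>z - \<pi>/2\<close>.\<close>

definition theta_ser :: "real \<Rightarrow> real \<Rightarrow> complex \<Rightarrow> complex" where
  "theta_ser q a z = (\<Sum>\<^sub>\<infinity>n. theta_term q a z n)"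

text \<open>With each term a single exponential, identities between terms become identities between
  quadratic polynomials in the exponent.\<close>

lemma theta_term_eq_exp:
  assumes "0 < q"
  shows "theta_term q a z n = exp ((of_int n + of_real a)\<^sup>2 * of_real (ln q) + 2 * \<i> * (of_int n + of_real a) * z)"
proof -
  have "complex_of_real (q powr ((of_int n + a)\<^sup>2)) = exp (of_real ((of_int n + a)\<^sup>2 * ln q))"
    unfolding exp_of_real using assms by (simp add: powr_def)
  then show ?thesis by (simp add: theta_term_def exp_add)
qed

text \<open>Completing the square in \<open>\<bar>n + a\<bar>\<close>: the Gaussian factor absorbs
  the growth \<open>exp (2 * B * \<bar>n + a\<bar>)\<close> and one further factor
  \<open>exp \<bar>n + a\<bar>\<close>. What is left is summable and uniform in the strip of half
  width \<open>B\<close>.\<close>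

lemma norm_tht_le:
  assumes q: "0 < q" "q < 1" and B: "\<bar>Im z\<bar> \<le> B"
  shows "norm (theta_term q a z n) \<le> exp ((2*B+1)\<^sup>2 / (4 * (- ln q)) + \<bar>a\<bar>) * exp (- \<bar>real_of_int n\<bar>)"
proof -
  define l where "l = - ln q"
  define m where "m = real_of_int n + a"
  have l: "l > 0" using q by (simp add: l_def)
  have "norm (theta_term q a z n) = exp (- l * m\<^sup>2 - 2 * m * Im z)"
    using q by (simp add: theta_term_def norm_mult powr_def l_def m_def exp_add[symmetric] algebra_simps)
  also have "- l * m\<^sup>2 - 2 * m * Im z \<le> (2*B+1)\<^sup>2 / (4 * l) + \<bar>a\<bar> - \<bar>real_of_int n\<bar>"
  proof -
    have 1: "- (m * Im z) \<le> \<bar>m\<bar> * B"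
      using mult_left_mono[OF B, of "\<bar>m\<bar>"] by (simp add: abs_mult[symmetric])
    have "0 \<le> l * (\<bar>m\<bar> - (2*B+1) / (2*l))\<^sup>2" using l by simp
    also have "\<dots> = l * \<bar>m\<bar>\<^sup>2 - (2*B+1) * \<bar>m\<bar> + (2*B+1)\<^sup>2 / (4*l)"
      using l by (simp add: power2_diff power_divide power_mult_distrib field_simps power2_eq_square[of l])
    finally have 2: "0 \<le> l * m\<^sup>2 - 2 * (\<bar>m\<bar> * B) - \<bar>m\<bar> + (2*B+1)\<^sup>2 / (4*l)"
      by (simp add: algebra_simps)
    have 3: "- \<bar>m\<bar> \<le> \<bar>a\<bar> - \<bar>real_of_int n\<bar>" unfolding m_def by linarith
    show ?thesis using 1 2 3 by linarith
  qed
  finally show ?thesis by (simp add: l_def flip: exp_add)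
qed

lemma theta_term_abs_summable:
  assumes "0 < q" "q < 1"
  shows "(\<lambda>n. norm (theta_term q a z n)) summable_on UNIV"
proof (rule summable_on_comparison_test)
  show "(\<lambda>n::int. exp ((2*\<bar>Im z\<bar>+1)\<^sup>2 / (4 * (- ln q)) + \<bar>a\<bar>) * exp (- \<bar>real_of_int n\<bar>)) summable_on UNIV"
    by (intro summable_on_cmult_right summable_on_exp_neg_abs_int)
qed (use norm_tht_le[OF assms order.refl] in auto)

lemma theta_ser_has_sum:
  assumes "0 < q" "q < 1"
  shows "(theta_term q a z has_sum theta_ser q a z) UNIV"
  unfolding theta_ser_def
  using abs_summable_summable[OF theta_term_abs_summable[OF assms]] by (rule has_sum_infsum)

lemma theta_ser_holomorphic:
  assumes q: "0 < q" "q < 1"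
  shows "theta_ser q a holomorphic_on A"
proof -
  have "theta_ser q a field_differentiable (at w)" for w
  proof -
    have "uniform_limit (cball w 1) (\<lambda>X z. \<Sum>n\<in>X. theta_term q a z n) (\<lambda>z. \<Sum>\<^sub>\<infinity>n. theta_term q a z n)
            (finite_subsets_at_top UNIV)"
    proof (rule Weierstrass_m_test_general)
      fix n :: int and z assume "z \<in> cball w 1"
      then have "norm (z - w) \<le> 1" by (simp add: dist_norm norm_minus_commute)
      then have "\<bar>Im z - Im w\<bar> \<le> 1" using abs_Im_le_cmod[of "z - w"] by simp
      then have "\<bar>Im z\<bar> \<le> \<bar>Im w\<bar> + 1" by linarith
      from norm_tht_le[OF q this, where a = a and n = n]
      show "norm (theta_term q a z n) \<le> exp ((2*(\<bar>Im w\<bar>+1)+1)\<^sup>2 / (4 * (- ln q)) + \<bar>a\<bar>) * exp (- \<bar>real_of_int n\<bar>)" .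
    qed (intro summable_on_cmult_right summable_on_exp_neg_abs_int)
    then have "uniform_limit (cball w 1) (\<lambda>X z. \<Sum>n\<in>X. theta_term q a z n) (theta_ser q a) (finite_subsets_at_top UNIV)"
      unfolding theta_ser_def .
    then have "theta_ser q a holomorphic_on ball w 1"
      by (rule holomorphic_uniform_limit[rotated])
         (auto simp: theta_term_def intro!: always_eventually holomorphic_intros continuous_intros)
    then show ?thesis
      by (rule holomorphic_on_imp_differentiable_at) auto
  qed
  then show ?thesis
    by (auto simp: holomorphic_on_def intro: field_differentiable_at_within)
qed

lemma theta_ser_add_one: "theta_ser q (a + 1) z = theta_ser q a z"
  unfolding theta_ser_def
  by (rule infsum_reindex_bij_witness[where i = "\<lambda>n. n - 1" and j = "\<lambda>n. n + 1"])
     (auto simp: theta_term_def algebra_simps)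

lemma theta_ser_minus: "theta_ser q a (- z) = theta_ser q (- a) z"
  unfolding theta_ser_def
proof (rule infsum_reindex_bij_witness[where i = uminus and j = uminus])
  fix n :: int
  have "(- of_int n - a)\<^sup>2 = (of_int n + a)\<^sup>2" by (simp add: power2_eq_square algebra_simps)
  moreover have "exp (2 * \<i> * of_real (of_int (- n) + - a) * z) = exp (2 * \<i> * of_real (of_int n + a) * (- z))"
    by (rule arg_cong[where f = exp]) (simp add: algebra_simps)
  ultimately show "theta_term q (- a) z (- n) = theta_term q a (- z) n" by (simp add: theta_term_def)
qed auto

lemma theta_ser_half_minus: "theta_ser q (1/2) (- z) = theta_ser q (1/2) z"
  using theta_ser_minus[of q "1/2" z] theta_ser_add_one[of q "- 1/2" z] by simp

lemma theta_ser_0_minus: "theta_ser q 0 (- z) = theta_ser q 0 z"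
  using theta_ser_minus[of q 0 z] by simp

lemma theta_ser_cnj: "cnj (theta_ser q a z) = theta_ser q a (- cnj z)"
  unfolding theta_ser_def theta_term_def by (subst infsum_cnj[symmetric]) (simp add: exp_cnj)

lemma exp_2ipi_int: "exp (2 * \<i> * of_int n * of_real pi) = 1"
  using exp_integer_2pi[of "of_int n"] by (simp add: mult_ac)

lemma theta_ser_add_pi: "theta_ser q a (z + of_real pi) = exp (2 * \<i> * of_real a * of_real pi) * theta_ser q a z"
proof -
  have "theta_term q a (z + of_real pi) n = exp (2 * \<i> * of_real a * of_real pi) * theta_term q a z n" for n
  proof -
    have "2 * \<i> * of_real (of_int n + a) * (z + of_real pi)
        = 2 * \<i> * of_real (of_int n + a) * z + 2 * \<i> * of_real a * of_real pi
          + 2 * \<i> * of_int n * of_real pi"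
      by (simp add: algebra_simps)
    then show ?thesis by (simp add: theta_term_def exp_add exp_2ipi_int)
  qed
  then have "(\<Sum>\<^sub>\<infinity>n. theta_term q a (z + of_real pi) n) = (\<Sum>\<^sub>\<infinity>n. exp (2 * \<i> * of_real a * of_real pi) * theta_term q a z n)" by (rule infsum_cong)
  then show ?thesis unfolding theta_ser_def infsum_cmult_right' .
qed

lemma theta_ser_0_add_pi: "theta_ser q 0 (z + of_real pi) = theta_ser q 0 z"
  by (simp add: theta_ser_add_pi)

lemma theta_ser_half_add_pi: "theta_ser q (1/2) (z + of_real pi) = - theta_ser q (1/2) z"
  using exp_pi_i by (simp add: theta_ser_add_pi mult_ac)

text \<open>The substitution \<open>(m, n) \<mapsto> (m + n, m - n)\<close>, split by the parity of \<open>m + n\<close>.\<close>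
lemma theta_ser_mult:
  assumes q: "0 < q" "q < 1"
  shows "theta_ser q a x * theta_ser q a y =
     theta_ser (q\<^sup>2) a (x + y) * theta_ser (q\<^sup>2) 0 (x - y) + theta_ser (q\<^sup>2) (a + 1/2) (x + y) * theta_ser (q\<^sup>2) (1/2) (x - y)"
proof -
  have q2: "0 < q\<^sup>2" "q\<^sup>2 < 1" using q by (auto simp: power_less_one_iff)
  have prod: "((\<lambda>(m, n). theta_term q a x m * theta_term p b y n) has_sum theta_ser q a x * theta_ser p b y) UNIV"
    if "0 < q" "q < 1" "0 < p" "p < 1" for q p a b x y
  proof -
    have "(\<lambda>(m, n). theta_term q a x m * theta_term p b y n) summable_on (UNIV \<times> UNIV)"
    proof (rule abs_summable_summable)
      have "(\<lambda>p'. norm (case p' of (m, n) \<Rightarrow> theta_term q a x m * theta_term p b y n)) summable_on (SIGMA m:UNIV. UNIV)"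
        using theta_term_abs_summable[OF that(1,2), of a x] theta_term_abs_summable[OF that(3,4), of b y]
        by (intro summable_on_SigmaI[where g = "\<lambda>m. norm (theta_term q a x m) * (\<Sum>\<^sub>\<infinity>n. norm (theta_term p b y n))"])
           (auto simp: norm_mult intro!: has_sum_cmult_right summable_on_cmult_left has_sum_infsum simp del: norm_exp_eq_Re)
      then show "(\<lambda>p'. norm (case p' of (m, n) \<Rightarrow> theta_term q a x m * theta_term p b y n)) summable_on (UNIV \<times> UNIV)" .
    qed
    then have *: "((\<lambda>(m, n). theta_term q a x m * theta_term p b y n) has_sum theta_ser q a x * theta_ser p b y) (SIGMA m:UNIV. UNIV)"
      by (intro has_sum_SigmaI[where g = "\<lambda>m. theta_term q a x m * theta_ser p b y"])
         (auto intro!: has_sum_cmult_right has_sum_cmult_left theta_ser_has_sum that)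
    then show ?thesis by simp
  qed
  define f where "f = (\<lambda>(m, n). theta_term q a x m * theta_term q a y n)"
  define e where "e = (\<lambda>(k::int, l::int). (k + l, k - l))"
  define o' where "o' = (\<lambda>(k::int, l::int). (k + l + 1, k - l))"
  have ln2: "complex_of_real (ln (q\<^sup>2)) = 2 * of_real (ln q)"
    using q by (simp add: ln_realpow)
  \<comment> \<open>For m = k + l, n = k - l the squares (m + a)^2 and (n + a)^2 add up to 2((k +
    a)^2 + l^2), which explains the nome \<open>q\<^sup>2\<close>, and the linear parts regroup to
    (k + a)(x + y) + l(x - y). In the odd case both k + a and l gain 1/2.\<close>
  have fe: "f (e (k, l)) = theta_term (q\<^sup>2) a (x + y) k * theta_term (q\<^sup>2) 0 (x - y) l" for k l
    unfolding f_def e_def using q2 q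
    by (simp add: theta_term_eq_exp ln2 exp_add[symmetric])
       (rule arg_cong[where f = exp], simp add: algebra_simps power2_eq_square)
  have fo: "f (o' (k, l)) = theta_term (q\<^sup>2) (a + 1/2) (x + y) k * theta_term (q\<^sup>2) (1/2) (x - y) l" for k l
    unfolding f_def o'_def using q2 q
    by (simp add: theta_term_eq_exp ln2 exp_add[symmetric])
       (rule arg_cong[where f = exp], simp add: field_simps power2_eq_square)
  have fe': "f (e p) = theta_term (q\<^sup>2) a (x + y) (fst p) * theta_term (q\<^sup>2) 0 (x - y) (snd p)"
    and fo': "f (o' p) = theta_term (q\<^sup>2) (a + 1/2) (x + y) (fst p) * theta_term (q\<^sup>2) (1/2) (x - y) (snd p)" for p
    using fe[of "fst p" "snd p"] fo[of "fst p" "snd p"] by simp_all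
  have inj: "inj e" "inj o'"
    by (auto simp: inj_def e_def o'_def)
  have E: "(f has_sum theta_ser (q\<^sup>2) a (x + y) * theta_ser (q\<^sup>2) 0 (x - y)) (range e)"
    using prod[OF q2 q2, of a "x + y" 0 "x - y"] inj
    by (subst has_sum_reindex) (auto simp: o_def fe' case_prod_unfold)
  have O: "(f has_sum theta_ser (q\<^sup>2) (a + 1/2) (x + y) * theta_ser (q\<^sup>2) (1/2) (x - y)) (range o')"
    using prod[OF q2 q2, of "a + 1/2" "x + y" "1/2" "x - y"] inj
    by (subst has_sum_reindex) (auto simp: o_def fo' case_prod_unfold)
  have disj: "range e \<inter> range o' = {}"
    by (auto simp: e_def o'_def) presburger
  have un: "range e \<union> range o' = UNIV"
  proof -
    have "(m, n) \<in> range e \<union> range o'" for m n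
    proof (cases "even (m + n)")
      case True
      then have "e ((m + n) div 2, m - (m + n) div 2) = (m, n)"
        unfolding e_def by auto
      then show ?thesis by (metis UnI1 rangeI)
    next
      case False
      then have "o' ((m + n - 1) div 2, m - (m + n - 1) div 2 - 1) = (m, n)"
        unfolding o'_def by auto
      then show ?thesis by (metis UnI2 rangeI)
    qed
    then show ?thesis by auto
  qed
  have "(f has_sum (theta_ser (q\<^sup>2) a (x + y) * theta_ser (q\<^sup>2) 0 (x - y)
     + theta_ser (q\<^sup>2) (a + 1/2) (x + y) * theta_ser (q\<^sup>2) (1/2) (x - y))) UNIV"
    using has_sum_Un_disjoint[OF E O disj] un by simp
  moreover have "(f has_sum (theta_ser q a x * theta_ser q a y)) UNIV"
    unfolding f_def by (rule prod) (use q in auto)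
  ultimately show ?thesis using has_sum_unique by blast
qed

text \<open>With \<open>q\<close> = exp(i pi tau) the displacement is the half quasi-period pi tau /
  2. It adds n ln q to the exponent, and completing the square replaces n by n + 1/2 at the price of
  the two factors in front.\<close>

lemma theta_ser_shift:
  assumes q: "0 < q" "q < 1"
  shows "theta_ser q 0 (z - \<i> * of_real (ln q / 2)) = of_real (q powr (-1/4)) * exp (- \<i> * z) * theta_ser q (1/2) z"
proof -
  have "theta_term q 0 (z - \<i> * of_real (ln q / 2)) n
      = of_real (q powr (-1/4)) * exp (- \<i> * z) * theta_term q (1/2) z n" for n
  proof -
    have "complex_of_real (q powr (-1/4)) = exp (of_real (- ln q / 4))"
      unfolding exp_of_real using q by (simp add: powr_def)
    then show ?thesis
      using q by (simp add: theta_term_eq_exp exp_add[symmetric])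
        (rule arg_cong[where f = exp], simp add: field_simps power2_eq_square)
  qed
  then have "(\<Sum>\<^sub>\<infinity>n. theta_term q 0 (z - \<i> * of_real (ln q / 2)) n) = (\<Sum>\<^sub>\<infinity>n. (of_real (q powr (-1/4)) * exp (- \<i> * z)) * theta_term q (1/2) z n)" by (rule infsum_cong)
  then show ?thesis unfolding theta_ser_def infsum_cmult_right' .
qed

section \<open>Jacobi's theta functions\<close>

lemma has_sum_int_imp_sums:
  fixes f :: "int \<Rightarrow> 'a :: banach"
  assumes "(f has_sum S) UNIV"
  obtains a b where "(\<lambda>n. f (int n)) sums a" "(\<lambda>n. f (- int n - 1)) sums b" "S = a + b"
proof -
  have sm: "f summable_on A" for A
    using summable_on_subset_banach[OF has_sum_imp_summable[OF assms]] by blast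
  have 1: "(\<lambda>n. f (int n)) summable_on UNIV"
    using sm[of "range int"] by (subst (asm) summable_on_reindex) (auto simp: inj_on_def o_def)
  have 2: "(\<lambda>n. f (- int n - 1)) summable_on UNIV"
    using sm[of "range (\<lambda>n. - int n - 1)"] by (subst (asm) summable_on_reindex) (auto simp: inj_on_def o_def)
  note * = has_sum_infsum[OF 1] has_sum_infsum[OF 2]
  show ?thesis
    using that[OF has_sum_imp_sums[OF *(1)] has_sum_imp_sums[OF *(2)]]
      has_sum_unique[OF assms has_sum_int_split[OF *]] by blast
qed

lemma cos_odd_shift: "cos ((2 * of_nat n + 1) * (z - of_real pi / 2)) = (-1) ^ n * sin ((2 * of_nat n + 1) * (z::complex))"
proof -
  have e: "(2 * of_nat n + 1) * (z - of_real pi / 2) = ((2 * of_nat n + 1) * z - of_real pi / 2) - of_real (of_nat n * pi)"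
    by (simp add: field_simps)
  have c: "cos (complex_of_real (of_nat n * pi)) = (-1) ^ n" "sin (complex_of_real (of_nat n * pi)) = 0"
    unfolding cos_of_real sin_of_real by (simp_all add: cos_npi)
  show ?thesis unfolding e cos_diff[of _ "of_real (of_nat n * pi)"] c
    by (simp add: cos_diff)
qed

lemma cos_even_shift: "cos (2 * of_nat n * (z - of_real pi / 2)) = (-1) ^ n * cos (2 * of_nat n * (z::complex))"
proof -
  have e: "2 * of_nat n * (z - of_real pi / 2) = 2 * of_nat n * z - of_real (of_nat n * pi)"
    by (simp add: field_simps)
  have c: "cos (complex_of_real (of_nat n * pi)) = (-1) ^ n" "sin (complex_of_real (of_nat n * pi)) = 0"
    unfolding cos_of_real sin_of_real by (simp_all add: cos_npi)
  show ?thesis unfolding e cos_diff[of _ "of_real (of_nat n * pi)"] c by simp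
qed

text \<open>The indices n and -n-1 give the opposite frequencies n + 1/2 and -(n + 1/2) with equal
  weight, so each pair is a cosine; the displacement by pi/2 turns it into the alternating
  sine.\<close>

lemma jtheta1_sums:
  assumes q: "0 < q" "q < 1"
  shows "(\<lambda>n. 2 * ((-1) ^ n * complex_of_real (q powr ((real n + 1/2)\<^sup>2)) * sin ((2 * of_nat n + 1) * z)))
           sums theta_ser q (1/2) (z - of_real pi / 2)"
proof -
  define w where "w = z - complex_of_real pi / 2"
  obtain a b where ab: "(\<lambda>n. theta_term q (1/2) w (int n)) sums a" "(\<lambda>n. theta_term q (1/2) w (- int n - 1)) sums b"
      "theta_ser q (1/2) w = a + b"
    using has_sum_int_imp_sums[OF theta_ser_has_sum[OF q, of "1/2" w]] by metis
  have "theta_term q (1/2) w (int n) + theta_term q (1/2) w (- int n - 1)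
      = 2 * ((-1) ^ n * complex_of_real (q powr ((real n + 1/2)\<^sup>2)) * sin ((2 * of_nat n + 1) * z))" for n
  proof -
    have "theta_term q (1/2) w (int n) + theta_term q (1/2) w (- int n - 1)
      = complex_of_real (q powr ((real n + 1/2)\<^sup>2)) *
         (exp (\<i> * ((2 * of_nat n + 1) * w)) + exp (- (\<i> * ((2 * of_nat n + 1) * w))))"
    proof -
      have "2 * \<i> * of_real (of_int (int n) + 1/2) * w = \<i> * ((2 * of_nat n + 1) * w)"
        "2 * \<i> * of_real (of_int (- int n - 1) + 1/2) * w = - (\<i> * ((2 * of_nat n + 1) * w))"
        by (simp_all add: algebra_simps)
      moreover have "(real_of_int (int n) + 1/2)\<^sup>2 = (real n + 1/2)\<^sup>2"
        "(real_of_int (- int n - 1) + 1/2)\<^sup>2 = (real n + 1/2)\<^sup>2"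
        by (simp_all add: power2_eq_square algebra_simps)
      ultimately show ?thesis by (simp only: theta_term_def distrib_left)
    qed
    also have "exp (\<i> * ((2 * of_nat n + 1) * w)) + exp (- (\<i> * ((2 * of_nat n + 1) * w)))
        = 2 * cos ((2 * of_nat n + 1) * w)"
      by (simp add: cos_exp_eq)
    also have "cos ((2 * of_nat n + 1) * w) = (-1) ^ n * sin ((2 * of_nat n + 1) * z)"
      unfolding w_def by (rule cos_odd_shift)
    finally show ?thesis by (simp add: mult_ac)
  qed
  then show ?thesis using sums_add[OF ab(1,2)] ab(3) by (simp add: w_def)
qed

lemma jtheta1_eq_th:
  assumes q: "0 < q" "q < 1"
  shows "jtheta1 q z = theta_ser q (1/2) (z - of_real pi / 2)"
proof -
  have "(\<lambda>n. (-1) ^ n * complex_of_real (q powr ((real n + 1/2)\<^sup>2)) * sin ((2 * of_nat n + 1) * z))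
      sums (theta_ser q (1/2) (z - of_real pi / 2) / 2)"
    using sums_divide[OF jtheta1_sums[OF q, of z], of 2] by simp
  then show ?thesis unfolding jtheta1_def by (simp add: sums_iff mult.commute)
qed

lemma jtheta4_eq_th:
  assumes q: "0 < q" "q < 1"
  shows "jtheta4 q z = theta_ser q 0 (z - of_real pi / 2)"
proof -
  define w where "w = z - complex_of_real pi / 2"
  obtain a b where ab: "(\<lambda>n. theta_term q 0 w (int n)) sums a" "(\<lambda>n. theta_term q 0 w (- int n - 1)) sums b"
      "theta_ser q 0 w = a + b"
    using has_sum_int_imp_sums[OF theta_ser_has_sum[OF q, of 0 w]] by metis
  \<comment> \<open>For \<open>a = 0\<close> opposite frequencies are n + 1 and -n-1, so the
    unpaired term at 0, which equals 1, is split off first.\<close>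
  have a': "(\<lambda>n. theta_term q 0 w (int n + 1)) sums (a - 1)"
    using sums_split_initial_segment[OF ab(1), of 1] q by (simp add: theta_term_def add.commute)
  have "theta_term q 0 w (int n + 1) + theta_term q 0 w (- int n - 1)
      = 2 * ((-1) ^ (n + 1) * complex_of_real (q ^ ((n + 1)\<^sup>2)) * cos (2 * of_nat (n + 1) * z))" for n
  proof -
    have p: "q powr ((real n + 1)\<^sup>2) = q ^ ((n + 1)\<^sup>2)"
      using powr_realpow[OF q(1), of "(n + 1)\<^sup>2"] by (simp add: add.commute)
    have "theta_term q 0 w (int n + 1) + theta_term q 0 w (- int n - 1)
      = complex_of_real (q powr ((real n + 1)\<^sup>2)) *
         (exp (\<i> * (2 * of_nat (n + 1) * w)) + exp (- (\<i> * (2 * of_nat (n + 1) * w))))"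
    proof -
      have "2 * \<i> * of_real (of_int (int n + 1) + 0) * w = \<i> * (2 * of_nat (n + 1) * w)"
        "2 * \<i> * of_real (of_int (- int n - 1) + 0) * w = - (\<i> * (2 * of_nat (n + 1) * w))"
        by (simp_all add: algebra_simps)
      moreover have "(real_of_int (int n + 1) + 0)\<^sup>2 = (real n + 1)\<^sup>2"
        "(real_of_int (- int n - 1) + 0)\<^sup>2 = (real n + 1)\<^sup>2"
        by (simp_all add: power2_eq_square algebra_simps)
      ultimately show ?thesis by (simp only: theta_term_def distrib_left)
    qed
    also have "exp (\<i> * (2 * of_nat (n + 1) * w)) + exp (- (\<i> * (2 * of_nat (n + 1) * w)))
        = 2 * cos (2 * of_nat (n + 1) * w)"
      by (simp add: cos_exp_eq)
    also have "cos (2 * of_nat (n + 1) * w) = (-1) ^ (n + 1) * cos (2 * of_nat (n + 1) * z)"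
      unfolding w_def by (rule cos_even_shift)
    finally show ?thesis unfolding p by (simp add: mult_ac)
  qed
  then have "(\<lambda>n. 2 * ((-1) ^ (n + 1) * complex_of_real (q ^ ((n + 1)\<^sup>2)) * cos (2 * of_nat (n + 1) * z)))
      sums (theta_ser q 0 w - 1)"
    using sums_add[OF a' ab(2)] ab(3) by (simp add: diff_add_eq)
  from sums_divide[OF this, of 2]
  have "(\<lambda>n. (-1) ^ (n + 1) * complex_of_real (q ^ ((n + 1)\<^sup>2)) * cos (2 * of_nat (n + 1) * z))
      sums ((theta_ser q 0 w - 1) / 2)" by simp
  note e = sums_unique[OF this, symmetric]
  show ?thesis unfolding jtheta4_def e by (simp add: w_def field_simps)
qed

lemma theta_ser_0_real_pos:
  assumes q: "0 < q" "q < 1"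
  shows "theta_ser q a 0 = of_real (Re (theta_ser q a 0))" "Re (theta_ser q a 0) > 0"
proof -
  have e: "theta_term q a 0 = (\<lambda>n. of_real (q powr (of_int n + a)\<^sup>2))"
    by (rule ext) (simp add: theta_term_def)
  have h: "((\<lambda>n. complex_of_real (q powr (of_int n + a)\<^sup>2)) has_sum theta_ser q a 0) UNIV"
    using theta_ser_has_sum[OF q, of a 0] e by simp
  then have r: "((\<lambda>n. q powr (of_int n + a)\<^sup>2) has_sum Re (theta_ser q a 0)) UNIV"
    using has_sum_Re by fastforce
  have "((\<lambda>n. complex_of_real (q powr (of_int n + a)\<^sup>2)) has_sum of_real (Re (theta_ser q a 0))) UNIV"
    using r by (rule has_sum_of_real)
  with h show "theta_ser q a 0 = of_real (Re (theta_ser q a 0))" by (rule has_sum_unique)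
  have "0 < q powr (of_int 0 + a)\<^sup>2" using q by simp
  also have "\<dots> = (\<Sum>n\<in>{0::int}. q powr (of_int n + a)\<^sup>2)" by simp
  also have "\<dots> \<le> Re (theta_ser q a 0)"
    by (rule finite_sum_le_has_sum[OF r]) auto
  finally show "Re (theta_ser q a 0) > 0" .
qed

context
  fixes q :: real
  assumes q: "0 < q" "q < 1"
begin

lemmas jt_eq = jtheta1_eq_th[OF q] jtheta4_eq_th[OF q]

lemma jtheta_holomorphic: "jtheta1 q holomorphic_on A" "jtheta4 q holomorphic_on A"
proof -
  have "(\<lambda>z. theta_ser q a (z - of_real pi / 2)) holomorphic_on A" for a
  proof -
    have "theta_ser q a \<circ> (\<lambda>z. z - of_real pi / 2) holomorphic_on A"
      by (intro holomorphic_on_compose theta_ser_holomorphic[OF q] holomorphic_intros)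
    then show ?thesis by (simp add: o_def)
  qed
  then show "jtheta1 q holomorphic_on A" "jtheta4 q holomorphic_on A"
    by (simp_all add: jt_eq[abs_def])
qed

lemma jtheta1_minus: "jtheta1 q (- z) = - jtheta1 q z"
  using theta_ser_half_minus[of q "z + pi / 2"] theta_ser_half_add_pi[of q "z - pi / 2"] by (simp add: jt_eq algebra_simps)

lemma jtheta4_minus: "jtheta4 q (- z) = jtheta4 q z"
  using theta_ser_0_minus[of q "z + pi / 2"] theta_ser_0_add_pi[of q "z - pi / 2"] by (simp add: jt_eq algebra_simps)

lemma jtheta1_0: "jtheta1 q 0 = 0"
  using jtheta1_minus[of 0] by simp

lemma jtheta1_pi_minus: "jtheta1 q (of_real pi - z) = jtheta1 q z"
  using theta_ser_half_minus[of q "z - pi / 2"] by (simp add: jt_eq algebra_simps)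

lemma jtheta4_pi_minus: "jtheta4 q (of_real pi - z) = jtheta4 q z"
  using theta_ser_0_minus[of q "z - pi / 2"] by (simp add: jt_eq algebra_simps)

lemma jtheta1_cnj: "jtheta1 q (cnj z) = cnj (jtheta1 q z)"
  using theta_ser_cnj[of q "1/2" "z - pi / 2"] theta_ser_half_minus[of q "cnj z - pi / 2"] by (simp add: jt_eq)

lemma jtheta4_cnj: "jtheta4 q (cnj z) = cnj (jtheta4 q z)"
  using theta_ser_cnj[of q 0 "z - pi / 2"] theta_ser_0_minus[of q "cnj z - pi / 2"] by (simp add: jt_eq)

lemma jtheta_pi_half: "jtheta1 q (of_real pi / 2) = theta_ser q (1/2) 0" "jtheta4 q (of_real pi / 2) = theta_ser q 0 0"
  by (simp_all add: jt_eq)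

text \<open>Products of two theta values are bilinear in only two functions of nome
  \<open>q\<^sup>2\<close>. The minus signs arise because \<open>P\<close> has period pi while
  \<open>Q\<close> changes sign under it.\<close>

lemma jtheta_addition:
  defines "P \<equiv> theta_ser (q\<^sup>2) 0" and "Q \<equiv> theta_ser (q\<^sup>2) (1/2)"
  shows "jtheta4 q x * jtheta4 q y = P (x + y) * P (x - y) - Q (x + y) * Q (x - y)"
    and "jtheta1 q x * jtheta1 q y = P (x + y) * Q (x - y) - Q (x + y) * P (x - y)"
    and "theta_ser q 0 x * theta_ser q 0 y = P (x + y) * P (x - y) + Q (x + y) * Q (x - y)"
    and "theta_ser q (1/2) x * theta_ser q (1/2) y = P (x + y) * Q (x - y) + Q (x + y) * P (x - y)"
proof -
  have P1: "theta_ser (q\<^sup>2) 1 = P" using theta_ser_add_one[of "q\<^sup>2" 0] by (auto simp: P_def)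
  have Pp: "P (z - of_real pi) = P z" for z using theta_ser_0_add_pi[of "q\<^sup>2" "z - of_real pi"] by (simp add: P_def)
  have Qp: "Q (z - of_real pi) = - Q z" for z using theta_ser_half_add_pi[of "q\<^sup>2" "z - of_real pi"] by (simp add: Q_def)
  have d: "x - of_real pi / 2 + (y - of_real pi / 2) = x + y - of_real pi"
     "x - of_real pi / 2 - (y - of_real pi / 2) = x - y"
    by simp_all
  note m = theta_ser_mult[OF q]
  show "jtheta4 q x * jtheta4 q y = P (x + y) * P (x - y) - Q (x + y) * Q (x - y)"
    unfolding jt_eq m d by (simp add: P_def[symmetric] Q_def[symmetric] Pp Qp)
  show "jtheta1 q x * jtheta1 q y = P (x + y) * Q (x - y) - Q (x + y) * P (x - y)"
    unfolding jt_eq m d by (simp add: P_def[symmetric] Q_def[symmetric] Pp Qp P1)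
  show "theta_ser q 0 x * theta_ser q 0 y = P (x + y) * P (x - y) + Q (x + y) * Q (x - y)"
    unfolding m by (simp add: P_def[symmetric] Q_def[symmetric])
  show "theta_ser q (1/2) x * theta_ser q (1/2) y = P (x + y) * Q (x - y) + Q (x + y) * P (x - y)"
    unfolding m by (simp add: P_def[symmetric] Q_def[symmetric] P1)
qed

text \<open>Every product here becomes a polynomial in the values of \<open>P\<close> and
  \<open>Q\<close> at 2x, 2y and 0, and the identity is then plain algebra.\<close>

lemma jtheta4_addition:
  "jtheta4 q (x + y) * jtheta4 q (x - y) * (jtheta4 q 0)\<^sup>2
     = (jtheta4 q x)\<^sup>2 * (jtheta4 q y)\<^sup>2 - (jtheta1 q x)\<^sup>2 * (jtheta1 q y)\<^sup>2"
  unfolding power2_eq_square jtheta_addition by (simp add: algebra_simps)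

lemma jtheta1_addition:
  "jtheta1 q (x + y) * jtheta1 q (x - y) * (jtheta4 q 0)\<^sup>2
     = (jtheta1 q x)\<^sup>2 * (jtheta4 q y)\<^sup>2 - (jtheta4 q x)\<^sup>2 * (jtheta1 q y)\<^sup>2"
  unfolding power2_eq_square jtheta_addition by (simp add: algebra_simps)

text \<open>The product formula at x - pi/2 and x has two summands, and the second contains the
  factor theta_1(0) = 0. The outcome transports zeros between the nomes \<open>q\<close> and
  \<open>q\<^sup>2\<close>.\<close>

lemma jtheta1_duplication:
  "jtheta1 q x * theta_ser q (1/2) x = jtheta1 (q\<^sup>2) (2 * x) * jtheta4 (q\<^sup>2) 0"
proof -
  have q2: "0 < q\<^sup>2" "q\<^sup>2 < 1" using q by (auto simp: power_less_one_iff)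
  have P1: "theta_ser (q\<^sup>2) 1 = theta_ser (q\<^sup>2) 0" using theta_ser_add_one[of "q\<^sup>2" 0] by auto
  have z: "theta_ser (q\<^sup>2) (1/2) (- (of_real pi / 2)) = 0"
    using jtheta1_eq_th[OF q2, of 0] jtheta1_minus jtheta1_def by simp
  show ?thesis
    unfolding jt_eq jtheta1_eq_th[OF q2] jtheta4_eq_th[OF q2] theta_ser_mult[OF q]
    using z P1 by (simp add: algebra_simps)
qed

end

section \<open>Zeros of the theta functions\<close>

lemma norm_cos_le_exp: "norm (cos z) \<le> exp \<bar>Im z\<bar>"
proof -
  have "norm (cos z) = norm (exp (\<i> * z) + exp (- (\<i> * z))) / 2"
    by (simp add: cos_exp_eq)
  also have "norm (exp (\<i> * z) + exp (- (\<i> * z))) \<le> exp (- Im z) + exp (Im z)"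
    by (rule order.trans[OF norm_triangle_ineq]) simp
  also have "(exp (- Im z) + exp (Im z)) / 2 \<le> exp \<bar>Im z\<bar>"
    by (cases "Im z \<ge> 0") (auto intro: order.trans)
  finally show ?thesis by simp
qed

text \<open>Keeping the factor \<open>norm (sin z)\<close> is the point: it allows the tail of the
  theta_1 series to be compared with its leading term even near the zeros of the sine. The recursion
  is sin((2n+3)z) = sin((2n+1)z) + 2 cos((2n+2)z) sin z.\<close>

lemma norm_sin_odd_le:
  "norm (sin ((2 * of_nat n + 1) * z)) \<le> (2 * real n + 1) * exp (2 * real n * \<bar>Im z\<bar>) * norm (sin z)"
proof (induction n)
  case (Suc n)
  have e: "(2 * of_nat (Suc n) + 1) * z = (2 * of_nat n + 2) * z + z"
      "(2 * of_nat n + 1) * z = (2 * of_nat n + 2) * z - z"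
    by (simp_all add: algebra_simps)
  have "sin ((2 * of_nat (Suc n) + 1) * z) = sin ((2 * of_nat n + 1) * z) + 2 * (cos ((2 * of_nat n + 2) * z) * sin z)"
    unfolding e sin_add sin_diff by simp
  then have "norm (sin ((2 * of_nat (Suc n) + 1) * z))
      \<le> norm (sin ((2 * of_nat n + 1) * z)) + 2 * (norm (cos ((2 * of_nat n + 2) * z)) * norm (sin z))"
    using norm_triangle_ineq[of "sin ((2 * of_nat n + 1) * z)" "2 * (cos ((2 * of_nat n + 2) * z) * sin z)"]
    by (simp add: norm_mult)
  moreover have "norm (cos ((2 * of_nat n + 2) * z)) \<le> exp (2 * real (Suc n) * \<bar>Im z\<bar>)"
  proof -
    have "Im ((2 * of_nat n + 2) * z) = 2 * real (Suc n) * Im z" by (simp add: algebra_simps)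
    then have "\<bar>Im ((2 * of_nat n + 2) * z)\<bar> = 2 * real (Suc n) * \<bar>Im z\<bar>" by (simp add: abs_mult)
    then show ?thesis using norm_cos_le_exp[of "(2 * of_nat n + 2) * z"] by simp
  qed
  then have "norm (cos ((2 * of_nat n + 2) * z)) * norm (sin z) \<le> exp (2 * real (Suc n) * \<bar>Im z\<bar>) * norm (sin z)"
    by (rule mult_right_mono) simp
  moreover have "(2 * real n + 1) * exp (2 * real n * \<bar>Im z\<bar>) * norm (sin z)
      \<le> (2 * real n + 1) * exp (2 * real (Suc n) * \<bar>Im z\<bar>) * norm (sin z)"
    by (intro mult_right_mono mult_left_mono) (auto intro: mult_right_mono)
  ultimately have "norm (sin ((2 * of_nat (Suc n) + 1) * z)) \<le> (2 * real n + 1) * exp (2 * real (Suc n) * \<bar>Im z\<bar>) * norm (sin z)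
      + 2 * (exp (2 * real (Suc n) * \<bar>Im z\<bar>) * norm (sin z))"
    using Suc.IH by linarith
  then show ?case by (simp add: algebra_simps)
qed simp

text \<open>The leading term dominates. In this strip exp(2m |Im z|) is at most q^(-m), so with 2m +
  1 <= 3^m the m-th term is at most \<open>C * (3 * q) ^ m\<close>, where \<open>C\<close> is the
  size of the leading one. The bound 1/9 makes the tail at most C/2, so a zero of the sum forces
  \<open>C = 0\<close>.\<close>

lemma jtheta1_zero_base:
  assumes q: "0 < q" "q \<le> 1/9" and z: "\<bar>Im z\<bar> \<le> - ln q / 2" and 0: "jtheta1 q z = 0"
  shows "sin z = 0"
proof -
  define f where "f = (\<lambda>n. 2 * ((-1) ^ n * complex_of_real (q powr ((real n + 1/2)\<^sup>2)) * sin ((2 * of_nat n + 1) * z)))"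
  define C where "C = 2 * q powr (1/4) * norm (sin z)"
  have C: "C \<ge> 0" by (simp add: C_def)
  have q1: "q < 1" using q by simp
  have "f sums 0"
    using jtheta1_sums[OF q(1) q1, of z] 0 unfolding f_def jtheta1_eq_th[OF q(1) q1] by simp
  from sums_split_initial_segment[OF this, of 1] have "(\<lambda>n. f (Suc n)) sums (- f 0)" by simp
  then have S: "(\<Sum>n. f (Suc n)) = - f 0" by (simp add: sums_iff)
  have f0: "norm (f 0) = C"
    by (simp add: f_def C_def norm_mult power2_eq_square)
  have le: "norm (f (Suc n)) \<le> C * (3 * q) ^ Suc n" for n
  proof -
    define m where "m = Suc n"
    have m: "m \<ge> 1" by (simp add: m_def)
    have 1: "norm (sin ((2 * of_nat m + 1) * z)) \<le> (2 * real m + 1) * q powr (- real m) * norm (sin z)"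
    proof -
      have "2 * real m * \<bar>Im z\<bar> \<le> 2 * real m * (- ln q / 2)"
        by (intro mult_left_mono z) simp
      then have "exp (2 * real m * \<bar>Im z\<bar>) \<le> q powr (- real m)"
        using q by (simp add: powr_def)
      then show ?thesis
        by (intro order.trans[OF norm_sin_odd_le] mult_right_mono mult_left_mono) auto
    qed
    have 2: "2 * real m + 1 \<le> 3 ^ m"
    proof (induction m)
      case (Suc m)
      have "(1::real) \<le> 3 ^ m" by simp
      then show ?case using Suc by simp
    qed simp
    have 3: "q powr ((real m + 1/2)\<^sup>2) * q powr (- real m) \<le> q powr (1/4) * q ^ m"
    proof -
      have "q powr ((real m + 1/2)\<^sup>2) * q powr (- real m) = q powr (1/4) * q powr (real m * real m)"
        by (simp add: powr_add[symmetric] power2_eq_square algebra_simps)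
      also have "q powr (real m * real m) \<le> q powr real m"
        using q1 q m by (intro powr_mono') auto
      finally show ?thesis using q by (simp add: powr_realpow)
    qed
    have "norm (f m) = 2 * q powr ((real m + 1/2)\<^sup>2) * norm (sin ((2 * of_nat m + 1) * z))"
      by (simp add: f_def norm_mult norm_power)
    also have "\<dots> \<le> 2 * q powr ((real m + 1/2)\<^sup>2) * ((2 * real m + 1) * q powr (- real m) * norm (sin z))"
      by (intro mult_left_mono 1) simp
    also have "\<dots> = 2 * norm (sin z) * ((2 * real m + 1) * (q powr ((real m + 1/2)\<^sup>2) * q powr (- real m)))"
      by (simp add: mult_ac)
    also have "\<dots> \<le> 2 * norm (sin z) * (3 ^ m * (q powr (1/4) * q ^ m))"
      by (intro mult_left_mono mult_mono 2 3) auto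
    finally show ?thesis by (simp add: C_def m_def power_mult_distrib mult_ac)
  qed
  have g: "(\<lambda>n. C * (3 * q) ^ Suc n) sums (C * (3 * q) * (1 / (1 - 3 * q)))"
    using sums_mult[OF geometric_sums[of "3 * q"], of "C * (3 * q)"] q by (simp add: mult_ac)
  have "norm (- f 0) \<le> (\<Sum>n. C * (3 * q) ^ Suc n)"
    unfolding S[symmetric] using g le by (intro norm_suminf_le) (auto simp: sums_iff)
  also have "\<dots> = C * (3 * q * (1 / (1 - 3 * q)))" using g by (simp add: sums_iff)
  also have "\<dots> \<le> C * (1/2)"
    using C q by (intro mult_left_mono) (auto simp: field_simps)
  finally have "C \<le> 0" using f0 by simp
  then show ?thesis using q unfolding C_def by (auto simp: mult_le_0_iff)
qed

lemma jtheta4_shift: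
  assumes q: "0 < q" "q < 1"
  shows "jtheta4 q z = of_real (q powr (-1/4)) * exp (- \<i> * (z - of_real pi / 2 + \<i> * of_real (ln q / 2)))
           * jtheta1 q (z + \<i> * of_real (ln q / 2))"
  using theta_ser_shift[OF q, of "z - of_real pi / 2 + \<i> * of_real (ln q / 2)"]
  by (simp add: jt_eq[OF q] algebra_simps)

lemma theta_ser_half_npi: "theta_ser q (1/2) (of_int n * of_real pi) = theta_ser q (1/2) 0 \<or> theta_ser q (1/2) (of_int n * of_real pi) = - theta_ser q (1/2) 0"
proof -
  have nat: "theta_ser q (1/2) (of_nat m * of_real pi) = theta_ser q (1/2) 0 \<or> theta_ser q (1/2) (of_nat m * of_real pi) = - theta_ser q (1/2) 0" for m
  proof (induction m)
    case (Suc m)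
    then show ?case using theta_ser_half_add_pi[of q "of_nat m * of_real pi"]
      by (auto simp: algebra_simps)
  qed simp
  show ?thesis
  proof (cases "n \<ge> 0")
    case True
    then show ?thesis using nat[of "nat n"] by simp
  next
    case False
    then show ?thesis using nat[of "nat (- n)"] theta_ser_half_minus[of q "of_int n * of_real pi"] by simp
  qed
qed

lemma sin_zero_Im: "sin z = 0 \<Longrightarrow> Im z = 0"
  by (auto simp: sin_eq_0)

text \<open>Passing from \<open>(q, z)\<close> to \<open>(q\<^sup>2, 2 z)\<close> doubles both sides
  of the bound on Im z, so the hypothesis survives each duplication, and after enough squarings the
  nome is at most 1/9.\<close>

lemma jtheta1_zero:
  assumes q: "0 < q" "q < 1" and z: "\<bar>Im z\<bar> \<le> - ln q / 2" and 0: "jtheta1 q z = 0"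
  shows "sin z = 0"
proof -
  have *: "sin z = 0" if "q ^ (2 ^ n) \<le> 1/9" "0 < q" "q < 1" "\<bar>Im z\<bar> \<le> - ln q / 2" "jtheta1 q z = 0" for n q z
    using that
  proof (induction n arbitrary: q z)
    case 0
    then show ?case using jtheta1_zero_base by simp
  next
    case (Suc n)
    have q2: "0 < q\<^sup>2" "q\<^sup>2 < 1" using Suc.prems by (auto simp: power_less_one_iff)
    have "(q\<^sup>2) ^ (2 ^ n) \<le> 1/9" using Suc.prems by (simp add: power_mult[symmetric])
    note IH = Suc.IH[OF this q2]
    have l2: "ln (q\<^sup>2) = 2 * ln q" using Suc.prems by (simp add: ln_realpow)
    have lq: "ln q < 0" using Suc.prems by simp
    \<comment> \<open>A zero of theta_4 at 0 would be a zero of theta_1 at half a quasi-period. That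
      point lies on the boundary of the strip and off the real axis, so the induction hypothesis for
      the closed strip excludes it.\<close>
    have j4: "jtheta4 (q\<^sup>2) 0 \<noteq> 0"
    proof
      assume "jtheta4 (q\<^sup>2) 0 = 0"
      then have "jtheta1 (q\<^sup>2) (\<i> * of_real (ln (q\<^sup>2) / 2)) = 0"
        using jtheta4_shift[OF q2, of 0] q2 by simp
      from IH[OF _ this] sin_zero_Im[of "\<i> * of_real (ln (q\<^sup>2) / 2)"]
      show False using l2 lq by simp
    qed
    have "jtheta1 (q\<^sup>2) (2 * z) = 0"
      using jtheta1_duplication[OF Suc.prems(2,3), of z] Suc.prems j4 by simp
    with IH[of "2 * z"] have "sin (2 * z) = 0" using Suc.prems l2 by simp
    then have "sin z = 0 \<or> cos z = 0" by (simp add: sin_double)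
    \<comment> \<open>Zeros of the cosine belong to the other factor of the duplication formula;
      there theta_1 equals plus or minus theta_2(0), which is positive up to sign.\<close>
    moreover have "cos z \<noteq> 0"
    proof
      assume "cos z = 0"
      then have "sin (z - of_real pi / 2) = 0" by (simp add: sin_diff)
      then obtain m :: int where "z - of_real pi / 2 = of_int m * of_real pi"
        unfolding sin_eq_0 by auto
      then have "jtheta1 q z = theta_ser q (1/2) (of_int m * of_real pi)"
        by (simp add: jt_eq[OF Suc.prems(2,3)])
      then have "theta_ser q (1/2) 0 = 0" using theta_ser_half_npi[of q m] Suc.prems by auto
      then show False using theta_ser_0_real_pos(2)[OF Suc.prems(2,3), of "1/2"] by simp
    qed
    ultimately show ?case by blast
  qed
  obtain N where N: "q ^ N < 1/9" using real_arch_pow_inv[of "1/9" q] q by auto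
  have "q ^ (2 ^ N) \<le> q ^ N"
    using q by (intro power_decreasing) (auto simp: less_imp_le[OF less_exp])
  with N *[OF _ q z 0, of N] show ?thesis by simp
qed

lemma jtheta4_nonzero:
  assumes q: "0 < q" "q < 1" and z: "\<bar>Im z\<bar> < - ln q / 2"
  shows "jtheta4 q z \<noteq> 0"
proof -
  \<comment> \<open>In the upper half of the strip the shift by half a quasi-period lands strictly
    below the real axis but within the closed strip of \<open>jtheta1_zero\<close>. The lower half
    follows by evenness.\<close>
  have *: "jtheta4 q z \<noteq> 0" if "0 \<le> Im z" "\<bar>Im z\<bar> < - ln q / 2" for z
  proof
    assume "jtheta4 q z = 0"
    then have "jtheta1 q (z + \<i> * of_real (ln q / 2)) = 0"
      using jtheta4_shift[OF q, of z] q by simp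
    from jtheta1_zero[OF q _ this] sin_zero_Im[of "z + \<i> * of_real (ln q / 2)"] show False
      using that by auto
  qed
  show ?thesis
  proof (cases "0 \<le> Im z")
    case False
    then show ?thesis using *[of "- z"] z jtheta4_minus[OF q, of z] by simp
  qed (use * z in auto)
qed

lemma jtheta4_half_period: "0 < q \<Longrightarrow> q < 1 \<Longrightarrow> jtheta4 q (\<i> * of_real (- ln q / 2)) = 0"
  using jtheta4_shift[of q "\<i> * of_real (- ln q / 2)"] jtheta1_0[of q] by simp

text \<open>By the product formulas theta_3(0)^2 - theta_2(0)^2 = (P - Q)^2 at 0, and P = Q would
  give theta_4(0) = 0. This is what keeps the modulus built from \<open>q\<close> below 1.\<close>

lemma theta_ser_half_less_0:
  assumes q: "0 < q" "q < 1"
  shows "Re (theta_ser q (1/2) 0) < Re (theta_ser q 0 0)"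
proof -
  have q2: "0 < q\<^sup>2" "q\<^sup>2 < 1" using q by (auto simp: power_less_one_iff)
  define P Q where "P = Re (theta_ser (q\<^sup>2) 0 0)" and "Q = Re (theta_ser (q\<^sup>2) (1/2) 0)"
  define b a where "b = Re (theta_ser q 0 0)" and "a = Re (theta_ser q (1/2) 0)"
  have e: "theta_ser (q\<^sup>2) 0 0 = of_real P" "theta_ser (q\<^sup>2) (1/2) 0 = of_real Q" "theta_ser q 0 0 = of_real b" "theta_ser q (1/2) 0 = of_real a"
    using theta_ser_0_real_pos(1)[OF q] theta_ser_0_real_pos(1)[OF q2] by (simp_all add: P_def Q_def a_def b_def)
  have pos: "a > 0" "b > 0" using theta_ser_0_real_pos(2)[OF q] by (simp_all add: a_def b_def)
  note ad = jtheta_addition[OF q, where x = 0 and y = 0, unfolded e]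
  have 1: "b * b = P * P + Q * Q" "a * a = P * Q + Q * P"
    using ad(3,4) by (simp_all add: e flip: of_real_mult of_real_add)
  have "jtheta4 q 0 \<noteq> 0" using jtheta4_nonzero[OF q, of 0] q by simp
  then have "P \<noteq> Q" using ad(1) by (auto simp: e)
  then have "(P - Q)\<^sup>2 > 0" by simp
  then have "a\<^sup>2 < b\<^sup>2" using 1 by (simp add: power2_eq_square algebra_simps)
  then show ?thesis using pos unfolding a_def[symmetric] b_def[symmetric]
    by (simp add: power2_less_imp_less)
qed

section \<open>Uniqueness for cubic equations, amplitude and elliptic sine\<close>

text \<open>Gronwall for E = w^2 + w'^2: with |h| <= M on [a, x], E' <= (1 + M) E, so E(t) exp(-(1 +
  M) t) cannot increase from its initial value 0.\<close>

lemma linear_ode2_zero_right: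
  fixes w w' h :: "real \<Rightarrow> real"
  assumes w: "\<And>x. (w has_real_derivative w' x) (at x)"
    and w': "\<And>x. (w' has_real_derivative h x * w x) (at x)"
    and h: "continuous_on UNIV h" and 0: "w a = 0" "w' a = 0" and ax: "a \<le> x"
  shows "w x = 0"
proof -
  have "compact (h ` {a..x})"
    by (intro compact_continuous_image continuous_on_subset[OF h]) auto
  then obtain M where M: "\<And>t. t \<in> {a..x} \<Longrightarrow> \<bar>h t\<bar> \<le> M"
    using compact_imp_bounded[THEN bounded_iff[THEN iffD1]] by fastforce
  define E where "E = (\<lambda>t. (w t)\<^sup>2 + (w' t)\<^sup>2)"
  define F where "F = (\<lambda>t. E t * exp (- (1 + M) * t))"
  have dF: "(F has_real_derivative (2 * w t * w' t * (1 + h t) - (1 + M) * E t) * exp (- (1 + M) * t)) (at t)" for t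
    unfolding F_def E_def
    by (rule derivative_eq_intros refl w w')+ (simp add: algebra_simps power2_eq_square)
  have "F x \<le> F a"
  proof (rule DERIV_nonpos_imp_nonincreasing[OF ax], intro exI conjI)
    fix t assume t: "a \<le> t" "t \<le> x"
    show "(F has_real_derivative (2 * w t * w' t * (1 + h t) - (1 + M) * E t) * exp (- (1 + M) * t)) (at t)"
      by (rule dF)
    have "\<bar>h t\<bar> \<le> M" using M t by simp
    then have "\<bar>1 + h t\<bar> \<le> 1 + M" by linarith
    moreover have "\<bar>2 * w t * w' t\<bar> \<le> E t"
      using sum_squares_bound[of "\<bar>w t\<bar>" "\<bar>w' t\<bar>"] by (simp add: E_def abs_mult)
    ultimately have "\<bar>2 * w t * w' t * (1 + h t)\<bar> \<le> E t * (1 + M)"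
      unfolding abs_mult[of "2 * w t * w' t"] by (intro mult_mono) (auto simp: E_def)
    then have "2 * w t * w' t * (1 + h t) - (1 + M) * E t \<le> 0" by (simp add: mult.commute)
    then show "(2 * w t * w' t * (1 + h t) - (1 + M) * E t) * exp (- (1 + M) * t) \<le> 0"
      by (intro mult_nonpos_nonneg) auto
  qed
  then have "E x * exp (- (1 + M) * x) \<le> 0" by (simp add: F_def E_def 0)
  then have "E x \<le> 0" by (simp add: mult_le_0_iff)
  then show ?thesis unfolding E_def by (smt (verit) zero_le_power2 power2_eq_iff_nonneg power_zero_numeral sum_power2_eq_zero_iff)
qed

lemma linear_ode2_zero:
  fixes w w' h :: "real \<Rightarrow> real"
  assumes w: "\<And>x. (w has_real_derivative w' x) (at x)"
    and w': "\<And>x. (w' has_real_derivative h x * w x) (at x)"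
    and h: "continuous_on UNIV h" and 0: "w a = 0" "w' a = 0"
  shows "w x = 0"
proof (cases "a \<le> x")
  case True
  then show ?thesis using linear_ode2_zero_right[OF w w' h 0] by blast
next
  case False
  have um: "(uminus has_real_derivative -1) (at t)" for t :: real
    by (auto intro!: derivative_eq_intros)
  have 1: "((\<lambda>t. w (- t)) has_real_derivative - w' (- t)) (at t)" for t
    using DERIV_chain2[OF w um] by simp
  have 2: "((\<lambda>t. - w' (- t)) has_real_derivative h (- t) * w (- t)) (at t)" for t
    using DERIV_minus[OF DERIV_chain2[OF w' um]] by simp
  have 3: "continuous_on UNIV (\<lambda>t. h (- t))"
    by (rule continuous_on_compose2[OF h]) (auto intro!: continuous_intros)
  show ?thesis
    using linear_ode2_zero_right[OF 1 2 3, of "- a" "- x"] 0 False by simp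
qed

text \<open>The difference of two solutions solves a linear equation. Its coefficient comes from
  factoring f^3 - g^3 and is continuous along the given pair.\<close>

lemma cubic_ode_unique:
  fixes f g f' g' :: "real \<Rightarrow> real"
  assumes f: "\<And>x. (f has_real_derivative f' x) (at x)" "\<And>x. (f' has_real_derivative A + B * f x + C * f x ^ 3) (at x)"
    and g: "\<And>x. (g has_real_derivative g' x) (at x)" "\<And>x. (g' has_real_derivative A + B * g x + C * g x ^ 3) (at x)"
    and 0: "f a = g a" "f' a = g' a"
  shows "f x = g x"
proof -
  have c: "continuous_on UNIV f" "continuous_on UNIV g"
    by (intro continuous_at_imp_continuous_on ballI DERIV_isCont[OF f(1)] DERIV_isCont[OF g(1)])+
  have "f x - g x = 0"
  proof (rule linear_ode2_zero[where w = "\<lambda>x. f x - g x" and w' = "\<lambda>x. f' x - g' x" and a = a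
      and h = "\<lambda>x. B + C * (f x ^ 2 + f x * g x + g x ^ 2)"])
    show "continuous_on UNIV (\<lambda>x. B + C * (f x ^ 2 + f x * g x + g x ^ 2))"
      by (intro continuous_intros c)
    show "((\<lambda>x. f' x - g' x) has_real_derivative (B + C * (f x ^ 2 + f x * g x + g x ^ 2)) * (f x - g x)) (at x)" for x
      by (rule DERIV_cong[OF DERIV_diff[OF f(2) g(2)]]) (simp add: algebra_simps power2_eq_square power3_eq_cube)
    show "((\<lambda>x. f x - g x) has_real_derivative f' x - g' x) (at x)" for x
      by (rule DERIV_diff[OF f(1) g(1)])
  qed (simp_all add: 0)
  then show ?thesis by simp
qed

section \<open>Incomplete elliptic integral, amplitude and sn for a fixed modulus\<close>

context
  fixes k :: real
  assumes k: "0 < k" "k < 1"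
begin

lemma one_minus_ksin_pos: "0 < 1 - k\<^sup>2 * (sin t)\<^sup>2"
proof -
  have "k\<^sup>2 < 1" using k by (simp add: power_less_one_iff)
  moreover have "k\<^sup>2 * (sin t)\<^sup>2 \<le> k\<^sup>2 * 1"
    by (intro mult_left_mono) (auto simp: abs_square_le_1)
  ultimately show ?thesis by simp
qed

lemma ell_integrand_ge_1: "1 \<le> 1 / sqrt (1 - k\<^sup>2 * (sin t)\<^sup>2)"
proof -
  have "sqrt (1 - k\<^sup>2 * (sin t)\<^sup>2) \<le> 1" by (subst real_sqrt_le_1_iff) simp
  moreover have "0 < sqrt (1 - k\<^sup>2 * (sin t)\<^sup>2)" using one_minus_ksin_pos by simp
  ultimately show ?thesis by (simp only: le_divide_eq_1_pos)
qed

lemma ell_integrand_continuous: "continuous_on A (\<lambda>t. 1 / sqrt (1 - k\<^sup>2 * (sin t)\<^sup>2))"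
proof (intro continuous_intros ballI)
  fix t show "sqrt (1 - k\<^sup>2 * (sin t)\<^sup>2) \<noteq> 0" using one_minus_ksin_pos[of t] by simp
qed

lemma ellF_deriv: "(ellF k has_real_derivative 1 / sqrt (1 - k\<^sup>2 * (sin x)\<^sup>2)) (at x)"
proof -
  define I where "I = (\<lambda>t. 1 / sqrt (1 - k\<^sup>2 * (sin t)\<^sup>2))"
  define N where "N = \<bar>x\<bar> + 1"
  have int: "I integrable_on {a..b}" for a b
    unfolding I_def by (intro integrable_continuous_real ell_integrand_continuous)
  \<comment> \<open>A primitive based at \<open>-N\<close> serves both branches of the definition,
    so 0 needs no separate treatment when differentiating.\<close>
  have eq: "ellF k y = integral {-N..y} I - integral {-N..0} I" if "y \<in> {-N<..<N}" for y
  proof (cases "0 \<le> y")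
    case True
    then have "integral {-N..0} I + integral {0..y} I = integral {-N..y} I"
      by (intro Henstock_Kurzweil_Integration.integral_combine int) (auto simp: N_def)
    then show ?thesis using True by (simp add: ellF_def I_def)
  next
    case False
    then have "integral {-N..y} I + integral {y..0} I = integral {-N..0} I"
      using that by (intro Henstock_Kurzweil_Integration.integral_combine int) auto
    then show ?thesis using False by (simp add: ellF_def I_def)
  qed
  have "((\<lambda>y. integral {-N..y} I) has_real_derivative I x) (at x within {-N..N})"
    unfolding I_def by (intro integral_has_real_derivative ell_integrand_continuous) (auto simp: N_def)
  then have "((\<lambda>y. integral {-N..y} I) has_real_derivative I x) (at x)"
    by (subst (asm) at_within_interior) (auto simp: N_def)
  then have "((\<lambda>y. integral {-N..y} I - integral {-N..0} I) has_real_derivative I x) (at x)"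
    by (auto intro!: derivative_eq_intros)
  then have "(ellF k has_real_derivative I x) (at x)"
    by (rule has_field_derivative_transform_within_open[where S = "{-N<..<N}"])
       (auto simp: eq N_def)
  then show ?thesis by (simp add: I_def)
qed

lemma ellF_0 [simp]: "ellF k 0 = 0"
  by (simp add: ellF_def)

text \<open>The integrand is at least 1. Growth at least as fast as the identity yields injectivity
  and surjectivity together, which makes the \<open>THE\<close> in \<open>jam\<close>
  meaningful.\<close>

lemma ellF_diff_ge: "x \<le> y \<Longrightarrow> y - x \<le> ellF k y - ellF k x"
proof -
  assume xy: "x \<le> y"
  have "((\<lambda>t. ellF k t - t) has_real_derivative 1 / sqrt (1 - k\<^sup>2 * (sin t)\<^sup>2) - 1) (at t)" for t
    by (intro DERIV_diff ellF_deriv DERIV_ident)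
  then have "ellF k x - x \<le> ellF k y - y"
    using ell_integrand_ge_1 by (intro DERIV_nonneg_imp_nondecreasing[OF xy, of "\<lambda>t. ellF k t - t"]) force
  then show ?thesis by simp
qed

lemma ellF_strict_mono: "x < y \<Longrightarrow> ellF k x < ellF k y"
  using ellF_diff_ge[of x y] by simp

lemma ellF_eq_iff: "ellF k x = ellF k y \<longleftrightarrow> x = y"
  using ellF_strict_mono[of x y] ellF_strict_mono[of y x] by (cases x y rule: linorder_cases) auto

lemma ellF_less_iff: "ellF k x < ellF k y \<longleftrightarrow> x < y"
  using ellF_strict_mono[of x y] ellF_strict_mono[of y x] by (cases x y rule: linorder_cases) auto

lemma ellF_isCont: "isCont (ellF k) x"
  by (rule DERIV_isCont[OF ellF_deriv])

lemma ellF_jam [simp]: "ellF k (jam k u) = u"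
proof -
  have "ellF k (- \<bar>u\<bar>) \<le> u" "u \<le> ellF k \<bar>u\<bar>"
    using ellF_diff_ge[of "- \<bar>u\<bar>" 0] ellF_diff_ge[of 0 "\<bar>u\<bar>"] by simp_all
  then obtain x where x: "ellF k x = u"
    using IVT[of "ellF k" "- \<bar>u\<bar>" u "\<bar>u\<bar>"] ellF_isCont by fastforce
  then show ?thesis
    unfolding jam_def by (rule theI[where a = x]) (simp add: ellF_eq_iff flip: x)
qed

lemma jam_ellF [simp]: "jam k (ellF k x) = x"
  using ellF_jam[of "ellF k x"] by (simp only: ellF_eq_iff)

lemma jam_less_iff: "jam k u < jam k v \<longleftrightarrow> u < v"
  using ellF_less_iff[of "jam k u" "jam k v"] by simp

lemma jam_le_iff: "jam k u \<le> jam k v \<longleftrightarrow> u \<le> v"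
  using jam_less_iff[of v u] by linarith

lemma jam_deriv: "(jam k has_real_derivative sqrt (1 - k\<^sup>2 * (sin (jam k u))\<^sup>2)) (at u)"
proof -
  have "isCont (jam k) (ellF k (jam k u))"
    by (rule isCont_inverse_function[where d = 1]) (auto intro: ellF_isCont)
  then have "(jam k has_real_derivative inverse (1 / sqrt (1 - k\<^sup>2 * (sin (jam k u))\<^sup>2))) (at u)"
    using one_minus_ksin_pos[of "jam k u"]
    by (intro DERIV_inverse_function[where f = "ellF k" and a = "u - 1" and b = "u + 1"] ellF_deriv) auto
  then show ?thesis by simp
qed

lemma ellF_minus: "ellF k (- x) = - ellF k x"
proof -
  have um: "(uminus has_real_derivative -1) (at t)" for t :: real
    by (auto intro!: derivative_eq_intros)
  have "((\<lambda>t. ellF k (- t) + ellF k t) has_real_derivative 0) (at t)" for t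
    using DERIV_add[OF DERIV_chain2[OF ellF_deriv um] ellF_deriv[of t]] by simp
  then have "ellF k (- x) + ellF k x = ellF k (- 0) + ellF k 0"
    by (intro DERIV_isconst_all) blast
  then show ?thesis by simp
qed

lemma ellF_add_pi: "ellF k (x + pi) = ellF k x + 2 * ellK k"
proof -
  have sh: "((\<lambda>t. t + pi) has_real_derivative 1) (at t)" for t
    by (auto intro!: derivative_eq_intros)
  have "((\<lambda>t. ellF k (t + pi) - ellF k t) has_real_derivative 0) (at t)" for t
    using DERIV_diff[OF DERIV_chain2[OF ellF_deriv sh] ellF_deriv[of t]] by simp
  then have *: "ellF k (x + pi) - ellF k x = ellF k (y + pi) - ellF k y" for x y
    by (intro DERIV_isconst_all) blast
  \<comment> \<open>The increment over one period does not depend on the starting point; starting at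
    -pi/2, oddness evaluates it to 2K.\<close>
  show ?thesis using *[of x "- (pi / 2)"] by (simp add: ellF_minus ellK_def)
qed

lemma ellK_pos: "0 < ellK k"
  using ellF_strict_mono[of 0 "pi / 2"] by (simp add: ellK_def)

lemma jam_add: "jam k (u + 2 * ellK k) = jam k u + pi"
  by (metis ellF_jam jam_ellF ellF_add_pi)

lemma jam_0 [simp]: "jam k 0 = 0"
  using jam_ellF[of 0] by simp

lemma jam_K [simp]: "jam k (ellK k) = pi / 2"
  using jam_ellF[of "pi / 2"] by (simp add: ellK_def)

lemma jsn_add: "jsn k (u + 2 * ellK k) = - jsn k u"
  by (simp add: jsn_def jam_add)

lemma jsn_0 [simp]: "jsn k 0 = 0" and jsn_K [simp]: "jsn k (ellK k) = 1"
  by (simp_all add: jsn_def)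

lemma jsn_pos: assumes "0 < u" "u < 2 * ellK k" shows "0 < jsn k u"
  using assms jam_less_iff[of 0 u] jam_less_iff[of u "2 * ellK k"] jam_add[of 0]
  by (auto simp: jsn_def intro!: sin_gt_zero)

lemma jsn_strict_mono: assumes "0 \<le> u" "u < v" "v \<le> ellK k" shows "jsn k u < jsn k v"
proof -
  have "jam k v \<le> pi / 2" "0 \<le> jam k u"
    using assms jam_le_iff[of v "ellK k"] jam_le_iff[of 0 u] by simp_all
  then show ?thesis
    using assms jam_less_iff[of u v] by (auto simp: jsn_def intro!: sin_monotone_2pi)
qed

lemma jsn_ex1:
  assumes "0 < s" "s < 1"
  shows "\<exists>!u. 0 < u \<and> u < ellK k \<and> jsn k u = s"
proof (rule ex_ex1I)
  have as: "0 < arcsin s" "arcsin s < pi / 2"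
    using assms arcsin_less_arcsin[of 0 s] arcsin_less_arcsin[of s 1] by auto
  then have "0 < ellF k (arcsin s) \<and> ellF k (arcsin s) < ellK k \<and> jsn k (ellF k (arcsin s)) = s"
    using ellF_strict_mono[of 0 "arcsin s"] ellF_strict_mono[of "arcsin s" "pi / 2"] assms
    by (auto simp: jsn_def ellK_def)
  then show "\<exists>u. 0 < u \<and> u < ellK k \<and> jsn k u = s" by blast
next
  fix u v assume "0 < u \<and> u < ellK k \<and> jsn k u = s" "0 < v \<and> v < ellK k \<and> jsn k v = s"
  then show "u = v" using jsn_strict_mono[of u v] jsn_strict_mono[of v u]
    by (cases u v rule: linorder_cases) auto
qed

text \<open>This is the product cn dn, which is the derivative of sn.\<close>

definition jsn1 :: "real \<Rightarrow> real" where
  "jsn1 u = cos (jam k u) * sqrt (1 - k\<^sup>2 * (jsn k u)\<^sup>2)"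

lemma jsn_deriv: "(jsn k has_real_derivative jsn1 u) (at u)"
  unfolding jsn_def[abs_def] jsn1_def
  by (auto intro!: derivative_eq_intros jam_deriv)

lemma jsn1_square: "(jsn1 u)\<^sup>2 = (1 - (jsn k u)\<^sup>2) * (1 - k\<^sup>2 * (jsn k u)\<^sup>2)"
  using one_minus_ksin_pos[of "jam k u"]
  by (simp add: jsn1_def jsn_def power_mult_distrib cos_squared_eq)

lemma jsn1_deriv: "(jsn1 has_real_derivative 2 * k\<^sup>2 * (jsn k u) ^ 3 - (1 + k\<^sup>2) * jsn k u) (at u)"
proof -
  define d where "d = sqrt (1 - k\<^sup>2 * (sin (jam k u))\<^sup>2)"
  have d: "d > 0" "d\<^sup>2 = 1 - k\<^sup>2 * (sin (jam k u))\<^sup>2"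
    using one_minus_ksin_pos[of "jam k u"] by (simp_all add: d_def)
  have "((\<lambda>u. cos (jam k u) * sqrt (1 - k\<^sup>2 * (sin (jam k u))\<^sup>2)) has_real_derivative
       (- sin (jam k u) * d * d + cos (jam k u) * (- (k\<^sup>2 * (2 * sin (jam k u) * (cos (jam k u) * d))) * (inverse d / 2)))) (at u)"
    using one_minus_ksin_pos[of "jam k u"]
    by (auto intro!: derivative_eq_intros jam_deriv simp: d_def)
  also have "(- sin (jam k u) * d * d + cos (jam k u) * (- (k\<^sup>2 * (2 * sin (jam k u) * (cos (jam k u) * d))) * (inverse d / 2)))
     = - sin (jam k u) * d\<^sup>2 - k\<^sup>2 * sin (jam k u) * (cos (jam k u))\<^sup>2"
    using d(1) by (simp add: power2_eq_square field_simps)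
  also have "\<dots> = 2 * k\<^sup>2 * (jsn k u) ^ 3 - (1 + k\<^sup>2) * jsn k u"
    unfolding d(2) cos_squared_eq by (simp add: jsn_def power2_eq_square power3_eq_cube algebra_simps)
  finally show ?thesis unfolding jsn1_def jsn_def .
qed

lemma jsn1_0: "jsn1 0 = 1"
  by (simp add: jsn1_def)

lemma jsn_square_le_1: "(jsn k u)\<^sup>2 \<le> 1"
  by (simp add: jsn_def abs_square_le_1)

end

section \<open>Monotone dependence of K and of the nome on the modulus\<close>

lemma ellF_strict_mono_modulus:
  assumes "0 < k" "k < l" "l < 1" "0 < x"
  shows "ellF k x < ellF l x"
proof -
  have k: "0 < k" "k < 1" and l: "0 < l" "l < 1" using assms by auto
  define g where "g = (\<lambda>t. 1 / sqrt (1 - l\<^sup>2 * (sin t)\<^sup>2) - 1 / sqrt (1 - k\<^sup>2 * (sin t)\<^sup>2))"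
  have d: "((\<lambda>x. ellF l x - ellF k x) has_real_derivative g t) (at t)" for t
    unfolding g_def by (intro DERIV_diff ellF_deriv k l)
  have le: "1 / sqrt (1 - k\<^sup>2 * (sin t)\<^sup>2) < 1 / sqrt (1 - l\<^sup>2 * (sin t)\<^sup>2)" if "sin t \<noteq> 0" for t
  proof -
    have "k\<^sup>2 < l\<^sup>2" using assms by (intro power_strict_mono) auto
    then have "k\<^sup>2 * (sin t)\<^sup>2 < l\<^sup>2 * (sin t)\<^sup>2" using that by (intro mult_strict_right_mono) auto
    then show ?thesis
      using one_minus_ksin_pos[OF l, of t] one_minus_ksin_pos[OF k, of t]
      by (intro divide_strict_left_mono) (auto simp del: real_sqrt_mult)
  qed
  have nn: "g t \<ge> 0" for t
    by (cases "sin t = 0") (use le[of t] in \<open>auto simp: g_def\<close>)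
  \<comment> \<open>On (0, y) the sine is positive because y < pi, so the strict gain happens there;
    beyond y weak monotonicity is enough.\<close>
  define y where "y = min x 1"
  have y: "0 < y" "y \<le> x" "y < pi" using assms pi_gt3 by (auto simp: y_def)
  have "ellF l 0 - ellF k 0 < ellF l y - ellF k y"
  proof (rule DERIV_pos_imp_increasing_open[OF y(1)])
    fix t assume "0 < t" "t < y"
    then have "sin t > 0" using y by (intro sin_gt_zero) auto
    with le[of t] d[of t] show "\<exists>D. ((\<lambda>x. ellF l x - ellF k x) has_real_derivative D) (at t) \<and> 0 < D"
      by (intro exI[of _ "g t"]) (auto simp: g_def)
  next
    show "continuous_on {0..y} (\<lambda>x. ellF l x - ellF k x)"
      by (rule DERIV_continuous_on[OF has_field_derivative_at_within[OF d]])
  qed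
  also have "ellF l y - ellF k y \<le> ellF l x - ellF k x"
    by (rule DERIV_nonneg_imp_nondecreasing[OF y(2)]) (use d nn in blast)
  finally show ?thesis by (simp add: ellF_0[OF k] ellF_0[OF l])
qed

lemma ellK_strict_mono: "0 < k \<Longrightarrow> k < l \<Longrightarrow> l < 1 \<Longrightarrow> ellK k < ellK l"
  unfolding ellK_def by (rule ellF_strict_mono_modulus) auto

lemma compl_modulus: "0 < k \<Longrightarrow> k < 1 \<Longrightarrow> 0 < sqrt (1 - k\<^sup>2) \<and> sqrt (1 - k\<^sup>2) < (1::real)"
  by (simp add: power_less_one_iff)

text \<open>As the modulus grows, K increases and K' decreases, so the ratio K'/K in the exponent
  falls.\<close>

lemma nome_strict_mono:
  assumes "0 < k" "k < l" "l < 1"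
  shows "nome k < nome l"
proof -
  have kl: "k\<^sup>2 < l\<^sup>2" using assms by (intro power_strict_mono) auto
  have l1: "0 < sqrt (1 - l\<^sup>2)" using compl_modulus[of l] assms by simp
  have "ellK' l < ellK' k"
    unfolding ellK'_def using kl assms l1 compl_modulus[of k] by (intro ellK_strict_mono) auto
  moreover have "0 < ellK' l" unfolding ellK'_def using compl_modulus[of l] assms by (intro ellK_pos) auto
  moreover have "0 < ellK k" "ellK k < ellK l" using assms ellK_strict_mono ellK_pos[of k] by auto
  ultimately have "ellK' l / ellK l < ellK' k / ellK k"
    by (intro frac_less) auto
  then have "pi * (ellK' l / ellK l) < pi * (ellK' k / ellK k)"
    by (intro mult_strict_left_mono) simp_all
  then show ?thesis by (simp add: nome_def)
qed

lemma nome_inj: "0 < k \<Longrightarrow> k < 1 \<Longrightarrow> 0 < l \<Longrightarrow> l < 1 \<Longrightarrow> nome k = nome l \<Longrightarrow> k = l"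
  using nome_strict_mono[of k l] nome_strict_mono[of l k] by (metis less_irrefl linorder_neqE_linordered_idom)

lemma nome_bounds: assumes "0 < k" "k < 1" shows "0 < nome k" "nome k < 1"
proof -
  have "0 < ellK' k" unfolding ellK'_def using compl_modulus[of k] assms by (intro ellK_pos) auto
  then show "0 < nome k" "nome k < 1" using ellK_pos[OF assms] by (simp_all add: nome_def)
qed

section \<open>The theta quotient\<close>

lemma jsn_minus: "0 < k \<Longrightarrow> k < 1 \<Longrightarrow> jsn k (- u) = - jsn k u"
  using jam_ellF[of k "- jam k u"] by (simp add: jsn_def ellF_minus)

text \<open>For \<open>s = \<theta>\<^sub>1 / \<theta>\<^sub>4\<close> the addition formulas read
  \<open>s(x+y) s(x-y) (1 - s(x)\<^sup>2 s(y)\<^sup>2) = s(x)\<^sup>2 - s(y)\<^sup>2\<close>; comparing second order terms at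
  \<open>y = 0\<close> yields a differential equation for \<open>s\<close>.\<close>

lemma addition_law_imp_ode:
  fixes s s' s'' :: "complex \<Rightarrow> complex"
  assumes U: "open U" "x \<in> U" "0 \<in> U"
    and d: "\<And>z. z \<in> U \<Longrightarrow> (s has_field_derivative s' z) (at z)"
      "\<And>z. z \<in> U \<Longrightarrow> (s' has_field_derivative s'' z) (at z)"
    and s0: "s 0 = 0"
    and add: "\<And>y. y \<in> U \<Longrightarrow> x + y \<in> U \<Longrightarrow> x - y \<in> U \<Longrightarrow>
       s (x + y) * s (x - y) * (1 - (s x)\<^sup>2 * (s y)\<^sup>2) = (s x)\<^sup>2 - (s y)\<^sup>2"
  shows "s x * s'' x - (s' x)\<^sup>2 = (s' 0)\<^sup>2 * ((s x) ^ 4 - 1)"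
proof -
  \<comment> \<open>The \<open>y\<close> for which all three arguments \<open>y\<close>,
    \<open>x + y\<close>, \<open>x - y\<close> stay in \<open>U\<close>: an open set containing
    0.\<close>
  define V where "V = U \<inter> ((\<lambda>y. x + y) -` U) \<inter> ((\<lambda>y. x - y) -` U)"
  have "open ((\<lambda>y. x + y) -` U)" "open ((\<lambda>y. x - y) -` U)"
    by (intro continuous_open_vimage continuous_intros U(1))+
  then have V: "open V" unfolding V_def using U(1) by (intro open_Int)
  have V0: "0 \<in> V" using U by (simp add: V_def)
  have VD: "y \<in> U" "x + y \<in> U" "x - y \<in> U" if "y \<in> V" for y using that by (auto simp: V_def)
  have sh: "((\<lambda>y. x + y) has_field_derivative 1) (at y)" "((\<lambda>y. x - y) has_field_derivative -1) (at y)" for y :: complex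
    by (auto intro!: derivative_eq_intros)
  note ds = d(1)[OF VD(1)] DERIV_chain2[OF d(1)[OF VD(2)] sh(1)] DERIV_chain2[OF d(1)[OF VD(3)] sh(2)]
  note ds' = d(2)[OF VD(1)] DERIV_chain2[OF d(2)[OF VD(2)] sh(1)] DERIV_chain2[OF d(2)[OF VD(3)] sh(2)]
  define F where "F = (\<lambda>y. s (x + y) * s (x - y) * (1 - (s x)\<^sup>2 * (s y)\<^sup>2) - (s x)\<^sup>2 + (s y)\<^sup>2)"
  define F1 where "F1 = (\<lambda>y. (s' (x + y) * s (x - y) - s (x + y) * s' (x - y)) * (1 - (s x)\<^sup>2 * (s y)\<^sup>2)
       - 2 * s (x + y) * s (x - y) * (s x)\<^sup>2 * s y * s' y + 2 * s y * s' y)"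
  have dF: "(F has_field_derivative F1 y) (at y)" if "y \<in> V" for y
    unfolding F_def
    by (rule ds[OF that] derivative_eq_intros refl)+ (simp add: F1_def algebra_simps power2_eq_square)
  have F0: "F y = 0" if "y \<in> V" for y
    using add[OF VD[OF that]] by (simp add: F_def)
  have F1_0: "F1 y = 0" if "y \<in> V" for y
  proof -
    have "((\<lambda>_. 0) has_field_derivative F1 y) (at y)"
      by (rule has_field_derivative_transform_within_open[OF dF[OF that] V that]) (simp add: F0)
    then show ?thesis using DERIV_unique DERIV_const by blast
  qed
  \<comment> \<open>This is the second derivative at 0 of a function that vanishes on
    \<open>V\<close>; since s(0) = 0, all other products drop out.\<close>
  have "(F1 has_field_derivative (2 * s x * s'' x - 2 * (s' x)\<^sup>2 - 2 * (s x) ^ 4 * (s' 0)\<^sup>2 + 2 * (s' 0)\<^sup>2)) (at 0)"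
    unfolding F1_def
    by (rule ds[OF V0] ds'[OF V0] derivative_eq_intros refl)+
       (simp add: s0 algebra_simps power2_eq_square power4_eq_xxxx)
  then have "((\<lambda>_. 0) has_field_derivative (2 * s x * s'' x - 2 * (s' x)\<^sup>2 - 2 * (s x) ^ 4 * (s' 0)\<^sup>2 + 2 * (s' 0)\<^sup>2)) (at 0)"
    by (rule has_field_derivative_transform_within_open[OF _ V V0]) (simp add: F1_0)
  then have "2 * s x * s'' x - 2 * (s' x)\<^sup>2 - 2 * (s x) ^ 4 * (s' 0)\<^sup>2 + 2 * (s' 0)\<^sup>2 = 0"
    using DERIV_unique DERIV_const by blast
  then have "2 * (s x * s'' x - (s' x)\<^sup>2) = 2 * ((s' 0)\<^sup>2 * ((s x) ^ 4 - 1))"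
    by (simp add: algebra_simps)
  then show ?thesis by (subst (asm) mult_left_cancel) simp_all
qed

context
  fixes q :: real
  assumes q: "0 < q" "q < 1"
begin

text \<open>The half width is the height of the zero of \<open>jtheta4\<close> in
  \<open>jtheta4_half_period\<close>, so this is the widest such strip on which the quotient has no
  pole.\<close>

definition strip :: "complex set" where "strip = {z. \<bar>Im z\<bar> < - ln q / 2}"

definition theta_quot :: "complex \<Rightarrow> complex" where "theta_quot z = jtheta1 q z / jtheta4 q z"

lemma open_strip: "open strip"
  unfolding strip_def by (intro open_Collect_less continuous_intros)

lemma convex_strip: "convex strip"
proof -
  have "strip = {z. Im z < - ln q / 2} \<inter> {z. Im z > - (- ln q / 2)}"
    by (auto simp: strip_def)
  then show ?thesis by (simp only: convex_Int convex_halfspace_Im_lt convex_halfspace_Im_gt)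
qed

lemma real_in_strip: "of_real y \<in> strip"
  using q by (simp add: strip_def)

lemma zero_in_strip: "0 \<in> strip"
  using q by (simp add: strip_def)

lemma jtheta4_nonzero_strip: "z \<in> strip \<Longrightarrow> jtheta4 q z \<noteq> 0"
  unfolding strip_def using jtheta4_nonzero[OF q] by blast

lemma theta_quot_holomorphic: "theta_quot holomorphic_on strip"
  unfolding theta_quot_def using jtheta4_nonzero_strip by (intro holomorphic_on_divide jtheta_holomorphic[OF q])

lemma theta_quot_deriv: "z \<in> strip \<Longrightarrow> (theta_quot has_field_derivative deriv theta_quot z) (at z)"
  using holomorphic_derivI[OF theta_quot_holomorphic open_strip] .

lemma theta_quot_deriv2: "z \<in> strip \<Longrightarrow> (deriv theta_quot has_field_derivative deriv (deriv theta_quot) z) (at z)"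
  using holomorphic_derivI[OF holomorphic_deriv[OF theta_quot_holomorphic open_strip] open_strip] .

lemma theta_quot_0: "theta_quot 0 = 0"
  by (simp add: theta_quot_def jtheta1_0[OF q])

lemma theta_quot_minus: "theta_quot (- z) = - theta_quot z"
  by (simp add: theta_quot_def jtheta1_minus[OF q] jtheta4_minus[OF q])

lemma theta_quot_pi_minus: "theta_quot (of_real pi - z) = theta_quot z"
  by (simp add: theta_quot_def jtheta1_pi_minus[OF q] jtheta4_pi_minus[OF q])

lemma theta_quot_cnj: "theta_quot (cnj z) = cnj (theta_quot z)"
  by (simp add: theta_quot_def jtheta1_cnj[OF q] jtheta4_cnj[OF q])

lemma theta_quot_addition:
  assumes "x \<in> strip" "y \<in> strip" "x + y \<in> strip" "x - y \<in> strip"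
  shows "theta_quot (x + y) * theta_quot (x - y) * (1 - (theta_quot x)\<^sup>2 * (theta_quot y)\<^sup>2) = (theta_quot x)\<^sup>2 - (theta_quot y)\<^sup>2"
proof -
  note nz = assms[THEN jtheta4_nonzero_strip] zero_in_strip[THEN jtheta4_nonzero_strip]
  define c where "c = (jtheta4 q 0)\<^sup>2"
  have e: "jtheta1 q z = theta_quot z * jtheta4 q z" if "z \<in> strip" for z
    using jtheta4_nonzero_strip[OF that] by (simp add: theta_quot_def)
  have 1: "jtheta4 q (x + y) * jtheta4 q (x - y) * c = (jtheta4 q x)\<^sup>2 * (jtheta4 q y)\<^sup>2 * (1 - (theta_quot x)\<^sup>2 * (theta_quot y)\<^sup>2)"
    unfolding c_def jtheta4_addition[OF q] e[OF assms(1)] e[OF assms(2)]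
    by (simp add: algebra_simps power_mult_distrib)
  have 2: "theta_quot (x + y) * theta_quot (x - y) * (jtheta4 q (x + y) * jtheta4 q (x - y) * c)
       = (jtheta4 q x)\<^sup>2 * (jtheta4 q y)\<^sup>2 * ((theta_quot x)\<^sup>2 - (theta_quot y)\<^sup>2)"
    using jtheta1_addition[OF q, of x y] unfolding c_def e[OF assms(1)] e[OF assms(2)] e[OF assms(3)] e[OF assms(4)]
    by (simp add: algebra_simps power_mult_distrib)
  have "(jtheta4 q x)\<^sup>2 * (jtheta4 q y)\<^sup>2 * (theta_quot (x + y) * theta_quot (x - y) * (1 - (theta_quot x)\<^sup>2 * (theta_quot y)\<^sup>2))
     = (jtheta4 q x)\<^sup>2 * (jtheta4 q y)\<^sup>2 * ((theta_quot x)\<^sup>2 - (theta_quot y)\<^sup>2)"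
    using 2 unfolding 1 by (simp add: mult_ac)
  then show ?thesis using nz by simp
qed

lemma theta_quot_ode:
  assumes "x \<in> strip"
  shows "theta_quot x * deriv (deriv theta_quot) x - (deriv theta_quot x)\<^sup>2 = (deriv theta_quot 0)\<^sup>2 * ((theta_quot x) ^ 4 - 1)"
  by (rule addition_law_imp_ode[OF open_strip assms zero_in_strip theta_quot_deriv theta_quot_deriv2 theta_quot_0 theta_quot_addition[OF assms]])

text \<open>The ratio theta_2(0)/theta_3(0), which is also the value of the quotient at pi/2. It
  will turn out to be the square root of the modulus.\<close>

definition s0 :: real where "s0 = Re (theta_ser q (1/2) 0) / Re (theta_ser q 0 0)"

lemma s0: "0 < s0" "s0 < 1"
  using theta_ser_0_real_pos(2)[OF q] theta_ser_half_less_0[OF q] by (simp_all add: s0_def)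

lemma theta_quot_pi_half: "theta_quot (of_real pi / 2) = of_real s0"
  using theta_ser_0_real_pos(1)[OF q] by (simp add: theta_quot_def s0_def jtheta_pi_half[OF q])

lemma deriv_theta_quot_pi_half: "deriv theta_quot (of_real pi / 2) = 0"
proof -
  have h: "of_real pi / 2 \<in> strip" using real_in_strip[of "pi / 2"] by simp
  have sh: "((\<lambda>z. of_real pi - z) has_field_derivative -1) (at z)" for z :: complex
    by (auto intro!: derivative_eq_intros)
  have "((\<lambda>z. theta_quot (of_real pi - z)) has_field_derivative deriv theta_quot (of_real pi / 2) * -1) (at (of_real pi / 2))"
    using h by (intro DERIV_chain2[OF _ sh]) (simp add: theta_quot_deriv)
  then have "(theta_quot has_field_derivative - deriv theta_quot (of_real pi / 2)) (at (of_real pi / 2))"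
    by (simp add: theta_quot_pi_minus)
  then have "deriv theta_quot (of_real pi / 2) = - deriv theta_quot (of_real pi / 2)"
    by (rule DERIV_unique[OF theta_quot_deriv[OF h]])
  then show ?thesis by simp
qed

lemma theta_quot_nonzero:
  assumes "z \<in> strip" "0 < Re z" "Re z < pi"
  shows "theta_quot z \<noteq> 0"
proof
  assume "theta_quot z = 0"
  then have "jtheta1 q z = 0" using jtheta4_nonzero_strip[OF assms(1)] by (simp add: theta_quot_def)
  then have "sin z = 0" using jtheta1_zero[OF q, of z] assms by (simp add: strip_def)
  then obtain n :: int where "z = of_real (of_int n * pi)" unfolding sin_eq_0 by auto
  then have n: "0 < of_int n * pi" "of_int n * pi < 1 * pi" using assms by simp_all
  have "of_int n < (1::real)" using n(2) by (rule mult_right_less_imp_less) simp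
  with n(1) show False by (simp add: zero_less_mult_iff)
qed

text \<open>The equation s s'' - s'^2 = A^2 (s^4 - 1) says precisely that (s'^2 - A^2 (1 + s^4)) /
  s^2 has derivative 0. The constant is read off at pi/2, where s' = 0 and s = s0. Division by s^2
  is why the claim is first confined to 0 < Re z < pi.\<close>

lemma theta_quot_first_integral_aux:
  assumes z: "z \<in> strip" "0 < Re z" "Re z < pi"
  shows "(deriv theta_quot z)\<^sup>2 = (deriv theta_quot 0)\<^sup>2 * (1 - (theta_quot z)\<^sup>2 / of_real (s0\<^sup>2)) * (1 - of_real (s0\<^sup>2) * (theta_quot z)\<^sup>2)"
proof -
  define V where "V = strip \<inter> {z. 0 < Re z} \<inter> {z. Re z < pi}"
  define A where "A = deriv theta_quot 0"
  have V: "convex V" unfolding V_def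
    by (intro convex_Int convex_strip convex_halfspace_Re_gt convex_halfspace_Re_lt)
  have nz: "theta_quot z \<noteq> 0" if "z \<in> V" for z using theta_quot_nonzero that by (auto simp: V_def)
  define E where "E = (\<lambda>z. ((deriv theta_quot z)\<^sup>2 - A\<^sup>2 * (1 + (theta_quot z) ^ 4)) / (theta_quot z)\<^sup>2)"
  have "(E has_field_derivative 0) (at z within V)" if "z \<in> V" for z
  proof -
    have zs: "z \<in> strip" using that by (simp add: V_def)
    define a b c where "a = theta_quot z" and "b = deriv theta_quot z" and "c = deriv (deriv theta_quot) z"
    have a: "a \<noteq> 0" using nz[OF that] by (simp add: a_def)
    have abc: "a * c - b\<^sup>2 = A\<^sup>2 * (a ^ 4 - 1)"
      using theta_quot_ode[OF zs] by (simp add: a_def b_def c_def A_def)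
    have "(E has_field_derivative
        (((2 * b * c - A\<^sup>2 * (4 * a ^ 3 * b)) * a\<^sup>2 - (b\<^sup>2 - A\<^sup>2 * (1 + a ^ 4)) * (2 * a * b)) / (a\<^sup>2 * a\<^sup>2))) (at z)"
      unfolding E_def
      by (rule theta_quot_deriv[OF zs] theta_quot_deriv2[OF zs] derivative_eq_intros refl)+
         (use a in \<open>auto simp: a_def[symmetric] b_def[symmetric] c_def[symmetric]\<close>)
    also have "((2 * b * c - A\<^sup>2 * (4 * a ^ 3 * b)) * a\<^sup>2 - (b\<^sup>2 - A\<^sup>2 * (1 + a ^ 4)) * (2 * a * b))
         = 2 * a * b * ((a * c - b\<^sup>2) - A\<^sup>2 * (a ^ 4 - 1))"
      by (simp add: algebra_simps power2_eq_square power3_eq_cube power4_eq_xxxx)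
    also have "\<dots> = 0" unfolding abc by simp
    finally show ?thesis by (simp add: has_field_derivative_at_within)
  qed
  then obtain c where c: "\<And>z. z \<in> V \<Longrightarrow> E z = c"
    using has_field_derivative_zero_constant[OF V, of E] by blast
  have h: "of_real pi / 2 \<in> V" using real_in_strip[of "pi / 2"] by (simp add: V_def)
  have zV: "z \<in> V" using z by (simp add: V_def)
  have "E z = E (of_real pi / 2)" using c[OF h] c[OF zV] by simp
  then have "((deriv theta_quot z)\<^sup>2 - A\<^sup>2 * (1 + (theta_quot z) ^ 4)) / (theta_quot z)\<^sup>2 = - (A\<^sup>2 * (1 + of_real s0 ^ 4) / (of_real s0)\<^sup>2)"
    by (simp add: E_def theta_quot_pi_half deriv_theta_quot_pi_half)
  then have "(deriv theta_quot z)\<^sup>2 - A\<^sup>2 * (1 + (theta_quot z) ^ 4) = - (A\<^sup>2 * (1 + of_real s0 ^ 4) / (of_real s0)\<^sup>2) * (theta_quot z)\<^sup>2"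
    using nz[OF zV] by (subst (asm) divide_eq_eq) simp
  then have "(deriv theta_quot z)\<^sup>2 = A\<^sup>2 * (1 + (theta_quot z) ^ 4) - (A\<^sup>2 * (1 + of_real s0 ^ 4) / (of_real s0)\<^sup>2) * (theta_quot z)\<^sup>2"
    by (simp only: diff_eq_eq) simp
  also have "\<dots> = A\<^sup>2 * (1 - (theta_quot z)\<^sup>2 / of_real (s0\<^sup>2)) * (1 - of_real (s0\<^sup>2) * (theta_quot z)\<^sup>2)"
    using s0 by (simp add: field_simps power2_eq_square power4_eq_xxxx)
  finally show ?thesis by (simp add: A_def)
qed

text \<open>The identity theorem, used to extend what was obtained by dividing by
  \<open>theta_quot\<close> to the whole strip, in particular to 0 and the imaginary axis.\<close>

lemma strip_identity:
  assumes f: "f holomorphic_on strip" "g holomorphic_on strip"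
    and eq: "\<And>z. z \<in> strip \<Longrightarrow> 0 < Re z \<Longrightarrow> Re z < pi \<Longrightarrow> f z = g z" and w: "w \<in> strip"
  shows "f w = g w"
proof (rule analytic_continuation_open[where s = "strip \<inter> {z. 0 < Re z} \<inter> {z. Re z < pi}" and s' = strip and f = f and g = g])
  show "open (strip \<inter> {z. 0 < Re z} \<inter> {z. Re z < pi})"
    by (intro open_Int open_strip open_halfspace_Re_gt open_halfspace_Re_lt)
  show "strip \<inter> {z. 0 < Re z} \<inter> {z. Re z < pi} \<noteq> {}"
    using real_in_strip[of "pi / 2"] by (auto intro!: exI[of _ "of_real pi / 2"])
  show "connected strip" by (rule convex_connected[OF convex_strip])
qed (use assms open_strip in auto)

lemma theta_quot_first_integral:
  assumes "z \<in> strip"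
  shows "(deriv theta_quot z)\<^sup>2 = (deriv theta_quot 0)\<^sup>2 * (1 - (theta_quot z)\<^sup>2 / of_real (s0\<^sup>2)) * (1 - of_real (s0\<^sup>2) * (theta_quot z)\<^sup>2)"
proof (rule strip_identity[OF _ _ _ assms])
  show "(\<lambda>z. (deriv theta_quot z)\<^sup>2) holomorphic_on strip"
    by (intro holomorphic_intros holomorphic_deriv[OF theta_quot_holomorphic open_strip])
  show "(\<lambda>z. (deriv theta_quot 0)\<^sup>2 * (1 - (theta_quot z)\<^sup>2 / of_real (s0\<^sup>2)) * (1 - of_real (s0\<^sup>2) * (theta_quot z)\<^sup>2)) holomorphic_on strip"
    using s0 by (intro holomorphic_intros theta_quot_holomorphic) auto
qed (rule theta_quot_first_integral_aux)

text \<open>Inserting the first integral into the equation for s s'' leaves a right-hand side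
  divisible by s. The result is a cubic equation of the type that sn satisfies.\<close>

lemma theta_quot_second_order:
  assumes "z \<in> strip"
  shows "deriv (deriv theta_quot) z = (deriv theta_quot 0)\<^sup>2 * (2 * (theta_quot z) ^ 3 - of_real (s0\<^sup>2 + 1 / s0\<^sup>2) * theta_quot z)"
proof (rule strip_identity[OF _ _ _ assms])
  show "deriv (deriv theta_quot) holomorphic_on strip"
    by (intro holomorphic_deriv theta_quot_holomorphic open_strip)
  show "(\<lambda>z. (deriv theta_quot 0)\<^sup>2 * (2 * (theta_quot z) ^ 3 - of_real (s0\<^sup>2 + 1 / s0\<^sup>2) * theta_quot z)) holomorphic_on strip"
    by (intro holomorphic_intros theta_quot_holomorphic)
next
  fix z assume z: "z \<in> strip" "0 < Re z" "Re z < pi"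
  define A where "A = deriv theta_quot 0"
  have "theta_quot z * deriv (deriv theta_quot) z = A\<^sup>2 * ((theta_quot z) ^ 4 - 1) + A\<^sup>2 * (1 - (theta_quot z)\<^sup>2 / of_real (s0\<^sup>2)) * (1 - of_real (s0\<^sup>2) * (theta_quot z)\<^sup>2)"
    using theta_quot_ode[OF z(1)] theta_quot_first_integral[OF z(1)] by (simp add: A_def algebra_simps)
  also have "\<dots> = theta_quot z * (A\<^sup>2 * (2 * (theta_quot z) ^ 3 - of_real (s0\<^sup>2 + 1 / s0\<^sup>2) * theta_quot z))"
    using s0 by (simp add: field_simps power2_eq_square power3_eq_cube power4_eq_xxxx)
  finally show "deriv (deriv theta_quot) z = (deriv theta_quot 0)\<^sup>2 * (2 * (theta_quot z) ^ 3 - of_real (s0\<^sup>2 + 1 / s0\<^sup>2) * theta_quot z)"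
    using theta_quot_nonzero[OF z] by (simp add: A_def)
qed

end

section \<open>Identification of the nome\<close>

lemma has_real_derivative_along_line:
  assumes "(f has_field_derivative D) (at (a * of_real t))"
  shows "((\<lambda>t. Re (f (a * of_real t))) has_real_derivative Re (D * a)) (at t)"
    and "((\<lambda>t. Im (f (a * of_real t))) has_real_derivative Im (D * a)) (at t)"
proof -
  have "((\<lambda>z. a * z) has_field_derivative a) (at (of_real t))"
    by (auto intro!: derivative_eq_intros)
  from DERIV_chain2[OF assms this]
  have *: "((\<lambda>t. f (a * of_real t)) has_vector_derivative D * a) (at t)"
    by (rule has_vector_derivative_real_field)
  show "((\<lambda>t. Re (f (a * of_real t))) has_real_derivative Re (D * a)) (at t)"
    by (rule has_field_derivative_Re[OF *])
  show "((\<lambda>t. Im (f (a * of_real t))) has_real_derivative Im (D * a)) (at t)"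
    by (rule has_field_derivative_Im[OF *])
qed

context
  fixes q :: real
  assumes q: "0 < q" "q < 1"
begin

definition kap :: real where "kap = (s0 q)\<^sup>2"
text \<open>The derivative at 0 of the quotient scaled to have value 1 at pi/2. It converts theta
  arguments into arguments of sn and will be shown to equal 2K/pi.\<close>

definition slope :: real where "slope = Re (deriv (theta_quot q) 0) / s0 q"

lemma kap: "0 < kap" "kap < 1"
  using s0[OF q] by (simp_all add: kap_def power_less_one_iff)

lemma Im_theta_quot_real: "Im (theta_quot q (of_real y)) = 0"
  using arg_cong[OF theta_quot_cnj[OF q, of "of_real y"], of Im] by simp

lemma Re_theta_quot_imag: "Re (theta_quot q (\<i> * of_real t)) = 0"
  using arg_cong[OF theta_quot_cnj[OF q, of "\<i> * of_real t"], of Re] theta_quot_minus[OF q, of "\<i> * of_real t"] by simp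

lemma Im_deriv_theta_quot_real: "Im (deriv (theta_quot q) (of_real y)) = 0"
proof -
  have "((\<lambda>t. Im (theta_quot q (1 * of_real t))) has_real_derivative Im (deriv (theta_quot q) (of_real y) * 1)) (at y)"
    by (rule has_real_derivative_along_line) (use theta_quot_deriv[OF q real_in_strip[OF q, of y]] in simp)
  then have "((\<lambda>t. 0) has_real_derivative Im (deriv (theta_quot q) (of_real y))) (at y)"
    by (simp add: Im_theta_quot_real)
  then show ?thesis using DERIV_unique DERIV_const by blast
qed

lemma deriv_theta_quot_0: "deriv (theta_quot q) 0 = of_real (s0 q * slope)"
  using Im_deriv_theta_quot_real[of 0] s0[OF q] by (simp add: slope_def complex_eq_iff)

definition sR :: "real \<Rightarrow> real" where "sR y = Re (theta_quot q (of_real y)) / s0 q"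

lemma theta_quot_real: "theta_quot q (of_real y) = of_real (s0 q * sR y)"
  using Im_theta_quot_real[of y] s0[OF q] by (simp add: sR_def complex_eq_iff)

text \<open>Both sides solve the same cubic equation with value 0 and derivative
  \<open>slope\<close> at 0. The argument is indifferent to the sign of \<open>slope\<close>, which
  is still open at this point.\<close>

lemma sR_eq_jsn: "sR y = jsn kap (slope * y)"
proof -
  define S1 where "S1 = (\<lambda>y. Re (deriv (theta_quot q) (of_real y)) / s0 q)"
  have nz: "s0 q \<noteq> 0" using s0[OF q] by simp
  have 1: "(sR has_real_derivative S1 y) (at y)" for y
  proof -
    have "((\<lambda>t. Re (theta_quot q (1 * of_real t))) has_real_derivative Re (deriv (theta_quot q) (of_real y) * 1)) (at y)"
      by (rule has_real_derivative_along_line) (use theta_quot_deriv[OF q real_in_strip[OF q, of y]] in simp)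
    then show ?thesis unfolding sR_def[abs_def] S1_def by (intro DERIV_cdivide) simp
  qed
  have 2: "(S1 has_real_derivative 0 + (- slope\<^sup>2 * (1 + kap\<^sup>2)) * sR y + (2 * slope\<^sup>2 * kap\<^sup>2) * sR y ^ 3) (at y)" for y
  proof -
    have "((\<lambda>t. Re (deriv (theta_quot q) (1 * of_real t))) has_real_derivative Re (deriv (deriv (theta_quot q)) (of_real y) * 1)) (at y)"
      by (rule has_real_derivative_along_line) (use theta_quot_deriv2[OF q real_in_strip[OF q, of y]] in simp)
    then have "(S1 has_real_derivative Re (deriv (deriv (theta_quot q)) (of_real y)) / s0 q) (at y)"
      unfolding S1_def by (intro DERIV_cdivide) simp
    moreover have "deriv (deriv (theta_quot q)) (of_real y) = of_real ((s0 q * slope)\<^sup>2 * (2 * (s0 q * sR y) ^ 3 - ((s0 q)\<^sup>2 + 1 / (s0 q)\<^sup>2) * (s0 q * sR y)))"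
      unfolding theta_quot_second_order[OF q real_in_strip[OF q]] theta_quot_real deriv_theta_quot_0 by simp
    then have "Re (deriv (deriv (theta_quot q)) (of_real y)) / s0 q = (s0 q * slope)\<^sup>2 * (2 * (s0 q * sR y) ^ 3 - ((s0 q)\<^sup>2 + 1 / (s0 q)\<^sup>2) * (s0 q * sR y)) / s0 q"
      by (simp only: Re_complex_of_real)
    moreover have "\<dots> = 0 + (- slope\<^sup>2 * (1 + kap\<^sup>2)) * sR y + (2 * slope\<^sup>2 * kap\<^sup>2) * sR y ^ 3"
      using nz by (simp add: kap_def field_simps power2_eq_square power3_eq_cube)
    ultimately show ?thesis by simp
  qed
  have ch: "((\<lambda>y. slope * y) has_real_derivative slope) (at y)" for y
    by (auto intro!: derivative_eq_intros)
  have 3: "((\<lambda>y. jsn kap (slope * y)) has_real_derivative slope * jsn1 kap (slope * y)) (at y)" for y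
    using DERIV_chain2[OF jsn_deriv[OF kap] ch] by (simp add: mult.commute)
  have 4: "((\<lambda>y. slope * jsn1 kap (slope * y)) has_real_derivative
      0 + (- slope\<^sup>2 * (1 + kap\<^sup>2)) * jsn kap (slope * y) + (2 * slope\<^sup>2 * kap\<^sup>2) * jsn kap (slope * y) ^ 3) (at y)" for y
    using DERIV_cmult[OF DERIV_chain2[OF jsn1_deriv[OF kap] ch], of slope y]
    by (simp add: algebra_simps power2_eq_square)
  show ?thesis
  proof (rule cubic_ode_unique[OF 1 2 3 4])
    show "sR 0 = jsn kap (slope * 0)" by (simp add: sR_def theta_quot_0[OF q] jsn_0[OF kap])
    show "S1 0 = slope * jsn1 kap (slope * 0)" by (simp add: S1_def slope_def jsn1_0[OF kap])
  qed
qed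

lemma sR_nonzero: "0 < y \<Longrightarrow> y < pi \<Longrightarrow> sR y \<noteq> 0"
  using theta_quot_nonzero[OF q real_in_strip[OF q, of y]] theta_quot_real[of y] by auto

text \<open>The first positive zero of \<open>sR\<close> is pi, that of sn is 2K, so |slope| pi =
  2K. The sign is then decided by the value 1 at pi/2.\<close>

lemma slope: "0 < slope" "slope * pi = 2 * ellK kap"
proof -
  have h: "sR (pi / 2) = 1"
    using theta_quot_pi_half[OF q] s0[OF q] by (simp add: sR_def)
  have p: "sR pi = 0"
    using theta_quot_pi_minus[OF q, of 0] by (simp add: sR_def theta_quot_0[OF q])
  define B where "B = \<bar>slope\<bar>"
  have ab: "sR y = jsn kap (B * y) \<or> sR y = - jsn kap (B * y)" for y
    using jsn_minus[OF kap, of "slope * y"] by (auto simp: B_def sR_eq_jsn abs_if)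
  have "slope \<noteq> 0" using h jsn_0[OF kap] by (auto simp: sR_eq_jsn)
  then have B: "B > 0" by (simp add: B_def)
  have K: "0 < ellK kap" by (rule ellK_pos[OF kap])
  have Bpi: "B * pi = 2 * ellK kap"
  proof (cases "B * pi" "2 * ellK kap" rule: linorder_cases)
    case less
    then have "jsn kap (B * pi) > 0" using B by (intro jsn_pos[OF kap]) auto
    then show ?thesis using ab[of pi] p by auto
  next
    case greater
    then have "2 * ellK kap / B < pi" using B by (simp add: field_simps)
    then have "sR (2 * ellK kap / B) \<noteq> 0" using B K by (intro sR_nonzero) auto
    moreover have "jsn kap (B * (2 * ellK kap / B)) = 0"
      using B jsn_add[OF kap, of 0] jsn_0[OF kap] by simp
    ultimately show ?thesis using ab[of "2 * ellK kap / B"] by auto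
  qed
  show "0 < slope"
  proof (rule ccontr)
    assume "\<not> 0 < slope"
    then have "slope * (pi / 2) = - ellK kap" using Bpi by (simp add: B_def)
    then have "sR (pi / 2) = -1" using jsn_minus[OF kap, of "ellK kap"] jsn_K[OF kap] by (simp add: sR_eq_jsn)
    then show False using h by simp
  qed
  then show "slope * pi = 2 * ellK kap" using Bpi by (simp add: B_def)
qed

text \<open>The first pole of the quotient on the positive imaginary axis is \<open>\<i> hper\<close>.\<close>

definition hper :: real where "hper = - ln q / 2"

lemma hper_pos: "0 < hper" using q by (simp add: hper_def)

lemma imag_in_strip: "\<bar>t\<bar> < hper \<Longrightarrow> \<i> * of_real t \<in> strip q"
  by (simp add: strip_def[OF q] hper_def)

text \<open>On the imaginary axis the quotient is purely imaginary, and this is its real profile. It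
  will be identified as the tangent of the amplitude for the complementary modulus.\<close>

definition rI :: "real \<Rightarrow> real" where "rI t = Im (theta_quot q (\<i> * of_real t)) / s0 q"
definition rI1 :: "real \<Rightarrow> real" where "rI1 t = Re (deriv (theta_quot q) (\<i> * of_real t)) / s0 q"

lemma theta_quot_imag: "theta_quot q (\<i> * of_real t) = \<i> * of_real (s0 q * rI t)"
  using Re_theta_quot_imag[of t] s0[OF q] by (simp add: rI_def complex_eq_iff)

lemma rI_deriv:
  assumes "\<bar>t\<bar> < hper" shows "(rI has_real_derivative rI1 t) (at t)"
proof -
  have "((\<lambda>t. Im (theta_quot q (\<i> * of_real t))) has_real_derivative Im (deriv (theta_quot q) (\<i> * of_real t) * \<i>)) (at t)"
    by (rule has_real_derivative_along_line) (rule theta_quot_deriv[OF q imag_in_strip[OF assms]])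
  then show ?thesis unfolding rI_def[abs_def] rI1_def by (intro DERIV_cdivide) simp
qed

lemma deriv_theta_quot_imag:
  assumes "\<bar>t\<bar> < hper" shows "deriv (theta_quot q) (\<i> * of_real t) = of_real (s0 q * rI1 t)"
proof -
  have "((\<lambda>t. Re (theta_quot q (\<i> * of_real t))) has_real_derivative Re (deriv (theta_quot q) (\<i> * of_real t) * \<i>)) (at t)"
    by (rule has_real_derivative_along_line) (rule theta_quot_deriv[OF q imag_in_strip[OF assms]])
  then have "((\<lambda>t. 0) has_real_derivative - Im (deriv (theta_quot q) (\<i> * of_real t))) (at t)"
    by (simp add: Re_theta_quot_imag)
  then have "- Im (deriv (theta_quot q) (\<i> * of_real t)) = 0" using DERIV_unique DERIV_const by blast
  then show ?thesis using s0[OF q] by (simp add: rI1_def complex_eq_iff)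
qed

lemma rI1_square:
  assumes "\<bar>t\<bar> < hper" shows "(rI1 t)\<^sup>2 = slope\<^sup>2 * (1 + (rI t)\<^sup>2) * (1 + kap\<^sup>2 * (rI t)\<^sup>2)"
proof -
  have nz: "s0 q \<noteq> 0" using s0[OF q] by simp
  have "complex_of_real ((s0 q * rI1 t)\<^sup>2) = of_real ((s0 q * slope)\<^sup>2 * (1 + (s0 q * rI t)\<^sup>2 / (s0 q)\<^sup>2) * (1 + (s0 q)\<^sup>2 * (s0 q * rI t)\<^sup>2))"
    using theta_quot_first_integral[OF q imag_in_strip[OF assms]]
    unfolding theta_quot_imag deriv_theta_quot_imag[OF assms] deriv_theta_quot_0 by (simp add: power_mult_distrib nz)
  then have "(s0 q * rI1 t)\<^sup>2 = (s0 q * slope)\<^sup>2 * (1 + (s0 q * rI t)\<^sup>2 / (s0 q)\<^sup>2) * (1 + (s0 q)\<^sup>2 * (s0 q * rI t)\<^sup>2)"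
    by (simp only: of_real_eq_iff)
  then have "(s0 q)\<^sup>2 * (rI1 t)\<^sup>2 = (s0 q)\<^sup>2 * (slope\<^sup>2 * (1 + (rI t)\<^sup>2) * (1 + kap\<^sup>2 * (rI t)\<^sup>2))"
    using nz by (simp add: kap_def power_mult_distrib algebra_simps)
  then show ?thesis using nz by simp
qed

lemma rI1_continuous: "continuous_on {- hper<..<hper} rI1"
proof -
  have "continuous_on (strip q) (deriv (theta_quot q))"
    by (intro holomorphic_on_imp_continuous_on holomorphic_deriv theta_quot_holomorphic[OF q] open_strip[OF q])
  then have "continuous_on {- hper<..<hper} (\<lambda>t. deriv (theta_quot q) (\<i> * of_real t))"
    by (rule continuous_on_compose2) (auto intro!: continuous_intros imag_in_strip)
  then show ?thesis unfolding rI1_def[abs_def] using s0[OF q] by (intro continuous_intros) auto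
qed

text \<open>The square in \<open>rI1_square\<close> never vanishes, so continuity preserves the
  positive sign at 0. This selects the root when the first integral is solved for
  \<open>rI1\<close>.\<close>

lemma rI1_pos:
  assumes "0 \<le> t" "t < hper" shows "0 < rI1 t"
proof (rule ccontr)
  have sq: "0 < (rI1 u)\<^sup>2" if "\<bar>u\<bar> < hper" for u
    unfolding rI1_square[OF that] using slope(1) by (intro mult_pos_pos) (auto simp: add_pos_nonneg)
  assume "\<not> 0 < rI1 t"
  moreover have "0 < rI1 0" using slope(1) by (simp add: rI1_def slope_def)
  moreover have "continuous_on {0..t} rI1"
    by (rule continuous_on_subset[OF rI1_continuous]) (use assms hper_pos in auto)
  ultimately obtain u where "0 \<le> u" "u \<le> t" "rI1 u = 0"
    using IVT2'[of rI1 t 0 0] assms by auto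
  then show False using sq[of u] assms by auto
qed

definition ckap :: real where "ckap = sqrt (1 - kap\<^sup>2)"

lemma ckap: "0 < ckap" "ckap < 1"
  using compl_modulus[OF kap] by (simp_all add: ckap_def)

lemma rI_0: "rI 0 = 0" by (simp add: rI_def theta_quot_0[OF q])

text \<open>Jacobi's imaginary transformation: with r = tan phi the factors (1 + r^2)(1 + kap^2 r^2)
  turn into the elliptic integrand of the complementary modulus, so
  \<open>ellF ckap (arctan (rI t))\<close> grows at the constant rate \<open>slope\<close>.\<close>

lemma arctan_rI:
  assumes "0 \<le> t" "t < hper" shows "jam ckap (slope * t) = arctan (rI t)"
proof -
  define f where "f = (\<lambda>t. ellF ckap (arctan (rI t)) - slope * t)"
  have "(f has_field_derivative 0) (at u within {0..<hper})" if u: "u \<in> {0..<hper}" for u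
  proof -
    define r where "r = rI u"
    have au: "\<bar>u\<bar> < hper" using u by simp
    have c2: "ckap\<^sup>2 = 1 - kap\<^sup>2" using kap by (simp add: ckap_def abs_square_le_1)
    have pos: "0 < 1 + r\<^sup>2" "0 < 1 + kap\<^sup>2 * r\<^sup>2" by (auto simp: add_pos_nonneg)
    have "(sin (arctan r))\<^sup>2 = r\<^sup>2 / (1 + r\<^sup>2)"
      using pos by (simp add: sin_arctan power_divide)
    then have e1: "1 - ckap\<^sup>2 * (sin (arctan r))\<^sup>2 = (1 + kap\<^sup>2 * r\<^sup>2) / (1 + r\<^sup>2)"
      using pos unfolding c2 by (simp add: field_simps)
    have e2: "rI1 u = slope * sqrt (1 + r\<^sup>2) * sqrt (1 + kap\<^sup>2 * r\<^sup>2)"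
    proof -
      have "rI1 u = sqrt ((rI1 u)\<^sup>2)" using rI1_pos[of u] u by simp
      then show ?thesis
        unfolding rI1_square[OF au] r_def using slope(1) by (simp add: real_sqrt_mult)
    qed
    have "((\<lambda>t. arctan (rI t)) has_real_derivative inverse (1 + r\<^sup>2) * rI1 u) (at u)"
      unfolding r_def by (rule DERIV_chain2[OF DERIV_arctan rI_deriv[OF au]])
    from DERIV_chain2[OF ellF_deriv[OF ckap] this]
    have "(f has_real_derivative (1 / sqrt (1 - ckap\<^sup>2 * (sin (arctan (rI u)))\<^sup>2)) * (inverse (1 + r\<^sup>2) * rI1 u) - slope * 1) (at u)"
      unfolding f_def by (intro DERIV_diff DERIV_cmult DERIV_ident)
    moreover have "(1 / sqrt (1 - ckap\<^sup>2 * (sin (arctan (rI u)))\<^sup>2)) * (inverse (1 + r\<^sup>2) * rI1 u) = slope"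
    proof -
      have sq: "sqrt (1 + r\<^sup>2) * sqrt (1 + r\<^sup>2) = 1 + r\<^sup>2" using pos by simp
      have "(1 / sqrt (1 - ckap\<^sup>2 * (sin (arctan (rI u)))\<^sup>2)) * (inverse (1 + r\<^sup>2) * rI1 u)
         = slope * (sqrt (1 + r\<^sup>2) * sqrt (1 + r\<^sup>2)) / (1 + r\<^sup>2)"
        using pos unfolding r_def[symmetric] e1 e2 by (simp add: real_sqrt_divide field_simps del: real_sqrt_mult_self)
      then show ?thesis unfolding sq using pos by simp
    qed
    ultimately show ?thesis by (simp add: has_field_derivative_at_within)
  qed
  then obtain c where c: "\<And>u. u \<in> {0..<hper} \<Longrightarrow> f u = c"
    using has_field_derivative_zero_constant[of "{0..<hper}" f] by auto
  have "f t = f 0" using c[of t] c[of 0] assms by simp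
  then have "ellF ckap (arctan (rI t)) = slope * t" by (simp add: f_def rI_0 ellF_0[OF ckap])
  then show ?thesis using jam_ellF[OF ckap, of "arctan (rI t)"] by simp
qed

text \<open>At the pole the tangent must become infinite, so the amplitude reaches pi/2 there and
  the argument of the amplitude equals K'.\<close>

lemma slope_hper: "slope * hper = ellK ckap"
proof -
  \<comment> \<open>The relation |theta_1| / |theta_4| = s0 tan(am) with denominators cleared. In
    this form it is continuous up to \<open>hper\<close>, where theta_4 vanishes and the tangent is
    singular.\<close>
  define h where "h = (\<lambda>t. norm (jtheta1 q (\<i> * of_real t)) * cos (jam ckap (slope * t))
      - s0 q * sin (jam ckap (slope * t)) * norm (jtheta4 q (\<i> * of_real t)))"
  have cj: "continuous_on UNIV (jtheta1 q)" "continuous_on UNIV (jtheta4 q)"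
    by (intro holomorphic_on_imp_continuous_on jtheta_holomorphic[OF q])+
  have c1: "continuous_on UNIV (\<lambda>t. jtheta1 q (\<i> * of_real t))" "continuous_on UNIV (\<lambda>t. jtheta4 q (\<i> * of_real t))"
    by (auto intro!: continuous_on_compose2[OF cj(1)] continuous_on_compose2[OF cj(2)] continuous_intros)
  have cam: "continuous_on UNIV (jam ckap)"
    by (intro continuous_at_imp_continuous_on ballI DERIV_isCont[OF jam_deriv[OF ckap]])
  have c2: "continuous_on UNIV (\<lambda>t. jam ckap (slope * t))"
    by (auto intro!: continuous_on_compose2[OF cam] continuous_intros)
  have "continuous_on UNIV h" unfolding h_def
    by (intro continuous_intros c1 c2)
  then have h_lim: "(h \<longlongrightarrow> h hper) (at_left hper)"
    by (auto simp: continuous_on_def intro: tendsto_within_subset)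
  have j_lim: "((\<lambda>t. jam ckap (slope * t)) \<longlongrightarrow> jam ckap (slope * hper)) (at_left hper)"
    using c2 by (auto simp: continuous_on_def intro: tendsto_within_subset)
  have ev: "eventually (\<lambda>t. t \<in> {0<..<hper}) (at_left hper)"
    using hper_pos by (rule eventually_at_leftI[rotated]) auto
  have h0: "h t = 0" if t: "t \<in> {0<..<hper}" for t
  proof -
    have i: "\<i> * of_real t \<in> strip q" using t by (intro imag_in_strip) auto
    have "0 \<le> rI t"
      using jam_less_iff[OF ckap, of "slope * t" 0] arctan_rI[of t] t slope(1) jam_0[OF ckap]
      by (auto simp: not_less mult_less_0_iff)
    moreover have "jtheta1 q (\<i> * of_real t) = \<i> * of_real (s0 q * rI t) * jtheta4 q (\<i> * of_real t)"
      using jtheta4_nonzero_strip[OF q i] theta_quot_imag[of t] by (simp add: theta_quot_def[OF q] field_simps)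
    ultimately have n: "norm (jtheta1 q (\<i> * of_real t)) = s0 q * rI t * norm (jtheta4 q (\<i> * of_real t))"
      using s0[OF q] by (simp add: norm_mult)
    have c: "cos (arctan (rI t)) \<noteq> 0" using cos_arctan_not_zero by blast
    have "rI t * cos (arctan (rI t)) = sin (arctan (rI t))"
      using tan_arctan[of "rI t"] c by (simp add: tan_def field_simps)
    then show ?thesis
      unfolding h_def n using arctan_rI[of t] t by (simp add: mult_ac)
  qed
  have "(h \<longlongrightarrow> 0) (at_left hper)"
    by (rule tendsto_eventually) (rule eventually_mono[OF ev h0])
  then have "h hper = 0" using tendsto_unique[OF trivial_limit_at_left_real h_lim] by blast
  moreover have "jtheta4 q (\<i> * of_real hper) = 0"
    using jtheta4_half_period[OF q] by (simp add: hper_def)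
  moreover have "jtheta1 q (\<i> * of_real hper) \<noteq> 0"
    using jtheta1_zero[OF q, of "\<i> * of_real hper"] sin_zero_Im[of "\<i> * of_real hper"] hper_pos
    by (auto simp: hper_def)
  ultimately have cos0: "cos (jam ckap (slope * hper)) = 0" by (simp add: h_def)
  have "jam ckap (slope * hper) \<le> pi / 2"
  proof (rule tendsto_upperbound[OF j_lim])
    show "eventually (\<lambda>t. jam ckap (slope * t) \<le> pi / 2) (at_left hper)"
    proof (rule eventually_mono[OF ev])
      fix t assume "t \<in> {0<..<hper}"
      then have "jam ckap (slope * t) = arctan (rI t)" by (intro arctan_rI) auto
      then show "jam ckap (slope * t) \<le> pi / 2" using arctan_ubound[of "rI t"] by linarith
    qed
  qed simp
  moreover have "0 < jam ckap (slope * hper)"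
    using jam_less_iff[OF ckap, of 0 "slope * hper"] jam_0[OF ckap] slope(1) hper_pos by simp
  ultimately have e: "jam ckap (slope * hper) = pi / 2"
    using cos0 cos_gt_zero[of "jam ckap (slope * hper)"] by fastforce
  show ?thesis using ellF_jam[OF ckap, of "slope * hper"] unfolding e ellK_def by simp
qed

lemma nome_kap: "nome kap = q"
proof -
  have 1: "ellK kap = slope * pi / 2" using slope(2) by simp
  have "- pi * ellK' kap / ellK kap = - pi * (slope * hper) / (slope * pi / 2)"
    unfolding 1 ellK'_def ckap_def[symmetric] slope_hper ..
  also have "\<dots> = ln q" using slope(1) by (simp add: hper_def)
  finally show ?thesis using q by (simp add: nome_def)
qed

end

section \<open>Transfer from a given nome to a given modulus\<close>

context
  fixes k :: real
  assumes k: "0 < k" "k < 1"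
begin

lemmas nome_bds = nome_bounds[OF k]

text \<open>Both moduli have the nome \<open>nome k\<close>, and the nome is injective.\<close>

lemma kap_nome: "kap (nome k) = k"
  using nome_inj[OF kap[OF nome_bds] k nome_kap[OF nome_bds]] .

lemma sqrt_modulus: "sqrt k = s0 (nome k)"
  using s0[OF nome_bds] kap_nome unfolding kap_def[OF nome_bds] by (intro real_sqrt_unique) auto

lemma slope_nome: "slope (nome k) * (pi * u / (2 * ellK k)) = u"
  using slope(2)[OF nome_bds] ellK_pos[OF k] unfolding kap_nome by (simp add: field_simps)

lemma hper_nome: "hper (nome k) = pi * ellK' k / (2 * ellK k)"
proof -
  have "ln (nome k) = - pi * ellK' k / ellK k" by (simp add: nome_def)
  then show ?thesis by (simp add: hper_def[OF nome_bds])
qed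

lemma jsnC_eq_theta_quot: "jsnC k u = theta_quot (nome k) (of_real pi * u / (2 * of_real (ellK k))) / of_real (sqrt k)"
  by (simp add: jsnC_def jH_def jTheta_def theta_quot_def[OF nome_bds])

lemma jsnC_of_real: "jsnC k (of_real u) = of_real (jsn k u)"
proof -
  have e: "of_real pi * of_real u / (2 * of_real (ellK k)) = complex_of_real (pi * u / (2 * ellK k))" by simp
  show ?thesis
    unfolding jsnC_eq_theta_quot e theta_quot_real[OF nome_bds] sR_eq_jsn[OF nome_bds] slope_nome kap_nome sqrt_modulus
    using s0[OF nome_bds] by simp
qed

lemma jTheta_nonzero: assumes "\<bar>Im u\<bar> < ellK' k" shows "jTheta k u \<noteq> 0"
proof -
  have e: "of_real pi * u / (2 * of_real (ellK k)) = complex_of_real (pi / (2 * ellK k)) * u" by simp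
  have "\<bar>Im (complex_of_real (pi / (2 * ellK k)) * u)\<bar> < - ln (nome k) / 2"
    using hper_nome ellK_pos[OF k] assms unfolding hper_def[OF nome_bds] by (simp add: abs_mult field_simps)
  then show ?thesis
    unfolding jTheta_def e using jtheta4_nonzero[OF nome_bds] by blast
qed

text \<open>Used for imaginary \<open>beta\<close>: the value is purely imaginary, and its size is
  the tangent of the amplitude for the complementary modulus.\<close>

lemma jsnC_imag:
  assumes "0 \<le> v" "v < ellK' k"
  shows "jsnC k (\<i> * of_real v) = \<i> * of_real (tan (jam (sqrt (1 - k\<^sup>2)) v))"
proof -
  define t where "t = pi * v / (2 * ellK k)"
  have e: "of_real pi * (\<i> * of_real v) / (2 * of_real (ellK k)) = \<i> * complex_of_real t" by (simp add: t_def)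
  have t: "0 \<le> t" "t < hper (nome k)"
    using assms ellK_pos[OF k] unfolding hper_nome t_def by (auto simp: divide_strict_right_mono)
  have "jam (sqrt (1 - k\<^sup>2)) v = arctan (rI (nome k) t)"
    using arctan_rI[OF nome_bds t] slope_nome[of v] unfolding ckap_def[OF nome_bds] kap_nome t_def by simp
  then have "rI (nome k) t = tan (jam (sqrt (1 - k\<^sup>2)) v)" by (simp add: tan_arctan)
  then show ?thesis
    unfolding jsnC_eq_theta_quot e theta_quot_imag[OF nome_bds] sqrt_modulus using s0[OF nome_bds] by simp
qed

lemma jH_eq: assumes "jTheta k u \<noteq> 0" shows "jH k u = of_real (sqrt k) * jsnC k u * jTheta k u"
  using assms k by (simp add: jsnC_def)

lemma jTheta_addition:
  assumes "jTheta k x \<noteq> 0" "jTheta k y \<noteq> 0"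
  shows "jTheta k (x + y) * jTheta k (x - y) * (jTheta k 0)\<^sup>2
    = (jTheta k x)\<^sup>2 * (jTheta k y)\<^sup>2 * (1 - of_real (k\<^sup>2) * (jsnC k x)\<^sup>2 * (jsnC k y)\<^sup>2)"
proof -
  have sqrt_k: "complex_of_real (sqrt k) ^ 2 = of_real k" using k by (simp flip: of_real_power)
  define c where "c = complex_of_real pi / (2 * of_real (ellK k))"
  have c: "complex_of_real pi * z / (2 * of_real (ellK k)) = c * z" for z by (simp add: c_def)
  have "jTheta k (x + y) * jTheta k (x - y) * (jTheta k 0)\<^sup>2
     = (jTheta k x)\<^sup>2 * (jTheta k y)\<^sup>2 - (jH k x)\<^sup>2 * (jH k y)\<^sup>2"
    using jtheta4_addition[OF nome_bds, of "c * x" "c * y"]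
    unfolding jTheta_def jH_def unfolding c unfolding distrib_left right_diff_distrib by simp
  also have "\<dots> = (jTheta k x)\<^sup>2 * (jTheta k y)\<^sup>2 * (1 - of_real (k\<^sup>2) * (jsnC k x)\<^sup>2 * (jsnC k y)\<^sup>2)"
    unfolding jH_eq[OF assms(1)] jH_eq[OF assms(2)] power_mult_distrib sqrt_k
    by (simp add: algebra_simps power2_eq_square)
  finally show ?thesis .
qed

lemma jH_addition:
  assumes "jTheta k x \<noteq> 0" "jTheta k y \<noteq> 0"
  shows "jH k (x + y) * jH k (x - y) * (jTheta k 0)\<^sup>2
    = of_real k * (jTheta k x)\<^sup>2 * (jTheta k y)\<^sup>2 * ((jsnC k x)\<^sup>2 - (jsnC k y)\<^sup>2)"
proof -
  have sqrt_k: "complex_of_real (sqrt k) ^ 2 = of_real k" using k by (simp flip: of_real_power)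
  define c where "c = complex_of_real pi / (2 * of_real (ellK k))"
  have c: "complex_of_real pi * z / (2 * of_real (ellK k)) = c * z" for z by (simp add: c_def)
  have "jH k (x + y) * jH k (x - y) * (jTheta k 0)\<^sup>2
     = (jH k x)\<^sup>2 * (jTheta k y)\<^sup>2 - (jTheta k x)\<^sup>2 * (jH k y)\<^sup>2"
    using jtheta1_addition[OF nome_bds, of "c * x" "c * y"]
    unfolding jTheta_def jH_def unfolding c unfolding distrib_left right_diff_distrib by simp
  also have "\<dots> = of_real k * (jTheta k x)\<^sup>2 * (jTheta k y)\<^sup>2 * ((jsnC k x)\<^sup>2 - (jsnC k y)\<^sup>2)"
    unfolding jH_eq[OF assms(1)] jH_eq[OF assms(2)] power_mult_distrib sqrt_k
    by (simp add: algebra_simps)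
  finally show ?thesis .
qed

end

section \<open>Periodic solutions\<close>

text \<open>The quartic has the roots \<open>\<zeta>\<^sub>1 + \<zeta>\<^sub>2 - \<zeta>\<^sub>3 > \<zeta>\<^sub>1 - \<zeta>\<^sub>2 + \<zeta>\<^sub>3 > - \<zeta>\<^sub>1 + \<zeta>\<^sub>2 + \<zeta>\<^sub>3 > - (\<zeta>\<^sub>1 + \<zeta>\<^sub>2 + \<zeta>\<^sub>3)\<close>;
  the profile oscillates between the two middle ones. Allowing \<open>\<zeta>\<^sub>3 \<le> 0\<close> covers \<open>b \<le> 0\<close>.\<close>

definition prof :: "real \<Rightarrow> real \<Rightarrow> real \<Rightarrow> real \<Rightarrow> real" where
  "prof z1 z2 z3 x = - (z1 + z2 + z3) +
     2 * (z1 + z3) * (z2 + z3) / ((z1 + z3) - (z1 - z2) * (jsn (zk z1 z2 z3) (znu z1 z2 z3 * x))\<^sup>2)"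

context
  fixes z1 z2 z3 :: real
  assumes z: "- z2 < z3" "z3 < z2" "z2 < z1"
begin

lemma zeta_squares_less: "z3\<^sup>2 < z2\<^sup>2" "z2\<^sup>2 < z1\<^sup>2" "z3\<^sup>2 < z1\<^sup>2"
proof -
  have "\<bar>z3\<bar> < \<bar>z2\<bar>" "\<bar>z2\<bar> < \<bar>z1\<bar>" using z by auto
  then show "z3\<^sup>2 < z2\<^sup>2" "z2\<^sup>2 < z1\<^sup>2" by (simp_all add: power2_strict_mono)
  then show "z3\<^sup>2 < z1\<^sup>2" by simp
qed

lemma znu_pos: "0 < znu z1 z2 z3" and znu_sq: "(znu z1 z2 z3)\<^sup>2 = z1\<^sup>2 - z3\<^sup>2"
  using zeta_squares_less by (simp_all add: znu_def)

lemma zk_sq: "(zk z1 z2 z3)\<^sup>2 = (z1\<^sup>2 - z2\<^sup>2) / (z1\<^sup>2 - z3\<^sup>2)"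
  using zeta_squares_less by (simp add: zk_def)

lemma zk_bounds: "0 < zk z1 z2 z3" "zk z1 z2 z3 < 1"
  using zeta_squares_less by (simp_all add: zk_def)

lemma zk_znu: "(zk z1 z2 z3)\<^sup>2 * (znu z1 z2 z3)\<^sup>2 = z1\<^sup>2 - z2\<^sup>2"
  using zeta_squares_less by (simp add: zk_sq znu_sq)

abbreviation "sn x \<equiv> jsn (zk z1 z2 z3) (znu z1 z2 z3 * x)"
abbreviation "sn1 x \<equiv> jsn1 (zk z1 z2 z3) (znu z1 z2 z3 * x)"
abbreviation "den x \<equiv> (z1 + z3) - (z1 - z2) * (sn x)\<^sup>2"

lemma den_bounds: "z2 + z3 \<le> den x" "den x \<le> z1 + z3" "0 < den x"
proof -
  have "(z1 - z2) * (sn x)\<^sup>2 \<le> (z1 - z2) * 1"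
    using z jsn_square_le_1[OF zk_bounds] by (intro mult_left_mono) auto
  then show "z2 + z3 \<le> den x" by simp
  then show "0 < den x" using z by linarith
  show "den x \<le> z1 + z3" using z by simp
qed

definition prof1 :: "real \<Rightarrow> real" where
  "prof1 x = 4 * (z1 + z3) * (z2 + z3) * (z1 - z2) * znu z1 z2 z3 * (sn x * sn1 x) / (den x)\<^sup>2"

lemma sn_deriv: "((\<lambda>x. sn x) has_real_derivative sn1 x * znu z1 z2 z3) (at x)"
  by (rule DERIV_chain2[OF jsn_deriv[OF zk_bounds]]) (auto intro!: derivative_eq_intros)

lemma sn1_deriv: "((\<lambda>x. sn1 x) has_real_derivative
    (2 * (zk z1 z2 z3)\<^sup>2 * (sn x) ^ 3 - (1 + (zk z1 z2 z3)\<^sup>2) * sn x) * znu z1 z2 z3) (at x)"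
  by (rule DERIV_chain2[OF jsn1_deriv[OF zk_bounds]]) (auto intro!: derivative_eq_intros)

lemma den_deriv: "((\<lambda>x. den x) has_real_derivative - ((z1 - z2) * (2 * sn x * (sn1 x * znu z1 z2 z3)))) (at x)"
  by (rule derivative_eq_intros sn_deriv refl)+ simp

lemma prof_deriv: "(prof z1 z2 z3 has_real_derivative prof1 x) (at x)"
proof -
  have nz: "den x \<noteq> 0" using den_bounds[of x] by simp
  have alg: "(0 * D - 2 * A * C * - (B * (2 * s * (t * n)))) / (D * D) = 4 * A * C * B * n * (s * t) / D\<^sup>2"
    for A B C D n s t :: real
    by (simp add: power2_eq_square)
  have "((\<lambda>x. 2 * (z1 + z3) * (z2 + z3) / den x) has_real_derivative
      4 * (z1 + z3) * (z2 + z3) * (z1 - z2) * znu z1 z2 z3 * (sn x * sn1 x) / (den x)\<^sup>2) (at x)"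
    by (rule DERIV_cong[OF DERIV_divide[OF DERIV_const den_deriv nz]]) (rule alg)
  from DERIV_add[OF DERIV_const[of "- (z1 + z2 + z3)"] this]
  show ?thesis unfolding prof_def[abs_def] prof1_def by (simp only: add_0)
qed

lemma deriv_quot:
  assumes "(f has_real_derivative f') (at x)" "(g has_real_derivative g') (at x)"
    "(h has_real_derivative h') (at x)" "h x \<noteq> 0"
  shows "((\<lambda>x. f x * g x / (h x)\<^sup>2) has_real_derivative
    ((f' * g x + f x * g') * (h x)\<^sup>2 - (f x * g x) * (2 * h x * h')) / ((h x)\<^sup>2 * (h x)\<^sup>2)) (at x)"
  using assms(4) by (auto intro!: derivative_eq_intros assms(1-3) simp: algebra_simps)

text \<open>The left side is the second derivative of the profile after eliminating nu^2 = n and k^2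
  nu^2 = m, with \<open>P\<close> for sn^2: it contains nu^2 sn1^2 = (1 - P)(n - m P) and nu^2 sn
  sn'' = P (2 m P - (n + m)). Clearing D^3 leaves a polynomial identity.\<close>

lemma prof_cubic_identity:
  fixes P :: real
  defines "D \<equiv> (z1 + z3) - (z1 - z2) * P" and "n \<equiv> z1\<^sup>2 - z3\<^sup>2" and "m \<equiv> z1\<^sup>2 - z2\<^sup>2"
  assumes "D \<noteq> 0"
  shows "4 * (z1 + z3) * (z2 + z3) * (z1 - z2) *
      ((((1 - P) * (n - m * P) + P * (2 * m * P - (n + m))) * D + 4 * (z1 - z2) * P * ((1 - P) * (n - m * P))) / D ^ 3)
    = zb z1 z2 z3 + 2 * (- (z1 + z2 + z3) + 2 * (z1 + z3) * (z2 + z3) / D) ^ 3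
       - zc z1 z2 z3 * (- (z1 + z2 + z3) + 2 * (z1 + z3) * (z2 + z3) / D)"
proof -
  define N where "N = - (z1 + z2 + z3) * D + 2 * (z1 + z3) * (z2 + z3)"
  have N: "- (z1 + z2 + z3) + 2 * (z1 + z3) * (z2 + z3) / D = N / D"
    using assms(4) by (simp add: N_def field_simps)
  have "4 * (z1 + z3) * (z2 + z3) * (z1 - z2) *
      (((1 - P) * (n - m * P) + P * (2 * m * P - (n + m))) * D + 4 * (z1 - z2) * P * ((1 - P) * (n - m * P)))
    = zb z1 z2 z3 * D ^ 3 + 2 * N ^ 3 - zc z1 z2 z3 * N * D\<^sup>2"
    unfolding N_def D_def n_def m_def zb_def zc_def by algebra
  moreover have "zb z1 z2 z3 + 2 * (N / D) ^ 3 - zc z1 z2 z3 * (N / D)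
      = (zb z1 z2 z3 * D ^ 3 + 2 * N ^ 3 - zc z1 z2 z3 * N * D\<^sup>2) / D ^ 3"
    using assms(4) by (simp add: field_simps power2_eq_square power3_eq_cube)
  ultimately show ?thesis unfolding N by simp
qed

lemma prof1_deriv:
  "(prof1 has_real_derivative zb z1 z2 z3 + 2 * (prof z1 z2 z3 x) ^ 3 - zc z1 z2 z3 * prof z1 z2 z3 x) (at x)"
proof -
  define k nu where "k = zk z1 z2 z3" and "nu = znu z1 z2 z3"
  define s t where "s = sn x" and "t = sn1 x"
  define D where "D = (z1 + z3) - (z1 - z2) * s\<^sup>2"
  have nz: "D \<noteq> 0" using den_bounds[of x] by (simp add: D_def s_def)
  have dD: "((\<lambda>x. den x) has_real_derivative - (z1 - z2) * (2 * s * (t * nu))) (at x)"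
    using den_deriv[of x] unfolding s_def t_def nu_def by (simp only: mult_minus_left)
  have "((\<lambda>x. sn x * sn1 x / (den x)\<^sup>2) has_real_derivative
      ((t * nu * t + s * ((2 * k\<^sup>2 * s ^ 3 - (1 + k\<^sup>2) * s) * nu)) * D\<^sup>2 - (s * t) * (2 * D * (- (z1 - z2) * (2 * s * (t * nu))))) / (D\<^sup>2 * D\<^sup>2)) (at x)"
    using deriv_quot[OF sn_deriv sn1_deriv dD] nz
    unfolding D_def s_def t_def nu_def k_def by blast
  from DERIV_cmult[OF this, of "4 * (z1 + z3) * (z2 + z3) * (z1 - z2) * nu"]
  have 1: "(prof1 has_real_derivative 4 * (z1 + z3) * (z2 + z3) * (z1 - z2) * nu *
      (((t * nu * t + s * ((2 * k\<^sup>2 * s ^ 3 - (1 + k\<^sup>2) * s) * nu)) * D\<^sup>2 - (s * t) * (2 * D * (- (z1 - z2) * (2 * s * (t * nu))))) / (D\<^sup>2 * D\<^sup>2))) (at x)"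
    unfolding prof1_def[abs_def] nu_def by simp
  define P n m where "P = s\<^sup>2" and "n = z1\<^sup>2 - z3\<^sup>2" and "m = z1\<^sup>2 - z2\<^sup>2"
  have n: "nu\<^sup>2 = n" and m: "k\<^sup>2 * nu\<^sup>2 = m" using znu_sq zk_znu by (simp_all add: nu_def k_def n_def m_def)
  have t2: "t\<^sup>2 = (1 - P) * (1 - k\<^sup>2 * P)"
    unfolding t_def P_def s_def k_def by (rule jsn1_square[OF zk_bounds])
  have F: "t\<^sup>2 * nu\<^sup>2 = (1 - P) * (n - m * P)"
    unfolding t2 m[symmetric] n[symmetric] by (simp add: algebra_simps)
  have G: "s * (2 * k\<^sup>2 * s ^ 3 - (1 + k\<^sup>2) * s) * nu\<^sup>2 = P * (2 * m * P - (n + m))"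
    unfolding P_def m[symmetric] n[symmetric] by (simp add: algebra_simps power2_eq_square power3_eq_cube)
  have "nu * (((t * nu * t + s * ((2 * k\<^sup>2 * s ^ 3 - (1 + k\<^sup>2) * s) * nu)) * D\<^sup>2 - (s * t) * (2 * D * (- (z1 - z2) * (2 * s * (t * nu))))) / (D\<^sup>2 * D\<^sup>2))
     = ((t\<^sup>2 * nu\<^sup>2 + s * (2 * k\<^sup>2 * s ^ 3 - (1 + k\<^sup>2) * s) * nu\<^sup>2) * D + 4 * (z1 - z2) * s\<^sup>2 * (t\<^sup>2 * nu\<^sup>2)) / D ^ 3"
    using nz by (simp add: divide_simps) (simp add: algebra_simps power2_eq_square power3_eq_cube power4_eq_xxxx)
  also have "\<dots> = (((1 - P) * (n - m * P) + P * (2 * m * P - (n + m))) * D + 4 * (z1 - z2) * P * ((1 - P) * (n - m * P))) / D ^ 3"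
    unfolding F G P_def ..
  finally have 2: "4 * (z1 + z3) * (z2 + z3) * (z1 - z2) * nu *
      (((t * nu * t + s * ((2 * k\<^sup>2 * s ^ 3 - (1 + k\<^sup>2) * s) * nu)) * D\<^sup>2 - (s * t) * (2 * D * (- (z1 - z2) * (2 * s * (t * nu))))) / (D\<^sup>2 * D\<^sup>2))
     = 4 * (z1 + z3) * (z2 + z3) * (z1 - z2) * ((((1 - P) * (n - m * P) + P * (2 * m * P - (n + m))) * D + 4 * (z1 - z2) * P * ((1 - P) * (n - m * P))) / D ^ 3)"
    by (simp only: mult.assoc)
  have "D = (z1 + z3) - (z1 - z2) * P" by (simp add: D_def P_def)
  then have 3: "4 * (z1 + z3) * (z2 + z3) * (z1 - z2) * ((((1 - P) * (n - m * P) + P * (2 * m * P - (n + m))) * D + 4 * (z1 - z2) * P * ((1 - P) * (n - m * P))) / D ^ 3)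
      = zb z1 z2 z3 + 2 * (prof z1 z2 z3 x) ^ 3 - zc z1 z2 z3 * prof z1 z2 z3 x"
    using prof_cubic_identity[of P] nz by (simp add: prof_def n_def m_def P_def s_def)
  show ?thesis using 1 unfolding 2 3 .
qed

lemma prof_first_integral:
  "(prof1 x)\<^sup>2 = (prof z1 z2 z3 x) ^ 4 - zc z1 z2 z3 * (prof z1 z2 z3 x)\<^sup>2 + 2 * zb z1 z2 z3 * prof z1 z2 z3 x + 2 * zd z1 z2 z3"
proof -
  define k nu where "k = zk z1 z2 z3" and "nu = znu z1 z2 z3"
  define s t where "s = sn x" and "t = sn1 x"
  define D where "D = (z1 + z3) - (z1 - z2) * s\<^sup>2"
  have nz: "D \<noteq> 0" using den_bounds[of x] by (simp add: D_def s_def)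
  define P n m where "P = s\<^sup>2" and "n = z1\<^sup>2 - z3\<^sup>2" and "m = z1\<^sup>2 - z2\<^sup>2"
  have n: "nu\<^sup>2 = n" and m: "k\<^sup>2 * nu\<^sup>2 = m" using znu_sq zk_znu by (simp_all add: nu_def k_def n_def m_def)
  have t2: "t\<^sup>2 = (1 - P) * (1 - k\<^sup>2 * P)"
    unfolding t_def P_def s_def k_def by (rule jsn1_square[OF zk_bounds])
  have F: "t\<^sup>2 * nu\<^sup>2 = (1 - P) * (n - m * P)"
    unfolding t2 m[symmetric] n[symmetric] by (simp add: algebra_simps)
  have p1: "prof1 x = 4 * (z1 + z3) * (z2 + z3) * (z1 - z2) * nu * (s * t) / D\<^sup>2"
    by (simp add: prof1_def s_def t_def nu_def D_def)
  have "(4 * A * C * B * nu * (s * t) / D\<^sup>2)\<^sup>2 = 16 * A\<^sup>2 * C\<^sup>2 * B\<^sup>2 * s\<^sup>2 * (t\<^sup>2 * nu\<^sup>2) / D ^ 4" for A B C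
    by (simp add: power_mult_distrib power_divide flip: power_mult)
  then have "(prof1 x)\<^sup>2 = 16 * (z1 + z3)\<^sup>2 * (z2 + z3)\<^sup>2 * (z1 - z2)\<^sup>2 * s\<^sup>2 * (t\<^sup>2 * nu\<^sup>2) / D ^ 4"
    unfolding p1 .
  then have 1: "(prof1 x)\<^sup>2 = 16 * (z1 + z3)\<^sup>2 * (z2 + z3)\<^sup>2 * (z1 - z2)\<^sup>2 * P * ((1 - P) * (n - m * P)) / D ^ 4"
    unfolding F by (simp add: P_def)
  define N where "N = - (z1 + z2 + z3) * D + 2 * (z1 + z3) * (z2 + z3)"
  have N: "prof z1 z2 z3 x = N / D"
  proof -
    have "prof z1 z2 z3 x = - (z1 + z2 + z3) + 2 * (z1 + z3) * (z2 + z3) / D"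
      by (simp only: prof_def s_def D_def)
    then show ?thesis using nz by (simp add: N_def field_simps)
  qed
  have "16 * (z1 + z3)\<^sup>2 * (z2 + z3)\<^sup>2 * (z1 - z2)\<^sup>2 * P * ((1 - P) * (n - m * P))
     = N ^ 4 - zc z1 z2 z3 * N\<^sup>2 * D\<^sup>2 + 2 * zb z1 z2 z3 * N * D ^ 3 + 2 * zd z1 z2 z3 * D ^ 4"
    unfolding N_def D_def n_def m_def zb_def zc_def zd_def P_def[symmetric] by (simp add: diff_divide_distrib) algebra
  moreover have "(N / D) ^ 4 - zc z1 z2 z3 * (N / D)\<^sup>2 + 2 * zb z1 z2 z3 * (N / D) + 2 * zd z1 z2 z3
      = (N ^ 4 - zc z1 z2 z3 * N\<^sup>2 * D\<^sup>2 + 2 * zb z1 z2 z3 * N * D ^ 3 + 2 * zd z1 z2 z3 * D ^ 4) / D ^ 4"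
    using nz by (simp add: field_simps power2_eq_square power3_eq_cube power4_eq_xxxx)
  ultimately show ?thesis unfolding N 1 by simp
qed

lemma prof_0: "prof z1 z2 z3 0 = z2 + z3 - z1"
proof -
  have "2 * A * C / A = 2 * C" if "A \<noteq> 0" for A C :: real using that by simp
  from this[of "z1 + z3" "z2 + z3"] show ?thesis
    using z by (simp add: prof_def jsn_0[OF zk_bounds])
qed

lemma prof1_0: "prof1 0 = 0"
  by (simp add: prof1_def jsn_0[OF zk_bounds])

lemma prof_is_sol: "is_sol (zb z1 z2 z3) (zc z1 z2 z3) (prof z1 z2 z3)"
  unfolding is_sol_def using prof_deriv prof1_deriv by blast

lemma prof_invariant: "invariant (zb z1 z2 z3) (zc z1 z2 z3) (zd z1 z2 z3) (prof z1 z2 z3)"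
  unfolding invariant_def DERIV_imp_deriv[OF prof_deriv] using prof_first_integral by blast

lemma prof_bpnc: "bpnc (prof z1 z2 z3)"
proof -
  define K nu where "K = ellK (zk z1 z2 z3)" and "nu = znu z1 z2 z3"
  have K: "0 < K" and nu: "0 < nu" using ellK_pos[OF zk_bounds] znu_pos by (simp_all add: K_def nu_def)
  have "prof z1 z2 z3 (x + 2 * K / nu) = prof z1 z2 z3 x" for x
  proof -
    have "nu * (x + 2 * K / nu) = nu * x + 2 * K" using nu by (simp add: field_simps)
    then have "sn (x + 2 * K / nu) = - sn x"
      using jsn_add[OF zk_bounds, of "nu * x"] by (simp add: nu_def K_def)
    then show ?thesis by (simp add: prof_def)
  qed
  moreover have "0 < 2 * K / nu" using K nu by simp
  moreover have "bounded (range (prof z1 z2 z3))"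
  proof (rule boundedI)
    fix y assume "y \<in> range (prof z1 z2 z3)"
    then obtain x where y: "y = - (z1 + z2 + z3) + 2 * (z1 + z3) * (z2 + z3) / den x"
      by (auto simp: prof_def)
    have "0 \<le> 2 * (z1 + z3) * (z2 + z3) / den x" using z den_bounds(3)[of x] by (intro divide_nonneg_pos mult_nonneg_nonneg) auto
    moreover have "2 * (z1 + z3) * (z2 + z3) / den x \<le> 2 * (z1 + z3) * (z2 + z3) / (z2 + z3)"
      using z den_bounds[of x] by (intro divide_left_mono mult_nonneg_nonneg mult_pos_pos) auto
    then have "2 * (z1 + z3) * (z2 + z3) / den x \<le> 2 * (z1 + z3)" using z by simp
    ultimately show "norm y \<le> \<bar>z1 + z2 + z3\<bar> + 2 * (z1 + z3)" unfolding y by simp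
  qed
  moreover have "prof z1 z2 z3 (K / nu) \<noteq> prof z1 z2 z3 0"
  proof -
    have "nu * (K / nu) = K" using nu by simp
    then have "sn (K / nu) = 1" using jsn_K[OF zk_bounds] unfolding nu_def K_def by metis
    moreover have "z1 + z3 - (z1 - z2) = z2 + z3" by simp
    ultimately have "prof z1 z2 z3 (K / nu) = - (z1 + z2 + z3) + 2 * (z1 + z3) * (z2 + z3) / (z2 + z3)"
      by (simp only: prof_def power_one mult_1_right)
    also have "\<dots> = - (z1 + z2 + z3) + 2 * (z1 + z3)"
      using z by (subst nonzero_mult_div_cancel_right) auto
    finally show ?thesis using z by (simp add: prof_0)
  qed
  ultimately show ?thesis unfolding bpnc_def by blast
qed

end

section \<open>The parameters: admissible range, uniqueness and existence\<close>

lemma zb_zc_bounds: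
  assumes z: "- z2 < z3" "z3 < z2" "z2 < z1"
  shows "0 < zc z1 z2 z3" "\<bar>zb z1 z2 z3\<bar> < bcrit (zc z1 z2 z3)"
proof -
  define x y w where "x = z1\<^sup>2" and "y = z2\<^sup>2" and "w = z3\<^sup>2"
  have o: "0 \<le> w" "w < y" "y < x" using zeta_squares_less[OF z] by (simp_all add: x_def y_def w_def)
  have "0 < x + y + w" using o by simp
  then show "0 < zc z1 z2 z3" by (simp add: zc_def x_def y_def w_def)
  \<comment> \<open>A certificate for the inequality of arithmetic and geometric means, strict
    because the squares are distinct. Since b^2 = 16xyw and c = 2(x + y + w), it is exactly b^2 <
    2c^3/27.\<close>
  have "2 * ((x + y + w) ^ 3 - 27 * x * y * w) = (x + y + w) * ((x - y)\<^sup>2 + (y - w)\<^sup>2 + (w - x)\<^sup>2)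
      + 6 * (x * (y - w)\<^sup>2 + y * (w - x)\<^sup>2 + w * (x - y)\<^sup>2)"
    by (simp add: algebra_simps power2_eq_square power3_eq_cube)
  moreover have "0 < (x + y + w) * ((x - y)\<^sup>2 + (y - w)\<^sup>2 + (w - x)\<^sup>2)"
    using o by (intro mult_pos_pos) (auto simp: add_pos_nonneg)
  moreover have "0 \<le> x * (y - w)\<^sup>2 + y * (w - x)\<^sup>2 + w * (x - y)\<^sup>2" using o by simp
  ultimately have "0 < 2 * ((x + y + w) ^ 3 - 27 * x * y * w)" by (simp only: add_pos_nonneg mult_nonneg_nonneg zero_le_numeral)
  then have "27 * x * y * w < (x + y + w) ^ 3" by (simp add: mult_ac)
  moreover have "(zb z1 z2 z3)\<^sup>2 = 16 * (x * y * w)"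
    by (simp add: zb_def x_def y_def w_def power_mult_distrib)
  moreover have "2 * (zc z1 z2 z3) ^ 3 / 27 = 16 * (x + y + w) ^ 3 / 27"
  proof -
    have "zc z1 z2 z3 = 2 * (x + y + w)" by (simp only: zc_def x_def y_def w_def)
    then show ?thesis by (simp only: power_mult_distrib) simp
  qed
  ultimately have "(zb z1 z2 z3)\<^sup>2 < 2 * (zc z1 z2 z3) ^ 3 / 27" by (simp add: mult_ac)
  then have "sqrt ((zb z1 z2 z3)\<^sup>2) < sqrt (2 * (zc z1 z2 z3) ^ 3 / 27)" by (rule real_sqrt_less_mono)
  then show "\<bar>zb z1 z2 z3\<bar> < bcrit (zc z1 z2 z3)" by (simp add: bcrit_def real_sqrt_divide)
qed

lemma cubic_roots_unique:
  fixes x1 x2 x3 y1 y2 y3 :: real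
  assumes x: "x3 < x2" "x2 < x1" and y: "y3 < y2" "y2 < y1"
    and e: "x1 + x2 + x3 = y1 + y2 + y3" "x1 * x2 + x1 * x3 + x2 * x3 = y1 * y2 + y1 * y3 + y2 * y3"
      "x1 * x2 * x3 = y1 * y2 * y3"
  shows "x1 = y1 \<and> x2 = y2 \<and> x3 = y3"
proof -
  have "(t - x1) * (t - x2) * (t - x3) = (t - y1) * (t - y2) * (t - y3)" for t
  proof -
    have "(t - x1) * (t - x2) * (t - x3) = t ^ 3 - (x1 + x2 + x3) * t\<^sup>2 + (x1 * x2 + x1 * x3 + x2 * x3) * t - x1 * x2 * x3"
      by (simp add: algebra_simps power2_eq_square power3_eq_cube)
    also have "\<dots> = (t - y1) * (t - y2) * (t - y3)"
      unfolding e by (simp add: algebra_simps power2_eq_square power3_eq_cube)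
    finally show ?thesis .
  qed
  from this[of y1] this[of y2] this[of y3]
  have "y1 = x1 \<or> y1 = x2 \<or> y1 = x3" "y2 = x1 \<or> y2 = x2 \<or> y2 = x3" "y3 = x1 \<or> y3 = x2 \<or> y3 = x3"
    by simp_all
  then show ?thesis using x y by auto
qed

text \<open>The squares of the parameters are the ordered roots of a cubic whose coefficients are
  determined by c, by d together with c, and by b^2; positivity recovers the parameters from their
  squares.\<close>

lemma zeta_unique:
  assumes z: "0 < z3" "z3 < z2" "z2 < z1" and w: "0 < w3" "w3 < w2" "w2 < w1"
    and e: "zb z1 z2 z3 = zb w1 w2 w3" "zc z1 z2 z3 = zc w1 w2 w3" "zd z1 z2 z3 = zd w1 w2 w3"
  shows "z1 = w1 \<and> z2 = w2 \<and> z3 = w3"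
proof -
  have s: "z1\<^sup>2 + z2\<^sup>2 + z3\<^sup>2 = w1\<^sup>2 + w2\<^sup>2 + w3\<^sup>2" using e(2) by (simp add: zc_def)
  have d: "zd a b c = (a\<^sup>2 + b\<^sup>2 + c\<^sup>2)\<^sup>2 / 2 - 2 * (a\<^sup>2 * b\<^sup>2 + a\<^sup>2 * c\<^sup>2 + b\<^sup>2 * c\<^sup>2)" for a b c
    by (simp add: zd_def power2_eq_square power4_eq_xxxx field_simps)
  have p: "(zb a b c)\<^sup>2 = 16 * (a\<^sup>2 * b\<^sup>2 * c\<^sup>2)" for a b c
    by (simp add: zb_def power_mult_distrib)
  have "z1\<^sup>2 * z2\<^sup>2 + z1\<^sup>2 * z3\<^sup>2 + z2\<^sup>2 * z3\<^sup>2 = w1\<^sup>2 * w2\<^sup>2 + w1\<^sup>2 * w3\<^sup>2 + w2\<^sup>2 * w3\<^sup>2"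
    using e(3) unfolding d s by simp
  moreover have "z1\<^sup>2 * z2\<^sup>2 * z3\<^sup>2 = w1\<^sup>2 * w2\<^sup>2 * w3\<^sup>2"
    using p[of z1 z2 z3] p[of w1 w2 w3] e(1) by simp
  ultimately have "z1\<^sup>2 = w1\<^sup>2 \<and> z2\<^sup>2 = w2\<^sup>2 \<and> z3\<^sup>2 = w3\<^sup>2"
    using s z w by (intro cubic_roots_unique) (auto intro!: power_strict_mono)
  then show ?thesis using z w by (simp add: power2_eq_iff_nonneg)
qed

text \<open>For the smallest root \<open>z\<^sub>0 > 0\<close> of \<open>z (c - 2 z\<^sup>2) = b\<close> the prescribed \<open>b, c\<close> force
  \<open>\<zeta>\<^sub>1 = \<zeta>\<^sub>2\<close> when \<open>\<zeta>\<^sub>3 = z\<^sub>0\<close>; a slightly larger \<open>\<zeta>\<^sub>3\<close> separates them.\<close>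

lemma zeta_exists_pos:
  assumes c: "0 < c" and b: "0 < b" "b < bcrit c"
  obtains z1 z2 z3 where "0 < z3" "z3 < z2" "z2 < z1" "b = zb z1 z2 z3" "c = zc z1 z2 z3"
proof -
  define g where "g = (\<lambda>z. z * (c - 2 * z\<^sup>2))"
  \<comment> \<open>For the parameters built below, h z / (16 z^2) equals (z1^2 - z^2)(z2^2 - z^2),
    so positivity of \<open>h\<close> is what places z below z2.\<close>
  define h where "h = (\<lambda>z. b\<^sup>2 - 8 * z ^ 4 * (c - 4 * z\<^sup>2))"
  \<comment> \<open>The maximum point of \<open>g\<close> on the positive axis, where c - 6z^2 = 0;
    the maximum is the critical value of b.\<close>
  define m where "m = sqrt (c / 6)"
  have m: "0 < m" "m\<^sup>2 = c / 6" using c by (simp_all add: m_def)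
  have gm: "g m = bcrit c"
  proof -
    have "sqrt (2 * c ^ 3 / 27) = g m"
    proof (rule real_sqrt_unique)
      have "(g m)\<^sup>2 = m\<^sup>2 * (c - 2 * m\<^sup>2)\<^sup>2" by (simp add: g_def power_mult_distrib)
      also have "\<dots> = 2 * c ^ 3 / 27" unfolding m(2) by (simp add: power2_eq_square power3_eq_cube field_simps)
      finally show "(g m)\<^sup>2 = 2 * c ^ 3 / 27" .
      show "0 \<le> g m" using m c by (simp add: g_def)
    qed
    then show ?thesis by (simp add: bcrit_def real_sqrt_divide)
  qed
  have "\<exists>z0\<ge>0. z0 \<le> m \<and> g z0 = b"
    using b m gm unfolding g_def by (intro IVT) (auto intro!: continuous_intros)
  then obtain z0 where z0: "0 \<le> z0" "z0 \<le> m" "g z0 = b" by blast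
  have z0': "0 < z0" "z0 < m"
    using z0 b gm by (auto simp: g_def less_le)
  have sq: "z0\<^sup>2 < c / 6" using z0' unfolding m(2)[symmetric] by (intro power_strict_mono) auto
  have "h z0 = z0\<^sup>2 * (c - 6 * z0\<^sup>2)\<^sup>2"
    unfolding h_def z0(3)[symmetric] g_def by (simp add: algebra_simps power2_eq_square power4_eq_xxxx)
  then have "0 < h z0" using z0' sq by simp
  moreover have "isCont h z0" unfolding h_def by (intro continuous_intros)
  ultimately have "eventually (\<lambda>z. 0 < h z) (at z0)"
    unfolding isCont_def by (rule order_tendstoD(1)[rotated])
  then obtain e where e: "0 < e" "\<And>z. z \<noteq> z0 \<Longrightarrow> \<bar>z - z0\<bar> < e \<Longrightarrow> 0 < h z"
    unfolding eventually_at by (auto simp: dist_real_def)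
  define z where "z = z0 + min e (m - z0) / 2"
  have z: "z0 < z" "z < m" "\<bar>z - z0\<bar> < e" using z0' e by (auto simp: z_def min_def field_simps)
  have hz: "0 < h z" using e z by auto
  have z2c: "z\<^sup>2 < c / 6" using z z0' unfolding m(2)[symmetric] by (intro power_strict_mono) auto
  have gz: "b < g z"
  proof -
    have "z0 * z < z * z" using z z0' by (intro mult_strict_right_mono) auto
    then have "0 < c - 2 * (z\<^sup>2 + z0 * z + z0\<^sup>2)" using z2c sq by (simp add: power2_eq_square)
    then have "0 < (z - z0) * (c - 2 * (z\<^sup>2 + z0 * z + z0\<^sup>2))" using z by simp
    also have "\<dots> = g z - g z0" by (simp add: g_def algebra_simps power2_eq_square)
    finally show ?thesis using z0 by simp
  qed
  have zp: "0 < z" using z z0' by simp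
  \<comment> \<open>The prescribed sum of squares and product of z1 and z2. Hence (z1 + z2)^2 = p +
    2r and (z1 - z2)^2 = p - 2r, and the latter is positive precisely because g z > b.\<close>
  define p r where "p = c / 2 - z\<^sup>2" and "r = b / (4 * z)"
  have r: "0 < r" using b zp by (simp add: r_def)
  have pr: "0 < p - 2 * r" using gz zp by (simp add: p_def r_def g_def field_simps power2_eq_square)
  define u v where "u = sqrt (p + 2 * r)" and "v = sqrt (p - 2 * r)"
  have uv: "0 < v" "v < u" "u\<^sup>2 = p + 2 * r" "v\<^sup>2 = p - 2 * r" using pr r by (simp_all add: u_def v_def)
  define z1 z2 where "z1 = (u + v) / 2" and "z2 = (u - v) / 2"
  have 12: "0 < z2" "z2 < z1" using uv by (simp_all add: z1_def z2_def)
  have sum: "z1\<^sup>2 + z2\<^sup>2 = p"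
  proof -
    have "z1\<^sup>2 + z2\<^sup>2 = (u\<^sup>2 + v\<^sup>2) / 2" by (simp add: z1_def z2_def power2_eq_square field_simps)
    then show ?thesis using uv by simp
  qed
  have prod: "z1 * z2 = r"
  proof -
    have "z1 * z2 = (u\<^sup>2 - v\<^sup>2) / 4" by (simp add: z1_def z2_def power2_eq_square field_simps)
    then show ?thesis using uv by simp
  qed
  have "z < z2"
  proof -
    have "(z1\<^sup>2 - z\<^sup>2) * (z2\<^sup>2 - z\<^sup>2) = (z1 * z2)\<^sup>2 - (z1\<^sup>2 + z2\<^sup>2) * z\<^sup>2 + z ^ 4"
      by (simp add: algebra_simps power2_eq_square power4_eq_xxxx)
    also have "\<dots> = h z / (16 * z\<^sup>2)"
      unfolding sum prod using zp by (simp add: h_def p_def r_def field_simps power2_eq_square power4_eq_xxxx)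
    also have "\<dots> > 0" using hz zp by simp
    finally have "0 < (z1\<^sup>2 - z\<^sup>2) * (z2\<^sup>2 - z\<^sup>2)" .
    moreover have "z2\<^sup>2 < z1\<^sup>2" using 12 by (intro power_strict_mono) auto
    then have "0 < z1\<^sup>2 - z\<^sup>2" using sum z2c by (simp add: p_def)
    ultimately have "z\<^sup>2 < z2\<^sup>2" by (simp add: zero_less_mult_iff)
    then show ?thesis using 12 by (simp add: power2_less_imp_less)
  qed
  moreover have "b = zb z1 z2 z"
  proof -
    have "zb z1 z2 z = 4 * (z1 * z2) * z" by (simp add: zb_def)
    then show ?thesis unfolding prod using zp by (simp add: r_def)
  qed
  moreover have "c = zc z1 z2 z"
  proof -
    have "zc z1 z2 z = 2 * (z1\<^sup>2 + z2\<^sup>2) + 2 * z\<^sup>2" by (simp add: zc_def)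
    then show ?thesis unfolding sum by (simp add: p_def)
  qed
  ultimately show ?thesis using that[of z z2 z1] zp 12 by blast
qed

lemma zeta_exists:
  assumes c: "0 < c" and b: "- bcrit c < b" "b < bcrit c"
  obtains z1 z2 z3 where "- z2 < z3" "z3 < z2" "z2 < z1" "b = zb z1 z2 z3" "c = zc z1 z2 z3"
proof (cases b "0::real" rule: linorder_cases)
  case less
  then have "0 < - b" "- b < bcrit c" using b by auto
  then obtain z1 z2 z3 where *: "0 < z3" "z3 < z2" "z2 < z1" "- b = zb z1 z2 z3" "c = zc z1 z2 z3"
    by (rule zeta_exists_pos[OF c])
  show ?thesis by (rule that[of z2 "- z3" z1]) (use * in \<open>auto simp: zb_def zc_def\<close>)
next
  case equal
  \<comment> \<open>For b = 0 the choice z3 = 0 is forced; any two distinct positive squares with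
    sum c/2 would do, here c/3 and c/6.\<close>
  have "sqrt (c / 6) < sqrt (c / 3)" using c by simp
  moreover have "0 < sqrt (c / 6)" using c by simp
  moreover have "c = zc (sqrt (c / 3)) (sqrt (c / 6)) 0" using c by (simp add: zc_def)
  ultimately show ?thesis using that[of "sqrt (c / 6)" 0 "sqrt (c / 3)"] equal by (simp add: zb_def)
next
  case greater
  then obtain z1 z2 z3 where *: "0 < z3" "z3 < z2" "z2 < z1" "b = zb z1 z2 z3" "c = zc z1 z2 z3"
    using b(2) by (rule zeta_exists_pos[OF c])
  show ?thesis by (rule that[of z2 z3 z1]) (use * in auto)
qed

text \<open>Dividing the quartic by (y - m)(y - M) leaves the quadratic \<open>R\<close>. The
  assumptions \<open>P\<close> concern half the derivative of the quartic, which is (m - M) R(m) / 2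
  at m and (M - m) R(M) / 2 at M, so \<open>R\<close> is negative at both points and its two real
  roots enclose them.\<close>

lemma quartic_param:
  fixes b c d m M :: real
  assumes mM: "m < M" and Q: "m ^ 4 - c * m\<^sup>2 + 2 * b * m + 2 * d = 0" "M ^ 4 - c * M\<^sup>2 + 2 * b * M + 2 * d = 0"
    and P: "0 < 2 * m ^ 3 - c * m + b" "2 * M ^ 3 - c * M + b < 0"
  obtains z1 z2 z3 where "- z2 < z3" "z3 < z2" "z2 < z1" "b = zb z1 z2 z3" "c = zc z1 z2 z3" "d = zd z1 z2 z3"
    "m = z2 + z3 - z1"
proof -
  define s e where "s = m + M" and "e = (m + M)\<^sup>2 - m * M - c"
  have "(M - m) * (2 * b) = (M - m) * (s * (m * M - e))"
    using Q by (simp add: s_def e_def algebra_simps power2_eq_square power4_eq_xxxx)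
  then have b: "2 * b = s * (m * M - e)" using mM by simp
  have c: "c = s\<^sup>2 - m * M - e" by (simp add: s_def e_def)
  have d: "2 * d = m * M * e"
  proof -
    have "2 * d = c * m\<^sup>2 - m * (2 * b) - m ^ 4" using Q(1) by (simp add: algebra_simps)
    also have "\<dots> = m * M * e" unfolding b c by (simp add: s_def algebra_simps power2_eq_square power4_eq_xxxx)
    finally show ?thesis .
  qed
  define R where "R = (\<lambda>y. y\<^sup>2 + s * y + e)"
  have "2 * (2 * m ^ 3 - c * m + b) = 4 * m ^ 3 - 2 * c * m + 2 * b" by simp
  also have "\<dots> = (m - M) * R m"
    unfolding b c R_def by (simp add: s_def algebra_simps power2_eq_square power3_eq_cube)
  finally have r: "2 * (2 * m ^ 3 - c * m + b) = (m - M) * R m" .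
  have "0 < (m - M) * R m" unfolding r[symmetric] using P(1) by simp
  then have Rm: "R m < 0" using mM by (simp add: zero_less_mult_iff)
  have "2 * (2 * M ^ 3 - c * M + b) = 4 * M ^ 3 - 2 * c * M + 2 * b" by simp
  also have "\<dots> = (M - m) * R M"
    unfolding b c R_def by (simp add: s_def algebra_simps power2_eq_square power3_eq_cube)
  finally have r: "2 * (2 * M ^ 3 - c * M + b) = (M - m) * R M" .
  have "(M - m) * R M < 0" unfolding r[symmetric] using P(2) by simp
  then have RM: "R M < 0" using mM by (simp add: mult_less_0_iff)
  have sq: "(2 * y + s)\<^sup>2 = 4 * R y + (s\<^sup>2 - 4 * e)" for y
    by (simp add: R_def algebra_simps power2_eq_square)
  have "0 \<le> (2 * m + s)\<^sup>2" by simp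
  then have disc: "0 < s\<^sup>2 - 4 * e" using sq[of m] Rm by simp
  define w where "w = sqrt (s\<^sup>2 - 4 * e)"
  have w: "0 < w" "w\<^sup>2 = s\<^sup>2 - 4 * e" using disc by (simp_all add: w_def)
  have "(2 * y + s)\<^sup>2 < w\<^sup>2" if "R y < 0" for y using sq[of y] w that by simp
  then have lt: "\<bar>2 * y + s\<bar> < w" if "R y < 0" for y
    using that w(1) power2_less_imp_less[of "\<bar>2 * y + s\<bar>" w] by simp
  \<comment> \<open>The larger root of \<open>R\<close>, hence the largest root of the quartic; the
    absence of a cubic term makes the smallest one -(u + m + M).\<close>
  define u where "u = (w - s) / 2"
  have uu: "u\<^sup>2 = - s * u - e"
  proof -
    have "4 * u\<^sup>2 = w\<^sup>2 - 2 * w * s + s\<^sup>2" by (simp add: u_def power2_eq_square field_simps)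
    also have "\<dots> = 4 * (- s * u - e)" unfolding w(2) by (simp add: u_def power2_eq_square field_simps)
    finally show ?thesis by simp
  qed
  have e: "e = - u\<^sup>2 - s * u" using uu by simp
  define z1 z2 z3 where "z1 = (u + M) / 2" and "z2 = (u + m) / 2" and "z3 = (m + M) / 2"
  show ?thesis
  proof (rule that)
    show "- z2 < z3" using lt[OF Rm] by (simp add: z2_def z3_def u_def s_def abs_less_iff field_simps)
    show "z3 < z2" using lt[OF RM] by (simp add: z2_def z3_def u_def s_def abs_less_iff field_simps)
    show "z2 < z1" using mM by (simp add: z1_def z2_def)
    have "2 * b = 2 * zb z1 z2 z3"
      unfolding b e by (simp add: zb_def z1_def z2_def z3_def s_def field_simps power2_eq_square)
    then show "b = zb z1 z2 z3" by simp
    show "c = zc z1 z2 z3"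
      unfolding c e by (simp add: zc_def z1_def z2_def z3_def s_def field_simps power2_eq_square)
    have "2 * d = 2 * zd z1 z2 z3"
      unfolding d e by (simp add: zd_def z1_def z2_def z3_def s_def field_simps power2_eq_square power4_eq_xxxx)
    then show "d = zd z1 z2 z3" by simp
    show "m = z2 + z3 - z1" by (simp add: z1_def z2_def z3_def field_simps)
  qed
qed

section \<open>Reduction of a periodic solution to the explicit profile\<close>

lemma is_solE:
  assumes "is_sol b c phi"
  obtains phi' where "\<And>x. (phi has_real_derivative phi' x) (at x)"
    "\<And>x. (phi' has_real_derivative b + (- c) * phi x + 2 * phi x ^ 3) (at x)"
proof -
  obtain phi' where *: "\<And>x. (phi has_real_derivative phi' x) (at x)"
    "\<And>x. (phi' has_real_derivative (b + 2 * (phi x) ^ 3 - c * phi x)) (at x)"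
    using assms unfolding is_sol_def by blast
  have "b + 2 * (phi x) ^ 3 - c * phi x = b + (- c) * phi x + 2 * phi x ^ 3" for x by simp
  with * show ?thesis by (intro that[of phi']) simp_all
qed

lemma is_sol_uminus: "is_sol b c phi \<Longrightarrow> is_sol (- b) c (\<lambda>x. - phi x)"
proof -
  assume "is_sol b c phi"
  then obtain phi' where *: "\<And>x. (phi has_real_derivative phi' x) (at x)"
    "\<And>x. (phi' has_real_derivative b + (- c) * phi x + 2 * phi x ^ 3) (at x)"
    by (rule is_solE) blast
  show ?thesis unfolding is_sol_def
    using DERIV_minus[OF *(1)] DERIV_minus[OF *(2)]
    by (intro exI[of _ "\<lambda>x. - phi' x"]) (simp add: algebra_simps)
qed

lemma bpnc_uminus: "bpnc phi \<Longrightarrow> bpnc (\<lambda>x. - phi x)"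
  unfolding bpnc_def by (auto simp: bounded_iff)

text \<open>The last inequality says that the second derivative is positive at the minimum, i.e.
  that the root of the quartic is simple. A negative value contradicts minimality, and zero would
  make the constant \<open>phi x0\<close> a solution with the same initial data, so
  \<open>phi\<close> would be constant.\<close>

lemma periodic_sol_min:
  assumes sol: "is_sol b c phi" and per: "bpnc phi"
  obtains x0 where "\<And>x. phi x0 \<le> phi x" "deriv phi x0 = 0" "0 < 2 * phi x0 ^ 3 - c * phi x0 + b"
proof -
  obtain phi' where d: "\<And>x. (phi has_real_derivative phi' x) (at x)"
    "\<And>x. (phi' has_real_derivative b + (- c) * phi x + 2 * phi x ^ 3) (at x)"
    using sol by (rule is_solE) blast
  obtain T where T: "T > 0" "\<And>x. phi (x + T) = phi x" using per by (auto simp: bpnc_def)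
  obtain p1 p2 where p: "phi p1 \<noteq> phi p2" using per by (auto simp: bpnc_def)
  interpret per: periodic_fun_simple phi T by unfold_locales (rule T(2))
  have "continuous_on {0..T} phi"
    by (intro continuous_at_imp_continuous_on ballI DERIV_isCont[OF d(1)])
  then have "\<exists>x\<in>{0..T}. \<forall>y\<in>{0..T}. phi x \<le> phi y"
    using T by (intro continuous_attains_inf) auto
  then obtain x0 where x0: "\<And>x. x \<in> {0..T} \<Longrightarrow> phi x0 \<le> phi x" by blast
  have min: "phi x0 \<le> phi x" for x
  proof -
    define y where "y = x - of_int \<lfloor>x / T\<rfloor> * T"
    have "of_int \<lfloor>x / T\<rfloor> * T \<le> x / T * T" "x / T * T < (of_int \<lfloor>x / T\<rfloor> + 1) * T"
      using T by (intro mult_right_mono mult_strict_right_mono; linarith)+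
    then have "y \<in> {0..T}" using T by (simp add: y_def algebra_simps)
    moreover have "phi y = phi x" unfolding y_def by (rule per.minus_of_int)
    ultimately show ?thesis using x0[of y] by simp
  qed
  have d0: "phi' x0 = 0"
    by (rule DERIV_local_min[OF d(1), of 1]) (auto intro: min)
  define l where "l = b + (- c) * phi x0 + 2 * phi x0 ^ 3"
  have "\<not> l < 0"
  proof
    assume "l < 0"
    then obtain e where e: "0 < e" "\<And>h. 0 < h \<Longrightarrow> h < e \<Longrightarrow> phi' (x0 + h) < phi' x0"
      using DERIV_neg_dec_right[OF d(2)[of x0]] unfolding l_def by auto
    have "phi (x0 + e / 2) < phi x0"
    proof (rule DERIV_neg_imp_decreasing_open[of x0 "x0 + e / 2" phi])
      fix x assume "x0 < x" "x < x0 + e / 2"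
      then have "phi' x < 0" using e(2)[of "x - x0"] e(1) d0 by simp
      then show "\<exists>y. (phi has_real_derivative y) (at x) \<and> y < 0" using d(1) by blast
    next
      show "continuous_on {x0..x0 + e / 2} phi"
        by (intro continuous_at_imp_continuous_on ballI DERIV_isCont[OF d(1)])
    qed (use e in simp)
    then show False using min[of "x0 + e / 2"] by simp
  qed
  moreover have "l \<noteq> 0"
  proof
    assume l: "l = 0"
    define g where "g = (\<lambda>_::real. phi x0)"
    have g: "(g has_real_derivative 0) (at x)" "((\<lambda>_. 0) has_real_derivative b + (- c) * g x + 2 * g x ^ 3) (at x)" for x
      using l by (simp_all add: g_def l_def)
    have "phi x = phi x0" for x
      using cubic_ode_unique[OF d g, of x0 x] d0 by (simp add: g_def)
    from this[of p1] this[of p2] show False using p by simp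
  qed
  ultimately have "0 < l" by simp
  then show ?thesis using that[OF min] d0 DERIV_imp_deriv[OF d(1)[of x0]] by (simp add: l_def)
qed

text \<open>Translated to its minimum, the solution has the initial data of \<open>prof\<close> at
  0, namely the second smallest root of the quartic and derivative 0, so uniqueness identifies the
  two.\<close>

lemma periodic_sol_shape:
  assumes sol: "is_sol b c phi" and per: "bpnc phi"
  obtains x0 z1 z2 z3 where "- z2 < z3" "z3 < z2" "z2 < z1" "b = zb z1 z2 z3" "c = zc z1 z2 z3"
    "invariant b c (zd z1 z2 z3) phi" "\<And>x. phi (x + x0) = prof z1 z2 z3 x"
proof -
  obtain phi' where d: "\<And>x. (phi has_real_derivative phi' x) (at x)"
    "\<And>x. (phi' has_real_derivative b + (- c) * phi x + 2 * phi x ^ 3) (at x)"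
    using sol by (rule is_solE) blast
  have dphi: "deriv phi x = phi' x" for x by (rule DERIV_imp_deriv[OF d(1)])
  obtain x0 where x0': "\<And>x. phi x0 \<le> phi x" "deriv phi x0 = 0" "0 < 2 * phi x0 ^ 3 - c * phi x0 + b"
    by (rule periodic_sol_min[OF sol per]) (rule that; assumption)
  note x0 = x0'[unfolded dphi]
  \<comment> \<open>The maximum is the minimum of the negated solution, which solves the equation
    with \<open>- b\<close>.\<close>
  obtain x1 where "\<And>x. - phi x1 \<le> - phi x" "deriv (\<lambda>x. - phi x) x1 = 0" "0 < 2 * (- phi x1) ^ 3 - c * (- phi x1) + (- b)"
    by (rule periodic_sol_min[OF is_sol_uminus[OF sol] bpnc_uminus[OF per]]) (rule that; assumption)
  moreover have "deriv (\<lambda>x. - phi x) x1 = - phi' x1"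
    by (rule DERIV_imp_deriv[OF DERIV_minus[OF d(1)]])
  ultimately have x1: "phi x0 \<le> phi x1" "phi' x1 = 0" "2 * phi x1 ^ 3 - c * phi x1 + b < 0"
    using x0(1) by simp_all
  have lt: "phi x0 < phi x1" using x0(3) x1(1,3) by (cases "phi x0 = phi x1") auto
  define E where "E = (\<lambda>x. (phi' x)\<^sup>2 - (phi x ^ 4 - c * (phi x)\<^sup>2 + 2 * b * phi x))"
  have "(E has_real_derivative 0) (at x)" for x
    unfolding E_def
    by (rule derivative_eq_intros d refl)+ (simp add: algebra_simps power3_eq_cube power2_eq_square)
  then have E: "E x = E y" for x y by (intro DERIV_isconst_all) blast
  define dd where "dd = E x0 / 2"
  have inv: "(phi' x)\<^sup>2 = phi x ^ 4 - c * (phi x)\<^sup>2 + 2 * b * phi x + 2 * dd" for x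
  proof -
    have "E x = 2 * dd" using E[of x x0] by (simp add: dd_def)
    then show ?thesis unfolding E_def by linarith
  qed
  obtain z1 z2 z3 where z: "- z2 < z3" "z3 < z2" "z2 < z1" "b = zb z1 z2 z3" "c = zc z1 z2 z3" "dd = zd z1 z2 z3"
    "phi x0 = z2 + z3 - z1"
  proof (rule quartic_param[OF lt _ _ x0(3) x1(3)])
    show "phi x0 ^ 4 - c * (phi x0)\<^sup>2 + 2 * b * phi x0 + 2 * dd = 0" using inv[of x0] x0(2) by simp
    show "phi x1 ^ 4 - c * (phi x1)\<^sup>2 + 2 * b * phi x1 + 2 * dd = 0" using inv[of x1] x1(2) by simp
  qed
  have iv: "invariant b c (zd z1 z2 z3) phi"
    using inv unfolding invariant_def dphi z(6)[symmetric] by blast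
  have sh: "((\<lambda>x. x + x0) has_real_derivative 1) (at x)" for x
    by (auto intro!: derivative_eq_intros)
  have s1: "((\<lambda>x. phi (x + x0)) has_real_derivative phi' (x + x0)) (at x)" for x
    using DERIV_chain2[OF d(1) sh] by simp
  have s2: "((\<lambda>x. phi' (x + x0)) has_real_derivative b + (- c) * phi (x + x0) + 2 * phi (x + x0) ^ 3) (at x)" for x
    using DERIV_chain2[OF d(2) sh] by simp
  have s3: "(prof1 z1 z2 z3 has_real_derivative b + (- c) * prof z1 z2 z3 x + 2 * prof z1 z2 z3 x ^ 3) (at x)" for x
    using prof1_deriv[OF z(1-3), of x] unfolding z(4)[symmetric] z(5)[symmetric] by (simp add: algebra_simps)
  have "phi (x + x0) = prof z1 z2 z3 x" for x
    by (rule cubic_ode_unique[OF s1 s2 prof_deriv[OF z(1-3)] s3, where a = 0])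
       (simp_all add: prof_0[OF z(1-3)] prof1_0[OF z(1-3)] z(7) x0(2))
  with z(1-5) iv show ?thesis by (rule that)
qed

lemma invariant_unique: "invariant b c d phi \<Longrightarrow> invariant b c d' phi \<Longrightarrow> d = d'"
proof -
  assume *: "invariant b c d phi" "invariant b c d' phi"
  have "(deriv phi 0)\<^sup>2 = (phi 0) ^ 4 - c * (phi 0)\<^sup>2 + 2 * b * phi 0 + 2 * d"
    "(deriv phi 0)\<^sup>2 = (phi 0) ^ 4 - c * (phi 0)\<^sup>2 + 2 * b * phi 0 + 2 * d'"
    using * unfolding invariant_def by blast+
  then show ?thesis by linarith
qed

lemma periodic_sol_pos_shape:
  assumes sol: "is_sol b c phi" and per: "bpnc phi" and b: "0 < b"
  obtains x0 z1 z2 z3 where "0 < z3" "z3 < z2" "z2 < z1" "b = zb z1 z2 z3" "c = zc z1 z2 z3"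
    "invariant b c (zd z1 z2 z3) phi" "\<And>x. phi (x + x0) = prof z1 z2 z3 x"
proof -
  obtain x0 z1 z2 z3 where z: "- z2 < z3" "z3 < z2" "z2 < z1" "b = zb z1 z2 z3" "c = zc z1 z2 z3"
    "invariant b c (zd z1 z2 z3) phi" "\<And>x. phi (x + x0) = prof z1 z2 z3 x"
    by (rule periodic_sol_shape[OF sol per]) (rule that; assumption)
  have "0 < z1 * z2" using z by simp
  moreover have "0 < (z1 * z2) * z3" using z(4) b by (simp add: zb_def)
  ultimately have "0 < z3" by (rule zero_less_mult_pos[rotated])
  then show ?thesis using z(2-7) by (rule that)
qed

text \<open>Parameters obtained from the solution could differ from the prescribed ones with the
  same \<open>b\<close> and \<open>c\<close>; the invariant fixes \<open>d\<close> and thereby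
  excludes this.\<close>

lemma periodic_sol_eq_prof:
  assumes z: "0 < z3" "z3 < z2" "z2 < z1"
    and sol: "is_sol (zb z1 z2 z3) (zc z1 z2 z3) phi" and per: "bpnc phi"
    and inv: "invariant (zb z1 z2 z3) (zc z1 z2 z3) (zd z1 z2 z3) phi"
  obtains x0 where "\<And>x. phi (x + x0) = prof z1 z2 z3 x"
proof -
  have pos: "0 < zb z1 z2 z3" using z by (simp add: zb_def)
  obtain x0 w1 w2 w3 where w: "0 < w3" "w3 < w2" "w2 < w1" "zb z1 z2 z3 = zb w1 w2 w3" "zc z1 z2 z3 = zc w1 w2 w3"
    "invariant (zb z1 z2 z3) (zc z1 z2 z3) (zd w1 w2 w3) phi" "\<And>x. phi (x + x0) = prof w1 w2 w3 x"
    by (rule periodic_sol_pos_shape[OF sol per pos]) (rule that; assumption)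
  have "z1 = w1 \<and> z2 = w2 \<and> z3 = w3"
    using zeta_unique[OF z w(1-5) invariant_unique[OF inv w(6)]] .
  then show ?thesis using w(7) that[of x0] by simp
qed

section \<open>Theta representation of the profile\<close>

lemma beta_set_jTheta_nonzero:
  assumes k: "0 < k" "k < 1" and b: "beta \<in> beta_set k" shows "jTheta k beta \<noteq> 0"
proof (rule jTheta_nonzero[OF k])
  have "0 < ellK' k" unfolding ellK'_def using compl_modulus[OF k] by (intro ellK_pos) auto
  then show "\<bar>Im beta\<bar> < ellK' k" using b by (auto simp: beta_set_def)
qed

lemma jTheta_of_real_nonzero: "0 < k \<Longrightarrow> k < 1 \<Longrightarrow> jTheta k (of_real x) \<noteq> 0"
proof (rule jTheta_nonzero)
  assume k: "0 < k" "k < 1"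
  show "\<bar>Im (of_real x)\<bar> < ellK' k"
    unfolding ellK'_def using compl_modulus[OF k] ellK_pos[of "sqrt (1 - k\<^sup>2)"] by simp
qed

text \<open>Existence and uniqueness of an imaginary \<open>beta\<close>: the tangent of the
  amplitude runs through all positive values on (0, K'), so the size of the prescribed sn does not
  matter.\<close>

lemma tan_jam_ex1:
  assumes k: "0 < k" "k < 1" and t: "0 < t"
  shows "\<exists>!v. 0 < v \<and> v < ellK k \<and> tan (jam k v) = t"
proof (rule ex1I[of _ "ellF k (arctan t)"])
  have "0 < arctan t" using t by simp
  then show "0 < ellF k (arctan t) \<and> ellF k (arctan t) < ellK k \<and> tan (jam k (ellF k (arctan t))) = t"
    using ellF_strict_mono[OF k, of 0 "arctan t"] ellF_strict_mono[OF k arctan_ubound, of t]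
    by (simp add: ellF_0[OF k] jam_ellF[OF k] ellK_def tan_arctan)
next
  fix v assume v: "0 < v \<and> v < ellK k \<and> tan (jam k v) = t"
  then have "0 < jam k v" "jam k v < pi / 2"
    using jam_less_iff[OF k, of 0 v] jam_less_iff[OF k, of v "ellK k"] jam_0[OF k] jam_K[OF k] by simp_all
  then have "arctan t = jam k v" using v by (intro arctan_unique) auto
  then show "v = ellF k (arctan t)" using ellF_jam[OF k, of v] by simp
qed

lemma alpha_ok_ex1:
  assumes z: "0 < z3" "z3 < z2" "z2 < z1" shows "\<exists>!alpha. alpha_ok z1 z2 z3 alpha"
proof -
  have z': "- z2 < z3" using z by simp
  have "0 < (z1 - z3) / (z1 + z2)" "(z1 - z3) / (z1 + z2) < 1" using z by simp_all
  then show ?thesis unfolding alpha_ok_def Let_def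
    by (intro jsn_ex1 zk_bounds[OF z' z(2,3)]) simp_all
qed

text \<open>The square of sn(beta). Its sign is that of z1 - z2 - z3 and decides between real and
  imaginary \<open>beta\<close>.\<close>

definition beta_sq :: "real \<Rightarrow> real \<Rightarrow> real \<Rightarrow> real" where
  "beta_sq z1 z2 z3 = (z1 + z3) * (z1 - z2 - z3) / ((z1 - z2) * (z1 + z2 + z3))"

lemma beta_ok_alt: "beta_ok z1 z2 z3 beta \<longleftrightarrow>
    beta \<in> beta_set (zk z1 z2 z3) \<and> jsnC (zk z1 z2 z3) beta = csqrt (of_real (beta_sq z1 z2 z3))"
  by (simp add: beta_ok_def beta_sq_def Let_def)

lemma beta_sq_pos:
  assumes z: "0 < z3" "z3 < z2" "z2 < z1" and g: "z2 + z3 < z1"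
  shows "0 < beta_sq z1 z2 z3" "beta_sq z1 z2 z3 < 1"
proof -
  have d: "0 < (z1 - z2) * (z1 + z2 + z3)" using z by simp
  show "0 < beta_sq z1 z2 z3" unfolding beta_sq_def using z g d by (intro divide_pos_pos mult_pos_pos) auto
  have "(z1 - z2) * (z1 + z2 + z3) - (z1 + z3) * (z1 - z2 - z3) = z1 * z3 + z2 * (z1 - z2) + z3\<^sup>2"
    by (simp add: algebra_simps power2_eq_square)
  also have "\<dots> > 0" using z by (intro add_pos_pos mult_pos_pos) auto
  finally show "beta_sq z1 z2 z3 < 1" unfolding beta_sq_def using d by simp
qed

lemma beta_sq_neg:
  assumes z: "0 < z3" "z3 < z2" "z2 < z1" and g: "z1 < z2 + z3"
  shows "beta_sq z1 z2 z3 < 0"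
  unfolding beta_sq_def using z g by (intro divide_neg_pos mult_pos_neg mult_pos_pos) auto

text \<open>The prescribed value is real and lies in (0, 1). The imaginary segment of
  \<open>beta_set\<close> is ruled out because sn is purely imaginary there, and on the real one sn
  is strictly increasing from 0 to 1.\<close>

lemma beta_real_case:
  assumes z: "0 < z3" "z3 < z2" "z2 < z1" and g: "z2 + z3 < z1"
  shows "\<exists>!beta. beta_ok z1 z2 z3 beta"
    and "beta_ok z1 z2 z3 beta \<Longrightarrow> beta \<in> complex_of_real ` {0<..<ellK (zk z1 z2 z3)}"
proof -
  define k where "k = zk z1 z2 z3"
  have z': "- z2 < z3" using z by simp
  have k: "0 < k" "k < 1" using zk_bounds[OF z' z(2,3)] by (simp_all add: k_def)
  define s where "s = sqrt (beta_sq z1 z2 z3)"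
  have s: "0 < s" "s < 1" using beta_sq_pos[OF z g] by (simp_all add: s_def)
  have cs: "csqrt (of_real (beta_sq z1 z2 z3)) = of_real s"
    using beta_sq_pos[OF z g] by (simp add: s_def csqrt_of_real_nonneg)
  have ok: "beta_ok z1 z2 z3 beta \<longleftrightarrow> (\<exists>u. 0 < u \<and> u < ellK k \<and> jsn k u = s \<and> beta = of_real u)" for beta
  proof
    assume "beta_ok z1 z2 z3 beta"
    then have b: "beta \<in> beta_set k" "jsnC k beta = of_real s"
      unfolding beta_ok_alt cs k_def[symmetric] by auto
    from b(1) consider u where "0 < u" "u < ellK k" "beta = of_real u"
      | v where "0 < v" "v < ellK' k" "beta = \<i> * of_real v"
      unfolding beta_set_def by auto
    then show "\<exists>u. 0 < u \<and> u < ellK k \<and> jsn k u = s \<and> beta = of_real u"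
    proof cases
      case 1
      then show ?thesis using b(2) jsnC_of_real[OF k, of u] by auto
    next
      case 2
      then have "\<i> * of_real (tan (jam (sqrt (1 - k\<^sup>2)) v)) = complex_of_real s"
        using b(2) jsnC_imag[OF k, of v] by simp
      then have "s = 0" by (simp add: complex_eq_iff)
      then show ?thesis using s by simp
    qed
  next
    assume "\<exists>u. 0 < u \<and> u < ellK k \<and> jsn k u = s \<and> beta = of_real u"
    then show "beta_ok z1 z2 z3 beta"
      unfolding beta_ok_alt cs k_def[symmetric] beta_set_def using jsnC_of_real[OF k] by auto
  qed
  show "\<exists>!beta. beta_ok z1 z2 z3 beta"
    unfolding ok using jsn_ex1[OF k s] by (metis (no_types, lifting))
  show "beta_ok z1 z2 z3 beta \<Longrightarrow> beta \<in> complex_of_real ` {0<..<ellK (zk z1 z2 z3)}"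
    unfolding ok k_def[symmetric] by auto
qed

lemma beta_imag_case:
  assumes z: "0 < z3" "z3 < z2" "z2 < z1" and g: "z1 < z2 + z3"
  shows "\<exists>!beta. beta_ok z1 z2 z3 beta"
    and "beta_ok z1 z2 z3 beta \<Longrightarrow> beta \<in> (\<lambda>v. \<i> * complex_of_real v) ` {0<..<ellK' (zk z1 z2 z3)}"
proof -
  define k where "k = zk z1 z2 z3"
  have z': "- z2 < z3" using z by simp
  have k: "0 < k" "k < 1" using zk_bounds[OF z' z(2,3)] by (simp_all add: k_def)
  define k' where "k' = sqrt (1 - k\<^sup>2)"
  have k': "0 < k'" "k' < 1" using compl_modulus[OF k] by (simp_all add: k'_def)
  have K': "ellK' k = ellK k'" by (simp add: ellK'_def k'_def)
  define s where "s = sqrt (- beta_sq z1 z2 z3)"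
  have s: "0 < s" using beta_sq_neg[OF z g] by (simp add: s_def)
  have cs: "csqrt (of_real (beta_sq z1 z2 z3)) = \<i> * of_real s"
    using beta_sq_neg[OF z g] by (simp add: s_def csqrt_of_real_nonpos)
  have ok: "beta_ok z1 z2 z3 beta \<longleftrightarrow> (\<exists>v. 0 < v \<and> v < ellK k' \<and> tan (jam k' v) = s \<and> beta = \<i> * of_real v)" for beta
  proof
    assume "beta_ok z1 z2 z3 beta"
    then have b: "beta \<in> beta_set k" "jsnC k beta = \<i> * of_real s"
      unfolding beta_ok_alt cs k_def[symmetric] by auto
    from b(1) consider u where "0 < u" "u < ellK k" "beta = of_real u"
      | v where "0 < v" "v < ellK k'" "beta = \<i> * of_real v"
      unfolding beta_set_def K' by auto
    then show "\<exists>v. 0 < v \<and> v < ellK k' \<and> tan (jam k' v) = s \<and> beta = \<i> * of_real v"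
    proof cases
      case 1
      then have "complex_of_real (jsn k u) = \<i> * of_real s" using b(2) jsnC_of_real[OF k, of u] by simp
      then have "s = 0" by (simp add: complex_eq_iff)
      then show ?thesis using s by simp
    next
      case 2
      then have "\<i> * of_real (tan (jam k' v)) = \<i> * complex_of_real s"
        using b(2) jsnC_imag[OF k, of v] K' by (simp add: k'_def)
      then have "tan (jam k' v) = s" by simp
      then show ?thesis using 2 by blast
    qed
  next
    assume "\<exists>v. 0 < v \<and> v < ellK k' \<and> tan (jam k' v) = s \<and> beta = \<i> * of_real v"
    then obtain v where v: "0 < v" "v < ellK k'" "tan (jam k' v) = s" "beta = \<i> * of_real v" by blast
    then show "beta_ok z1 z2 z3 beta"
      unfolding beta_ok_alt cs k_def[symmetric] beta_set_def K'
      using jsnC_imag[OF k, of v] K' by (auto simp: k'_def)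
  qed
  show "\<exists>!beta. beta_ok z1 z2 z3 beta"
    unfolding ok using tan_jam_ex1[OF k' s] by (metis (no_types, lifting))
  show "beta_ok z1 z2 z3 beta \<Longrightarrow> beta \<in> (\<lambda>v. \<i> * complex_of_real v) ` {0<..<ellK' (zk z1 z2 z3)}"
    unfolding ok k_def[symmetric] K' by auto
qed

text \<open>This value explains the choice of alpha: 1 - k^2 sn^2(alpha) sn^2 becomes the
  denominator of \<open>prof\<close> divided by z1 + z3, so the theta product in the denominator
  carries the poles of the profile.\<close>

lemma k2_sn2_alpha:
  assumes z: "0 < z3" "z3 < z2" "z2 < z1" and a: "alpha_ok z1 z2 z3 alpha"
  shows "(zk z1 z2 z3)\<^sup>2 * (jsn (zk z1 z2 z3) alpha)\<^sup>2 = (z1 - z2) / (z1 + z3)"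
proof -
  have z': "- z2 < z3" using z by simp
  have "(jsn (zk z1 z2 z3) alpha)\<^sup>2 = (z1 - z3) / (z1 + z2)"
    using a z by (simp add: alpha_ok_def Let_def)
  moreover have "(zk z1 z2 z3)\<^sup>2 = ((z1 - z2) * (z1 + z2)) / ((z1 - z3) * (z1 + z3))"
    unfolding zk_sq[OF z' z(2,3)] by (simp add: algebra_simps power2_eq_square)
  ultimately show ?thesis using z by simp
qed

lemma theta_denominator:
  assumes z: "0 < z3" "z3 < z2" "z2 < z1" and a: "alpha_ok z1 z2 z3 alpha"
  defines "k \<equiv> zk z1 z2 z3"
  shows "jTheta k (of_real y - of_real alpha) * jTheta k (of_real y + of_real alpha) * (jTheta k 0)\<^sup>2
    = (jTheta k (of_real y))\<^sup>2 * (jTheta k (of_real alpha))\<^sup>2 * of_real (1 - (z1 - z2) / (z1 + z3) * (jsn k y)\<^sup>2)"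
proof -
  have k: "0 < k" "k < 1" using zk_bounds[of z2 z3 z1] z by (simp_all add: k_def)
  have "jTheta k (of_real y + of_real alpha) * jTheta k (of_real y - of_real alpha) * (jTheta k 0)\<^sup>2
    = (jTheta k (of_real y))\<^sup>2 * (jTheta k (of_real alpha))\<^sup>2 * of_real (1 - (k\<^sup>2 * (jsn k alpha)\<^sup>2) * (jsn k y)\<^sup>2)"
    using jTheta_addition[OF k jTheta_of_real_nonzero[OF k] jTheta_of_real_nonzero[OF k], of y alpha]
    by (simp add: jsnC_of_real[OF k] mult_ac)
  then show ?thesis
    unfolding k2_sn2_alpha[OF z a, folded k_def] by (simp add: mult_ac)
qed

lemma cancel_common_factor:
  fixes A E s C :: real
  assumes "A \<noteq> 0" "E \<noteq> 0"
  shows "- s + 2 * A * C / (A * E) = (- s * E + 2 * C) / E"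
  using assms by (simp add: field_simps)

text \<open>By the addition formulas the numerator is proportional to S - R with S = sn^2 and R =
  sn^2(beta), and the denominator to E. The constant Theta^2(alpha)/H^2(beta) cancels every
  remaining theta value, and (z1 - z2 - z3)(S - R)/(E R) is left.\<close>

lemma prof_eq_profA:
  assumes z: "0 < z3" "z3 < z2" "z2 < z1" and ne: "z1 \<noteq> z2 + z3"
    and a: "alpha_ok z1 z2 z3 alpha" and b: "beta_ok z1 z2 z3 beta"
  shows "complex_of_real (prof z1 z2 z3 x) = profA z1 z2 z3 alpha beta x"
proof -
  define k where "k = zk z1 z2 z3"
  define y where "y = znu z1 z2 z3 * x"
  have z': "- z2 < z3" using z by simp
  have k: "0 < k" "k < 1" using zk_bounds[OF z' z(2,3)] by (simp_all add: k_def)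
  define R where "R = beta_sq z1 z2 z3"
  have R: "R \<noteq> 0" unfolding R_def beta_sq_def using z ne by simp
  have bs: "beta \<in> beta_set k" "(jsnC k beta)\<^sup>2 = of_real R"
    using b unfolding beta_ok_alt k_def R_def by auto
  have nz: "jTheta k (of_real y) \<noteq> 0" "jTheta k (of_real alpha) \<noteq> 0" "jTheta k beta \<noteq> 0" "jTheta k 0 \<noteq> 0"
    using jTheta_of_real_nonzero[OF k, of y] jTheta_of_real_nonzero[OF k, of alpha]
      beta_set_jTheta_nonzero[OF k bs(1)] jTheta_of_real_nonzero[OF k, of 0] by simp_all
  define S E where "S = (jsn k y)\<^sup>2" and "E = 1 - (z1 - z2) / (z1 + z3) * S"
  have D: "(z1 + z3) - (z1 - z2) * S = (z1 + z3) * E" using z by (simp add: E_def field_simps)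
  have E: "E \<noteq> 0" using D den_bounds(3)[OF z' z(2,3), of x] by (auto simp: S_def k_def y_def)
  have 1: "jTheta k (of_real y - of_real alpha) * jTheta k (of_real y + of_real alpha)
     = (jTheta k (of_real y))\<^sup>2 * (jTheta k (of_real alpha))\<^sup>2 * of_real E / (jTheta k 0)\<^sup>2"
    using theta_denominator[OF z a, of y] nz(4) by (simp add: k_def E_def S_def eq_divide_eq)
  have 2: "jH k (of_real y - beta) * jH k (of_real y + beta)
     = of_real k * (jTheta k (of_real y))\<^sup>2 * (jTheta k beta)\<^sup>2 * of_real (S - R) / (jTheta k 0)\<^sup>2"
    using jH_addition[OF k nz(1,3)] nz(4)
    by (simp add: jsnC_of_real[OF k] bs(2) S_def eq_divide_eq mult_ac)
  have 3: "(jH k beta)\<^sup>2 = of_real k * of_real R * (jTheta k beta)\<^sup>2"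
    unfolding jH_eq[OF k nz(3)] power_mult_distrib bs(2) using k by (simp flip: of_real_power)
  have "profA z1 z2 z3 alpha beta x
     = of_real (z1 - z2 - z3) * (jH k (of_real y - beta) * jH k (of_real y + beta))
       / (jTheta k (of_real y - of_real alpha) * jTheta k (of_real y + of_real alpha))
       * ((jTheta k (of_real alpha))\<^sup>2 / (jH k beta)\<^sup>2)"
    by (simp only: profA_def Let_def k_def y_def)
  also have "\<dots> = of_real ((z1 - z2 - z3) * (S - R) / (E * R))"
    unfolding 1 2 3 using nz E R k by (simp add: field_simps)
  also have "(z1 - z2 - z3) * (S - R) / (E * R) = prof z1 z2 z3 x"
  proof -
    have "(z1 - z2 - z3) * (S - R) / R = (z1 - z2 - z3) * (S / R - 1)" using R by (simp add: field_simps)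
    also have "\<dots> = S * ((z1 - z2) * (z1 + z2 + z3)) / (z1 + z3) - (z1 - z2 - z3)"
    proof -
      have "w * (S / (A * w / p) - 1) = S * p / A - w" if "A \<noteq> 0" "w \<noteq> 0" "p \<noteq> 0" for A w p :: real
        using that by (simp add: field_simps)
      from this[of "z1 + z3" "z1 - z2 - z3" "(z1 - z2) * (z1 + z2 + z3)"] show ?thesis
        using z ne unfolding R_def beta_sq_def by simp
    qed
    finally have "(z1 - z2 - z3) * (S - R) / (E * R) = (S * ((z1 - z2) * (z1 + z2 + z3)) / (z1 + z3) - (z1 - z2 - z3)) / E"
      by (metis divide_divide_eq_left' mult.commute)
    also have "\<dots> = - (z1 + z2 + z3) + 2 * (z1 + z3) * (z2 + z3) / ((z1 + z3) * E)"
    proof -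
      have "S * ((z1 - z2) * (z1 + z2 + z3)) / (z1 + z3) - (z1 - z2 - z3) = - (z1 + z2 + z3) * E + 2 * (z2 + z3)"
        using z by (simp add: E_def field_simps)
      then show ?thesis using cancel_common_factor[of "z1 + z3" E "z1 + z2 + z3" "z2 + z3"] E z by simp
    qed
    also have "\<dots> = prof z1 z2 z3 x" unfolding D[symmetric] by (simp only: prof_def S_def k_def y_def)
    finally show ?thesis .
  qed
  finally show ?thesis ..
qed

text \<open>Here sn(beta) would be 0 and H(beta) would vanish in the denominator of the general
  formula. The profile has its double zeros where sn vanishes, and the factor sn^2 Theta^2 supplies
  them directly.\<close>

lemma prof_eq_profB:
  assumes z: "0 < z3" "z3 < z2" "z2 < z1" and eq: "z1 = z2 + z3" and a: "alpha_ok z1 z2 z3 alpha"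
  shows "complex_of_real (prof z1 z2 z3 x) = profB z1 z2 z3 alpha x"
proof -
  define k where "k = zk z1 z2 z3"
  define y where "y = znu z1 z2 z3 * x"
  have z': "- z2 < z3" using z by simp
  have k: "0 < k" "k < 1" using zk_bounds[OF z' z(2,3)] by (simp_all add: k_def)
  have nz: "jTheta k (of_real y) \<noteq> 0" "jTheta k (of_real alpha) \<noteq> 0" "jTheta k 0 \<noteq> 0"
    using jTheta_of_real_nonzero[OF k, of y] jTheta_of_real_nonzero[OF k, of alpha] jTheta_of_real_nonzero[OF k, of 0] by simp_all
  define S E where "S = (jsn k y)\<^sup>2" and "E = 1 - (z1 - z2) / (z1 + z3) * S"
  have D: "(z1 + z3) - (z1 - z2) * S = (z1 + z3) * E" using z by (simp add: E_def field_simps)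
  have E: "E \<noteq> 0" using D den_bounds(3)[OF z' z(2,3), of x] by (auto simp: S_def k_def y_def)
  have 1: "jTheta k (of_real y - of_real alpha) * jTheta k (of_real y + of_real alpha)
     = (jTheta k (of_real y))\<^sup>2 * (jTheta k (of_real alpha))\<^sup>2 * of_real E / (jTheta k 0)\<^sup>2"
    using theta_denominator[OF z a, of y] nz(3) by (simp add: k_def E_def S_def eq_divide_eq)
  have "profB z1 z2 z3 alpha x
     = of_real (2 * (z2 + z3) * z3 * S) * (jTheta k (of_real y))\<^sup>2 * (jTheta k (of_real alpha))\<^sup>2
       / (of_real (z2 + 2 * z3) * (jTheta k (of_real y - of_real alpha) * jTheta k (of_real y + of_real alpha)) * (jTheta k 0)\<^sup>2)"
    by (simp only: profB_def Let_def k_def y_def S_def mult.assoc)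
  also have "\<dots> = of_real (2 * (z2 + z3) * z3 * S / ((z2 + 2 * z3) * E))"
    unfolding 1 using nz E by simp
  also have "2 * (z2 + z3) * z3 * S / ((z2 + 2 * z3) * E) = prof z1 z2 z3 x"
  proof -
    have "prof z1 z2 z3 x = - (z1 + z2 + z3) + 2 * (z1 + z3) * (z2 + z3) / ((z1 + z3) * E)"
      unfolding D[symmetric] by (simp only: prof_def S_def k_def y_def)
    also have "\<dots> = (- (z1 + z2 + z3) * E + 2 * (z2 + z3)) / E"
      using E z by (intro cancel_common_factor) auto
    also have "- (z1 + z2 + z3) * E + 2 * (z2 + z3) = 2 * (z2 + z3) * z3 * S / (z2 + 2 * z3)"
      using z unfolding E_def eq by (simp add: field_simps)
    finally show ?thesis by simp
  qed
  finally show ?thesis ..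
qed

lemma periodic_sol_iff:
  "(\<exists>phi. is_sol b c phi \<and> bpnc phi) \<longleftrightarrow> (c > 0 \<and> - bcrit c < b \<and> b < bcrit c)"
proof
  assume "\<exists>phi. is_sol b c phi \<and> bpnc phi"
  then obtain phi where phi: "is_sol b c phi" "bpnc phi" by blast
  obtain x0 z1 z2 z3 where z: "- z2 < z3" "z3 < z2" "z2 < z1" "b = zb z1 z2 z3" "c = zc z1 z2 z3"
    by (rule periodic_sol_shape[OF phi]) (rule that; assumption)
  show "c > 0 \<and> - bcrit c < b \<and> b < bcrit c"
    using zb_zc_bounds[OF z(1-3)] unfolding z(4,5) by linarith
next
  assume "c > 0 \<and> - bcrit c < b \<and> b < bcrit c"
  then have "0 < c" "- bcrit c < b" "b < bcrit c" by auto
  then obtain z1 z2 z3 where z: "- z2 < z3" "z3 < z2" "z2 < z1" "b = zb z1 z2 z3" "c = zc z1 z2 z3"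
    by (rule zeta_exists)
  show "\<exists>phi. is_sol b c phi \<and> bpnc phi"
    using prof_is_sol[OF z(1-3)] prof_bpnc[OF z(1-3)] unfolding z(4,5) by blast
qed

lemma zeta_param_ex1:
  assumes b: "0 < b" and phi: "is_sol b c phi" "bpnc phi"
  shows "\<exists>!(z1, z2, z3). 0 < z3 \<and> z3 < z2 \<and> z2 < z1 \<and>
            b = zb z1 z2 z3 \<and> c = zc z1 z2 z3 \<and> invariant b c (zd z1 z2 z3) phi"
proof -
  obtain x0 z1 z2 z3 where z: "0 < z3" "z3 < z2" "z2 < z1" "b = zb z1 z2 z3" "c = zc z1 z2 z3"
    "invariant b c (zd z1 z2 z3) phi"
    by (rule periodic_sol_pos_shape[OF phi b]) (rule that; assumption)
  show ?thesis
  proof (rule ex1I[of _ "(z1, z2, z3)"])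
    fix w assume "case w of (w1, w2, w3) \<Rightarrow> 0 < w3 \<and> w3 < w2 \<and> w2 < w1 \<and>
            b = zb w1 w2 w3 \<and> c = zc w1 w2 w3 \<and> invariant b c (zd w1 w2 w3) phi"
    then obtain w1 w2 w3 where w: "w = (w1, w2, w3)" "0 < w3" "w3 < w2" "w2 < w1" "b = zb w1 w2 w3"
      "c = zc w1 w2 w3" "invariant b c (zd w1 w2 w3) phi" by auto
    have "w1 = z1 \<and> w2 = z2 \<and> w3 = z3"
      by (rule zeta_unique[OF w(2-4) z(1-3)])
         (use w z invariant_unique[OF w(7) z(6)] in auto)
    then show "w = (z1, z2, z3)" using w(1) by simp
  qed (use z in auto)
qed

theorem theorem1:
  shows
    "(\<forall>b c. (\<exists>phi. is_sol b c phi \<and> bpnc phi) \<longleftrightarrow> (c > 0 \<and> - bcrit c < b \<and> b < bcrit c))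
     \<and>
     (\<forall>b c phi. c > 0 \<and> 0 < b \<and> b < bcrit c \<and> is_sol b c phi \<and> bpnc phi \<longrightarrow>
        (\<exists>!(z1, z2, z3). 0 < z3 \<and> z3 < z2 \<and> z2 < z1 \<and>
            b = zb z1 z2 z3 \<and> c = zc z1 z2 z3 \<and> invariant b c (zd z1 z2 z3) phi))
     \<and>
     (\<forall>z1 z2 z3. 0 < z3 \<and> z3 < z2 \<and> z2 < z1 \<longrightarrow>
        0 < zb z1 z2 z3 \<and> zb z1 z2 z3 < bcrit (zc z1 z2 z3) \<and>
        (\<exists>psi. is_sol (zb z1 z2 z3) (zc z1 z2 z3) psi \<and> bpnc psi \<and>
               invariant (zb z1 z2 z3) (zc z1 z2 z3) (zd z1 z2 z3) psi))
     \<and>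
     (\<forall>z1 z2 z3. 0 < z3 \<and> z3 < z2 \<and> z2 < z1 \<and> z1 \<noteq> z2 + z3 \<longrightarrow>
        0 < znu z1 z2 z3 \<and> 0 < zk z1 z2 z3 \<and> zk z1 z2 z3 < 1 \<and>
        (\<exists>!alpha. alpha_ok z1 z2 z3 alpha) \<and>
        (\<exists>!beta. beta_ok z1 z2 z3 beta) \<and>
        (\<forall>beta. beta_ok z1 z2 z3 beta \<longrightarrow>
           (z1 > z2 + z3 \<longrightarrow> beta \<in> complex_of_real ` {0<..<ellK (zk z1 z2 z3)}) \<and>
           (z1 < z2 + z3 \<longrightarrow> beta \<in> (\<lambda>v. \<i> * complex_of_real v) ` {0<..<ellK' (zk z1 z2 z3)})) \<and>
        (\<forall>alpha beta phi. alpha_ok z1 z2 z3 alpha \<and> beta_ok z1 z2 z3 beta \<and>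
           is_sol (zb z1 z2 z3) (zc z1 z2 z3) phi \<and> bpnc phi \<and>
           invariant (zb z1 z2 z3) (zc z1 z2 z3) (zd z1 z2 z3) phi \<longrightarrow>
           (\<exists>x0. \<forall>x. complex_of_real (phi (x + x0)) = profA z1 z2 z3 alpha beta x)))
     \<and>
     (\<forall>z1 z2 z3. 0 < z3 \<and> z3 < z2 \<and> z2 < z1 \<and> z1 = z2 + z3 \<longrightarrow>
        0 < znu z1 z2 z3 \<and> 0 < zk z1 z2 z3 \<and> zk z1 z2 z3 < 1 \<and>
        (\<exists>!alpha. alpha_ok z1 z2 z3 alpha) \<and>
        (\<forall>alpha phi. alpha_ok z1 z2 z3 alpha \<and>
           is_sol (zb z1 z2 z3) (zc z1 z2 z3) phi \<and> bpnc phi \<and>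
           invariant (zb z1 z2 z3) (zc z1 z2 z3) (zd z1 z2 z3) phi \<longrightarrow>
           (\<exists>x0. \<forall>x. complex_of_real (phi (x + x0)) = profB z1 z2 z3 alpha x)))"
proof (intro conjI allI impI; (elim conjE)?)
  fix b c
  show "(\<exists>phi. is_sol b c phi \<and> bpnc phi) \<longleftrightarrow> (c > 0 \<and> - bcrit c < b \<and> b < bcrit c)"
    by (rule periodic_sol_iff)
next
  fix b c phi assume "0 < b" "is_sol b c phi" "bpnc phi"
  then show "\<exists>!(z1, z2, z3). 0 < z3 \<and> z3 < z2 \<and> z2 < z1 \<and>
            b = zb z1 z2 z3 \<and> c = zc z1 z2 z3 \<and> invariant b c (zd z1 z2 z3) phi"
    by (rule zeta_param_ex1)
next
  fix z1 z2 z3 :: real assume z: "0 < z3" "z3 < z2" "z2 < z1"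
  have z': "- z2 < z3" using z by simp
  show "0 < zb z1 z2 z3" using z by (simp add: zb_def)
  show "zb z1 z2 z3 < bcrit (zc z1 z2 z3)" using zb_zc_bounds(2)[OF z' z(2,3)] by simp
  show "\<exists>psi. is_sol (zb z1 z2 z3) (zc z1 z2 z3) psi \<and> bpnc psi \<and>
               invariant (zb z1 z2 z3) (zc z1 z2 z3) (zd z1 z2 z3) psi"
    using prof_is_sol[OF z' z(2,3)] prof_bpnc[OF z' z(2,3)] prof_invariant[OF z' z(2,3)] by blast
next
  fix z1 z2 z3 :: real assume z: "0 < z3" "z3 < z2" "z2 < z1" and ne: "z1 \<noteq> z2 + z3"
  have z': "- z2 < z3" using z by simp
  show "0 < znu z1 z2 z3" "0 < zk z1 z2 z3" "zk z1 z2 z3 < 1"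
    using znu_pos[OF z' z(2,3)] zk_bounds[OF z' z(2,3)] by auto
  show "\<exists>!alpha. alpha_ok z1 z2 z3 alpha" by (rule alpha_ok_ex1[OF z])
  show "\<exists>!beta. beta_ok z1 z2 z3 beta"
    using beta_real_case(1)[OF z] beta_imag_case(1)[OF z] ne by (cases "z2 + z3 < z1") auto
next
  fix z1 z2 z3 :: real and beta assume z: "0 < z3" "z3 < z2" "z2 < z1" and "beta_ok z1 z2 z3 beta" "z2 + z3 < z1"
  then show "beta \<in> complex_of_real ` {0<..<ellK (zk z1 z2 z3)}" using beta_real_case(2) by blast
next
  fix z1 z2 z3 :: real and beta assume z: "0 < z3" "z3 < z2" "z2 < z1" and "beta_ok z1 z2 z3 beta" "z1 < z2 + z3"
  then show "beta \<in> (\<lambda>v. \<i> * complex_of_real v) ` {0<..<ellK' (zk z1 z2 z3)}" using beta_imag_case(2) by blast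
next
  fix z1 z2 z3 :: real and alpha beta phi assume z: "0 < z3" "z3 < z2" "z2 < z1" and ne: "z1 \<noteq> z2 + z3"
    and ab: "alpha_ok z1 z2 z3 alpha" "beta_ok z1 z2 z3 beta"
    and phi: "is_sol (zb z1 z2 z3) (zc z1 z2 z3) phi" "bpnc phi"
      "invariant (zb z1 z2 z3) (zc z1 z2 z3) (zd z1 z2 z3) phi"
  obtain x0 where e: "\<And>x. phi (x + x0) = prof z1 z2 z3 x"
    by (rule periodic_sol_eq_prof[OF z phi]) (rule that; assumption)
  show "\<exists>x0. \<forall>x. complex_of_real (phi (x + x0)) = profA z1 z2 z3 alpha beta x"
    by (intro exI[of _ x0] allI, unfold e) (rule prof_eq_profA[OF z ne ab])
next
  fix z1 z2 z3 :: real assume z: "0 < z3" "z3 < z2" "z2 < z1"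
  have z': "- z2 < z3" using z by simp
  show "0 < znu z1 z2 z3" "0 < zk z1 z2 z3" "zk z1 z2 z3 < 1"
    using znu_pos[OF z' z(2,3)] zk_bounds[OF z' z(2,3)] by auto
  show "\<exists>!alpha. alpha_ok z1 z2 z3 alpha" by (rule alpha_ok_ex1[OF z])
next
  fix z1 z2 z3 :: real and alpha phi assume z: "0 < z3" "z3 < z2" "z2 < z1" and eq: "z1 = z2 + z3"
    and a: "alpha_ok z1 z2 z3 alpha"
    and phi: "is_sol (zb z1 z2 z3) (zc z1 z2 z3) phi" "bpnc phi"
      "invariant (zb z1 z2 z3) (zc z1 z2 z3) (zd z1 z2 z3) phi"
  obtain x0 where e: "\<And>x. phi (x + x0) = prof z1 z2 z3 x"
    by (rule periodic_sol_eq_prof[OF z phi]) (rule that; assumption)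
  show "\<exists>x0. \<forall>x. complex_of_real (phi (x + x0)) = profB z1 z2 z3 alpha x"
    by (intro exI[of _ x0] allI, unfold e) (rule prof_eq_profB[OF z eq a])
qed

end
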